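(* Let $\varphi:\mathbb{R}\to\mathbb{R}$ be infinitely differentiable with $\varphi''>0$ everywhere, and for $(\xi,\tau)\in\mathbb{R}^2$ define $$\Lambda(\xi,\tau)=\int_{-\infty}^{\infty}\exp\left(-2s^4+\tau s^2-\xi s\right)ds,\qquad w_{1,0}(\xi,\tau)=-\frac{2}{\varphi''(0)\,\Lambda(\xi,\tau)}\,\frac{\partial\Lambda(\xi,\tau)}{\partial\xi}.$$ Let $0<\gamma_1<\gamma_2<2$. Let $H(\xi,\tau)$ be the Whitney fold function, $H^3-\tau H+\xi=0$ (with the branch specified in the context). Then $w_{1,0}$ satisfies the following asymptotic relations. (1) In the domain $$\Omega_1=\mathbb{R}^2\setminus\{(\xi,\tau): |\xi|<\tau^{\gamma_1-1/2},\ \tau>0\}$$ one has the asymptotic expansion $$w_{1,0}(\xi,\tau)=[\varphi''(0)]^{-1}H(\xi,\tau)+\sum_{l=1}^{\infty}h_{1-4l}(\xi,\tau),\qquad 3[H(\xi,\tau)]^2-\tau\to\infty,\quad (\xi,\tau)\in\Omega_1,$$ where the $h_l(\xi,\tau)$ are homogeneous functions of power $l$ in $H(\xi,\tau)$, $\sqrt{-\tau}$ and $\sqrt{3[H(\xi,\tau)]^2-\tau}$, which are polynomials in $H(\xi,\tau)$, $\tau$ and $(3[H(\xi,\tau)]^2-\tau)^{-1}$. (2) In the domain $$\Omega_2=\{(\xi,\tau): |\xi|\tau^{1/2}<\tau^{\gamma_2},\ \tau>0\}$$ one has the asymptotic expansion $$w_{1,0}(\xi,\tau)=\sqrt{\tau}\left(-\frac{\tanh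 z}{\varphi''(0)}+\sum_{k=1}^{\infty}\tau^{-2k}q_k(z)\right),\qquad \tau\to+\infty,\quad (\xi,\tau)\in\Omega_2,$$ where $z=\xi\sqrt{\tau}/2$, the functions $q_k\in C^\infty(\mathbb{R})$ are solutions of a recurrence system of ordinary differential equations, and $|q_k(z)|\leqslant M_k(1+|z|^k)$ for all $z\in\mathbb{R}$ with constants $M_k$.
   Context: The function $w_{1,0}$ is a solution of the Burgers equation $\frac{\partial w}{\partial\tau}+\varphi''(0)\,w\frac{\partial w}{\partial\xi}-\frac{\partial^2 w}{\partial\xi^2}=0$. Branch of $H$: $H(\xi,\tau)$ is the real root of $H^3-\tau H+\xi=0$ for which $s=H/2$ is the global maximum point of $s\mapsto -2s^4+\tau s^2-\xi s$; that is, for $\xi\ne0$, the unique real root of sign opposite to that of $\xi$, and for $\xi=0$, $\tau\leqslant 0$, $H=0$. The points with $\xi=0$, $\tau>0$ do not belong to $\Omega_1$. The infinite series are understood as asymptotic series in the indicated limits. "Homogeneous of power $l$" means that $H$, $\sqrt{-\tau}$ and $\sqrt{3H^2-\tau}$ are each assigned weight $1$ (so $\tau$ has weight $2$ and $(3H^2-\tau)^{-1}$ has weight $-2$) and every monomial has total weight $l$. The recurrence system for $q_k$ is the one obtained by substituting the series in (2) into the Burgers equation above, with $z=\xi\sqrt{\tau}/2$, and equating coefficients of equal powers of $\tau$. *)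

theory Defs
  imports
    "HOL-Analysis.Analysis"
    "HOL-Library.Landau_Symbols"
    "HOL-Library.Poly_Mapping"
begin

definition smooth :: "(real \<Rightarrow> real) \<Rightarrow> bool" where
  "smooth f \<longleftrightarrow> (\<forall>n x. (deriv ^^ n) f differentiable (at x))"

definition phase :: "real \<Rightarrow> real \<Rightarrow> real \<Rightarrow> real" where
  "phase \<xi> \<tau> s = - 2 * s ^ 4 + \<tau> * s\<^sup>2 - \<xi> * s"

definition Lam :: "real \<Rightarrow> real \<Rightarrow> real" where
  "Lam \<xi> \<tau> = (LINT s|lborel. exp (phase \<xi> \<tau> s))"

definition w10 :: "(real \<Rightarrow> real) \<Rightarrow> real \<Rightarrow> real \<Rightarrow> real" where
  "w10 \<phi> \<xi> \<tau> = - (2 / (deriv (deriv \<phi>) 0 * Lam \<xi> \<tau>)) * deriv (\<lambda>x. Lam x \<tau>) \<xi>"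

(* For \<xi> = 0 and \<tau> > 0 there are two such roots, so H is unspecified there;
   these points lie outside \<Omega>\<^sub>1. *)
definition H :: "real \<Rightarrow> real \<Rightarrow> real" where
  "H \<xi> \<tau> = (THE h. h ^ 3 - \<tau> * h + \<xi> = 0 \<and> (\<forall>s. phase \<xi> \<tau> s \<le> phase \<xi> \<tau> (h / 2)))"

definition Omega1 :: "real \<Rightarrow> (real \<times> real) set" where
  "Omega1 \<gamma>\<^sub>1 = UNIV - {(\<xi>, \<tau>). \<bar>\<xi>\<bar> < \<tau> powr (\<gamma>\<^sub>1 - 1 / 2) \<and> \<tau> > 0}"

definition Omega2 :: "real \<Rightarrow> (real \<times> real) set" where
  "Omega2 \<gamma>\<^sub>2 = {(\<xi>, \<tau>). \<bar>\<xi>\<bar> * \<tau> powr (1 / 2) < \<tau> powr \<gamma>\<^sub>2 \<and> \<tau> > 0}"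

(* Asymptotic series along the filter F with respect to the asymptotic scale g. Over a
   filter on pairs (\<xi>, \<tau>) the Landau symbols are uniform in both variables. *)
definition asymptotic_series ::
  "'a filter \<Rightarrow> ('a \<Rightarrow> real) \<Rightarrow> (nat \<Rightarrow> 'a \<Rightarrow> real) \<Rightarrow> (nat \<Rightarrow> 'a \<Rightarrow> real) \<Rightarrow> bool" where
  "asymptotic_series F f a g \<longleftrightarrow>
     (\<forall>n. g (Suc n) \<in> o[F](g n)) \<and>
     (\<forall>n. (\<lambda>x. f x - (\<Sum>k<n. a k x)) \<in> O[F](g n))"

(* An exponent triple (i, j, k) stands for the monomial H^i * \<tau>^j * (3 H^2 - \<tau>)^(-k). *)
definition eval_poly3 :: "((nat \<times> nat \<times> nat) \<Rightarrow>\<^sub>0 real) \<Rightarrow> real \<Rightarrow> real \<Rightarrow> real" where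
  "eval_poly3 P \<xi> \<tau> =
     (\<Sum>(i, j, k)\<in>Poly_Mapping.keys P. Poly_Mapping.lookup P (i, j, k) *
        H \<xi> \<tau> ^ i * \<tau> ^ j * inverse (3 * (H \<xi> \<tau>)\<^sup>2 - \<tau>) ^ k)"

(* H has weight 1, \<tau> has weight 2 and (3 H^2 - \<tau>)^(-1) has weight -2. *)
definition homogeneous_of_power :: "((nat \<times> nat \<times> nat) \<Rightarrow>\<^sub>0 real) \<Rightarrow> int \<Rightarrow> bool" where
  "homogeneous_of_power P l \<longleftrightarrow>
     (\<forall>(i, j, k)\<in>Poly_Mapping.keys P. int i + 2 * int j - 2 * int k = l)"

(* The coefficient of \<tau> powr (3/2 - 2 k) in  w_\<tau> + a w w_\<xi> - w_\<xi>\<xi>  for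
     w = sqrt \<tau> * (\<Sum>k. q k z / \<tau>^(2 k)),   z = \<xi> * sqrt \<tau> / 2.
   By the chain rule, with z_\<tau> = z / (2 \<tau>) and z_\<xi> = sqrt \<tau> / 2,
     w_\<tau>  = (\<Sum>k. \<tau> powr (-1/2 - 2 k) * ((1/2 - 2 k) q k z + z/2 * (q k)' z)),
     w_\<xi>  = 1/2 * (\<Sum>k. \<tau> powr (1 - 2 k) * (q k)' z),
     w_\<xi>\<xi> = 1/4 * (\<Sum>k. \<tau> powr (3/2 - 2 k) * (q k)'' z),
   so that w_\<tau> contributes through q (k - 1). *)
definition burgers_coeff :: "real \<Rightarrow> (nat \<Rightarrow> real \<Rightarrow> real) \<Rightarrow> nat \<Rightarrow> real \<Rightarrow> real" where
  "burgers_coeff a q k z =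
     (if k = 0 then 0
      else (1 / 2 - 2 * real (k - 1)) * q (k - 1) z + z / 2 * deriv (q (k - 1)) z)
     + a * (1 / 2 * (\<Sum>i\<le>k. q i z * deriv (q (k - i)) z))
     - 1 / 4 * deriv (deriv (q k)) z"

end

theory Submission
  imports Defs "HOL-Probability.Sinc_Integral" "HOL-Real_Asymp.Real_Asymp"
begin

text \<open>
  Let \<open>avg \<xi> \<tau> g\<close> be the mean of \<open>g\<close> for the probability density proportional to
  \<open>exp (phase \<xi> \<tau> s)\<close>. Differentiating \<open>Lam\<close> under the integral sign shows that \<open>w10\<close> is
  \<open>2 / \<phi>''(0)\<close> times the mean of \<open>s\<close> (\<open>w10_eq_avg\<close>), so both claims concern the mean of a quartic
  density. Integration by parts, \<open>avg p' = avg (p * (8 s^3 - 2 \<tau> s + \<xi>))\<close>, gives exact linear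
  recurrences between moments. In suitable coordinates each recurrence expresses a moment through
  moments that are multiplied by a small factor or that are smaller themselves. Rough bounds on the
  size of all moments, fed into the recurrence again and again, therefore improve to expansions of
  all moments to any order. No integrand is expanded and no series are divided.

  In \<open>\<Omega>\<^sub>1\<close> the coordinate is \<open>u = s - H/2\<close>, the distance to the maximum of the phase, which there equals
  its maximal value minus \<open>D u^2 + 4 H u^3 + 2 u^4\<close> with \<open>D = 3 H^2 - \<tau>\<close>. The \<open>n\<close>-th moment has size
  \<open>D^(-n/2)\<close> (\<open>moment_bound\<close>): the phase may have a second local maximum near \<open>u = -H\<close>, but in \<open>\<Omega>\<^sub>1\<close>
  its weight relative to the first one is exponentially small in a power of \<open>D\<close>. The recurrence only involves
  \<open>H\<close> and \<open>1/D\<close>, so the terms of the expansion are polynomials in these, and they inherit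
  homogeneity from it (\<open>moment_expansion\<close>, \<open>homogeneous_laplace_coeff\<close>).

  In \<open>\<Omega>\<^sub>2\<close> both maxima count. In terms of \<open>r = 2 s / \<surd>\<tau>\<close> they lie near \<open>r = 1\<close> and \<open>r = -1\<close>, which
  suggests \<open>x = r^2 - 1\<close> and the moments \<open>A\<^sub>n = avg (x^n)\<close>, \<open>B\<^sub>n = avg (r x^n)\<close> as functions of \<open>z\<close> and
  \<open>\<epsilon> = 8/\<tau>^2\<close>. Their size is governed by \<open>\<sigma> = (1 + |z|) \<epsilon>\<close> (\<open>momA_even_bigo\<close>), and the recurrences
  determine \<open>A\<^sub>n\<close> and \<open>B\<^sub>n\<close>, \<open>n \<ge> 1\<close>, up to \<open>O(\<sigma>^(N+1))\<close> from the moments up to \<open>O(\<sigma>^N)\<close>. They leave \<open>B\<^sub>0\<close>,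
  the rescaled mean of \<open>s\<close>, undetermined. It solves the Riccati equation
  \<open>\<partial>B\<^sub>0/\<partial>z = B\<^sub>0^2 - 1 - A\<^sub>1\<close> and vanishes at \<open>z = 0\<close>. To leading order \<open>B\<^sub>0 = - tanh z\<close>, around which the
  equation is contracting away from \<open>z = 0\<close>; hence the error in \<open>A\<^sub>1\<close> carries over to \<open>B\<^sub>0\<close>
  up to a constant factor, uniformly in \<open>z\<close> (\<open>stable_linear_ode_bound\<close>). Alternating the two steps
  yields \<open>inner_expansion\<close>.

  The coefficients \<open>q\<^sub>k\<close> come from solving the recurrences and the Riccati equation order by order in
  \<open>\<epsilon>\<close>; each one arises from a polynomial in \<open>z\<close> and its predecessors by a bounded solution operator, which
  gives smoothness and growth. Burgers' equation for them is an identity between formal power series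
  in \<open>\<epsilon>\<close>. It amounts to the rules by which the \<open>z\<close>-derivative and the \<open>\<epsilon>\<close>-derivative act on \<open>A\<^sub>n\<close> and \<open>B\<^sub>n\<close>.
  The defects of these rules satisfy the homogeneous form of the recurrences, and for such families
  \<open>moment_system_zero\<close> gives uniqueness (\<open>serA'_eq\<close>, \<open>eps_defect_0\<close>).
\<close>

section \<open>Averages against the quartic weight\<close>

definition weighted_integral :: "real \<Rightarrow> real \<Rightarrow> (real \<Rightarrow> real) \<Rightarrow> real" where
  "weighted_integral \<xi> \<tau> g = (LINT s|lborel. g s * exp (phase \<xi> \<tau> s))"

definition avg :: "real \<Rightarrow> real \<Rightarrow> (real \<Rightarrow> real) \<Rightarrow> real" where
  "avg \<xi> \<tau> g = weighted_integral \<xi> \<tau> g / Lam \<xi> \<tau>"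

text \<open>
  The quartic term dominates any linear exponential growth and a Gaussian on top of it. All questions of
  integrability and of decay at infinity reduce to this.
\<close>

lemma phase_le_neg_square:
  assumes "c \<ge> 0"
  obtains K where "\<And>s. c * \<bar>s\<bar> + phase \<xi> \<tau> s \<le> K - s\<^sup>2"
proof -
  define B where "B = \<bar>\<tau>\<bar> + 1 + \<bar>\<xi>\<bar> + c"
  have "c * \<bar>s\<bar> + phase \<xi> \<tau> s \<le> (B\<^sup>2 + B) - s\<^sup>2" for s :: real
  proof -
    have s: "\<bar>s\<bar> \<le> 1 + s\<^sup>2"
      using zero_le_power2[of "\<bar>s\<bar> - 1"] zero_le_power2[of s] by (simp add: power2_diff)
    have 1: "c * \<bar>s\<bar> \<le> c * (1 + s\<^sup>2)" using s assms by (rule mult_left_mono)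
    have 2: "- \<xi> * s \<le> \<bar>\<xi>\<bar> * (1 + s\<^sup>2)"
    proof -
      have "- \<xi> * s \<le> \<bar>\<xi>\<bar> * \<bar>s\<bar>" by (metis abs_ge_self abs_minus abs_mult)
      also have "\<dots> \<le> \<bar>\<xi>\<bar> * (1 + s\<^sup>2)" using s by (intro mult_left_mono) auto
      finally show ?thesis .
    qed
    have 3: "\<tau> * s\<^sup>2 \<le> \<bar>\<tau>\<bar> * (1 + s\<^sup>2)"
      by (intro mult_mono) auto
    have 4: "B * s\<^sup>2 - 2 * s^4 \<le> B\<^sup>2"
    proof -
      have "B\<^sup>2 + 2 * s^4 - B * s\<^sup>2 = (B - s\<^sup>2/2)\<^sup>2 + 7/4 * (s\<^sup>2)\<^sup>2"
        by (simp add: power2_eq_square power4_eq_xxxx algebra_simps)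
      also have "\<dots> \<ge> 0" by simp
      finally show ?thesis by linarith
    qed
    have "c * \<bar>s\<bar> + phase \<xi> \<tau> s + s\<^sup>2 \<le> B * (1 + s\<^sup>2) - 2 * s^4"
      unfolding phase_def B_def using 1 2 3 zero_le_power2[of s] by (simp add: algebra_simps)
    also have "\<dots> \<le> B\<^sup>2 + B" using 4 by (simp add: algebra_simps)
    finally show ?thesis by linarith
  qed
  thus ?thesis using that by blast
qed

lemma continuous_phase [continuous_intros]:
  "continuous_on A (\<lambda>s. phase \<xi> \<tau> s)"
  unfolding phase_def by (intro continuous_intros)

lemma measurable_phase [measurable]: "phase \<xi> \<tau> \<in> borel_measurable borel"
  by (rule borel_measurable_continuous_onI) (rule continuous_phase)

lemma integrable_exp_growth:
  assumes [measurable]: "g \<in> borel_measurable borel"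
    and g: "\<And>s. \<bar>g s\<bar> \<le> C * exp (c * \<bar>s\<bar>)" and c: "c \<ge> 0"
  shows "integrable lborel (\<lambda>s. g s * exp (phase \<xi> \<tau> s))"
proof -
  obtain K where K: "\<And>s. c * \<bar>s\<bar> + phase \<xi> \<tau> s \<le> K - s\<^sup>2"
    using phase_le_neg_square[OF c] by blast
  have C: "C \<ge> 0" using g[of 0] by simp
  have "integrable lborel (\<lambda>x::real. inverse (1 + x^2))"
    using integrable_inverse_1_plus_square by (simp add: set_integrable_def)
  hence I: "integrable lborel (\<lambda>x::real. C * exp K * inverse (1 + x^2))"
    by (rule integrable_mult_right)
  show ?thesis
  proof (rule Bochner_Integration.integrable_bound[OF I])
    show "AE s in lborel. norm (g s * exp (phase \<xi> \<tau> s)) \<le> norm (C * exp K * inverse (1 + s\<^sup>2))"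
    proof (rule AE_I2)
      fix s :: real
      have "\<bar>g s * exp (phase \<xi> \<tau> s)\<bar> \<le> C * exp (c * \<bar>s\<bar>) * exp (phase \<xi> \<tau> s)"
        using g[of s] by (simp add: abs_mult)
      also have "\<dots> = C * exp (c * \<bar>s\<bar> + phase \<xi> \<tau> s)" by (simp add: exp_add)
      also have "\<dots> \<le> C * exp (K - s\<^sup>2)" using K C by (intro mult_left_mono) auto
      also have "\<dots> = C * exp K * exp (- s\<^sup>2)" by (simp add: exp_diff exp_minus field_simps)
      also have "\<dots> \<le> C * exp K * inverse (1 + s\<^sup>2)"
      proof (intro mult_left_mono)
        have "1 + s\<^sup>2 \<le> exp (s\<^sup>2)" by (rule exp_ge_add_one_self)
        thus "exp (- s\<^sup>2) \<le> inverse (1 + s\<^sup>2)" unfolding exp_minus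
          by (intro le_imp_inverse_le) (auto simp: add_pos_nonneg)
      qed (use C in auto)
      finally show "norm (g s * exp (phase \<xi> \<tau> s)) \<le> norm (C * exp K * inverse (1 + s\<^sup>2))"
        using C by (simp add: add_nonneg_nonneg)
    qed
    show "(\<lambda>s. g s * exp (phase \<xi> \<tau> s)) \<in> borel_measurable lborel"
      by measurable
  qed
qed

lemma polynomial_exp_growth:
  assumes "real_polynomial_function (p :: real \<Rightarrow> real)"
  shows "\<exists>C c. c \<ge> 0 \<and> C \<ge> 0 \<and> (\<forall>s. \<bar>p s\<bar> \<le> C * exp (c * \<bar>s\<bar>))"
  using assms
proof (induction p rule: real_polynomial_function.induct)
  case (linear f)
  then obtain k where k: "f = (\<lambda>x. x * k)" using real_bounded_linear by blast
  have "\<bar>s\<bar> \<le> exp \<bar>s\<bar>" for s :: real using exp_ge_add_one_self[of "\<bar>s\<bar>"] by linarith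
  hence "\<forall>s. \<bar>f s\<bar> \<le> \<bar>k\<bar> * exp (1 * \<bar>s\<bar>)" by (auto simp: k abs_mult mult.commute[of _ "\<bar>k\<bar>"] intro!: mult_left_mono)
  thus ?case by (intro exI[of _ "\<bar>k\<bar>"] exI[of _ 1] conjI) auto
next
  case (const c)
  have "\<forall>s::real. \<bar>c\<bar> \<le> \<bar>c\<bar> * exp (0 * \<bar>s\<bar>)" by simp
  thus ?case by (intro exI[of _ "\<bar>c\<bar>"] exI[of _ 0]) auto
next
  case (add f g)
  then obtain C c D d where *: "c \<ge> 0" "C \<ge> 0" "d \<ge> 0" "D \<ge> 0"
    "\<And>s. \<bar>f s\<bar> \<le> C * exp (c * \<bar>s\<bar>)" "\<And>s. \<bar>g s\<bar> \<le> D * exp (d * \<bar>s\<bar>)" by auto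
  have "\<bar>f s + g s\<bar> \<le> (C + D) * exp ((c + d) * \<bar>s\<bar>)" for s
  proof -
    have "\<bar>f s + g s\<bar> \<le> C * exp (c * \<bar>s\<bar>) + D * exp (d * \<bar>s\<bar>)" using *(5)[of s] *(6)[of s] by linarith
    also have "\<dots> \<le> C * exp ((c + d) * \<bar>s\<bar>) + D * exp ((c + d) * \<bar>s\<bar>)"
      using *(1-4) by (intro add_mono mult_left_mono) (auto intro!: mult_right_mono)
    finally show ?thesis by (simp add: algebra_simps)
  qed
  moreover have "c + d \<ge> 0" "C + D \<ge> 0" using *(1-4) by auto
  ultimately show ?case by - (intro exI conjI allI; assumption)
next
  case (mult f g)
  then obtain C c D d where *: "c \<ge> 0" "C \<ge> 0" "d \<ge> 0" "D \<ge> 0"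
    "\<And>s. \<bar>f s\<bar> \<le> C * exp (c * \<bar>s\<bar>)" "\<And>s. \<bar>g s\<bar> \<le> D * exp (d * \<bar>s\<bar>)" by auto
  have "\<bar>f s * g s\<bar> \<le> (C * D) * exp ((c + d) * \<bar>s\<bar>)" for s
  proof -
    have "\<bar>f s * g s\<bar> \<le> (C * exp (c * \<bar>s\<bar>)) * (D * exp (d * \<bar>s\<bar>))" 
      using *(5)[of s] *(6)[of s] *(1-4) by (auto simp: abs_mult intro!: mult_mono)
    thus ?thesis by (simp add: algebra_simps exp_add)
  qed
  moreover have "c + d \<ge> 0" "C * D \<ge> 0" using *(1-4) by auto
  ultimately show ?case by - (intro exI conjI allI; assumption)
qed

lemma continuous_on_real_polynomial:
  assumes "real_polynomial_function (p :: real \<Rightarrow> real)"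
  shows "continuous_on A p"
proof -
  have "polynomial_function p" using assms by (simp only: real_polynomial_function_eq)
  thus ?thesis by (rule continuous_on_polymonial_function)
qed

lemma polynomial_measurable:
  assumes "real_polynomial_function (p :: real \<Rightarrow> real)"
  shows "p \<in> borel_measurable borel"
  by (rule borel_measurable_continuous_onI[OF continuous_on_real_polynomial[OF assms]])

lemma real_polynomial_function_ident [intro]: "real_polynomial_function (\<lambda>x::real. x)"
  by (rule real_polynomial_function.intros(1)) (rule bounded_linear_ident)

lemmas polynomial_function_intros = real_polynomial_function_ident real_polynomial_function.intros(2-4)
  real_polynomial_function_diff real_polynomial_function_power

lemma integrable_polynomial_weight:
  assumes "real_polynomial_function (p :: real \<Rightarrow> real)"
  shows "integrable lborel (\<lambda>s. p s * exp (phase \<xi> \<tau> s))"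
proof -
  obtain C c where C: "c \<ge> 0" "C \<ge> 0" "\<And>s. \<bar>p s\<bar> \<le> C * exp (c * \<bar>s\<bar>)"
    using polynomial_exp_growth[OF assms] by blast
  show ?thesis by (rule integrable_exp_growth[OF polynomial_measurable[OF assms] C(3,1)])
qed

lemma Lam_eq_weighted_integral: "Lam \<xi> \<tau> = weighted_integral \<xi> \<tau> (\<lambda>_. 1)"
  by (simp add: Lam_def weighted_integral_def)

lemma weighted_integral_linear:
  assumes "real_polynomial_function p" "real_polynomial_function q"
  shows "weighted_integral \<xi> \<tau> (\<lambda>s. p s + q s) = weighted_integral \<xi> \<tau> p + weighted_integral \<xi> \<tau> q"
    and "weighted_integral \<xi> \<tau> (\<lambda>s. p s - q s) = weighted_integral \<xi> \<tau> p - weighted_integral \<xi> \<tau> q"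
  using integrable_polynomial_weight[OF assms(1)] integrable_polynomial_weight[OF assms(2)]
  by (simp_all add: weighted_integral_def ring_distribs)

lemma weighted_integral_cmult: "weighted_integral \<xi> \<tau> (\<lambda>s. c * p s) = c * weighted_integral \<xi> \<tau> p"
  by (simp add: weighted_integral_def mult.assoc)

lemma weighted_integral_mono:
  assumes "real_polynomial_function p" "real_polynomial_function q" "\<And>s. p s \<le> q s"
  shows "weighted_integral \<xi> \<tau> p \<le> weighted_integral \<xi> \<tau> q"
  unfolding weighted_integral_def
  using assms by (intro integral_mono integrable_polynomial_weight mult_right_mono) auto

text \<open>A compact set of positive length already bounds the normalising constant from below.\<close>

lemma Lam_ge_on_interval:
  assumes "\<And>s. s \<in> {a..b} \<Longrightarrow> phase \<xi> \<tau> s \<ge> m" "a \<le> b"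
  shows "Lam \<xi> \<tau> \<ge> (b - a) * exp m"
proof -
  have "(b - a) * exp m = (LINT s|lborel. indicator {a..b} s * exp m)"
    using assms(2) by (simp add: )
  also have "\<dots> \<le> (LINT s|lborel. exp (phase \<xi> \<tau> s))"
  proof (rule integral_mono)
    show "integrable lborel (\<lambda>s. exp (phase \<xi> \<tau> s))"
      using integrable_polynomial_weight[OF real_polynomial_function.intros(2)[of 1]] by simp
    show "integrable lborel (\<lambda>s. indicat_real {a..b} s * exp m)"
      using assms(2) by (intro integrable_mult_left integrable_real_indicator) auto
  qed (use assms(1) in \<open>auto simp: indicator_def\<close>)
  finally show ?thesis by (simp add: Lam_def)
qed

lemma Lam_pos: "Lam \<xi> \<tau> > 0"
proof -
  obtain x where "\<forall>s\<in>{0..1}. phase \<xi> \<tau> x \<le> phase \<xi> \<tau> s"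
    using continuous_attains_inf[OF _ _ continuous_phase, of "{0..1::real}" \<xi> \<tau>] by fastforce
  then obtain m where m: "\<And>s. s \<in> {0..1} \<Longrightarrow> phase \<xi> \<tau> s \<ge> m" by blast
  have "0 < exp m" by simp
  also have "\<dots> \<le> Lam \<xi> \<tau>" using Lam_ge_on_interval[of 0 1, OF m] by simp
  finally show ?thesis .
qed

lemma avg_const: "avg \<xi> \<tau> (\<lambda>_. c) = c"
  using Lam_pos[of \<xi> \<tau>] weighted_integral_cmult[of \<xi> \<tau> c "\<lambda>_. 1"]
  by (simp add: avg_def flip: Lam_eq_weighted_integral)

lemma avg_add:
  assumes "real_polynomial_function p" "real_polynomial_function q"
  shows "avg \<xi> \<tau> (\<lambda>s. p s + q s) = avg \<xi> \<tau> p + avg \<xi> \<tau> q"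
  by (simp add: avg_def weighted_integral_linear[OF assms] add_divide_distrib)

lemma avg_diff:
  assumes "real_polynomial_function p" "real_polynomial_function q"
  shows "avg \<xi> \<tau> (\<lambda>s. p s - q s) = avg \<xi> \<tau> p - avg \<xi> \<tau> q"
  by (simp add: avg_def weighted_integral_linear[OF assms] diff_divide_distrib)

lemma avg_cmult: "avg \<xi> \<tau> (\<lambda>s. c * p s) = c * avg \<xi> \<tau> p"
  by (simp add: avg_def weighted_integral_cmult)

lemma avg_mono:
  assumes "real_polynomial_function p" "real_polynomial_function q" "\<And>s. p s \<le> q s"
  shows "avg \<xi> \<tau> p \<le> avg \<xi> \<tau> q"
  unfolding avg_def using weighted_integral_mono[OF assms] Lam_pos[of \<xi> \<tau>]
  by (intro divide_right_mono) (auto simp: less_imp_le)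

lemma avg_nonneg:
  assumes "real_polynomial_function p" "\<And>s. p s \<ge> 0"
  shows "avg \<xi> \<tau> p \<ge> 0"
  using avg_mono[OF real_polynomial_function.intros(2)[of 0] assms(1)] assms(2) by (simp add: avg_const)

lemma avg_abs_le:
  assumes "real_polynomial_function p" "real_polynomial_function q" "\<And>s. \<bar>p s\<bar> \<le> q s"
  shows "\<bar>avg \<xi> \<tau> p\<bar> \<le> avg \<xi> \<tau> q"
proof (rule abs_leI)
  show "avg \<xi> \<tau> p \<le> avg \<xi> \<tau> q" by (rule avg_mono[OF assms(1,2) abs_le_D1[OF assms(3)]])
  have "avg \<xi> \<tau> (\<lambda>s. -1 * p s) \<le> avg \<xi> \<tau> q" 
    using assms(3) by (intro avg_mono polynomial_function_intros assms(1,2)) (smt (verit))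
  thus "- avg \<xi> \<tau> p \<le> avg \<xi> \<tau> q" by (simp only: avg_cmult)
qed

lemma weight_tendsto_0:
  assumes p: "real_polynomial_function p"
  shows "((\<lambda>s. p s * exp (phase \<xi> \<tau> s)) \<longlongrightarrow> 0) at_top"
    and "((\<lambda>s. p s * exp (phase \<xi> \<tau> s)) \<longlongrightarrow> 0) at_bot"
proof -
  obtain C c where C: "c \<ge> 0" "C \<ge> 0" "\<And>s. \<bar>p s\<bar> \<le> C * exp (c * \<bar>s\<bar>)"
    using polynomial_exp_growth[OF p] by blast
  obtain K where K: "\<And>s. c * \<bar>s\<bar> + phase \<xi> \<tau> s \<le> K - s\<^sup>2"
    using phase_le_neg_square[OF C(1)] by blast
  have *: "norm (p s * exp (phase \<xi> \<tau> s)) \<le> C * exp (K - s\<^sup>2)" for s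
  proof -
    have "\<bar>p s * exp (phase \<xi> \<tau> s)\<bar> \<le> C * exp (c * \<bar>s\<bar>) * exp (phase \<xi> \<tau> s)"
      using C(3)[of s] by (simp add: abs_mult)
    also have "\<dots> = C * exp (c * \<bar>s\<bar> + phase \<xi> \<tau> s)" by (simp add: exp_add)
    also have "\<dots> \<le> C * exp (K - s\<^sup>2)" using K C by (intro mult_left_mono) auto
    finally show ?thesis by simp
  qed
  have 1: "((\<lambda>s. C * exp (K - s\<^sup>2)) \<longlongrightarrow> 0) at_top"
    by (rule tendsto_mult_right_zero) real_asymp
  have 2: "((\<lambda>s. C * exp (K - s\<^sup>2)) \<longlongrightarrow> 0) at_bot"
    by (rule tendsto_mult_right_zero) real_asymp
  show "((\<lambda>s. p s * exp (phase \<xi> \<tau> s)) \<longlongrightarrow> 0) at_top"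
    using * by (intro Lim_null_comparison[OF always_eventually 1]) auto
  show "((\<lambda>s. p s * exp (phase \<xi> \<tau> s)) \<longlongrightarrow> 0) at_bot"
    using * by (intro Lim_null_comparison[OF always_eventually 2]) auto
qed

text \<open>
  The second factor on the right is minus the derivative of the phase in \<open>s\<close>, and the
  boundary terms vanish by \<open>weight_tendsto_0\<close>. All recurrences between moments are
  instances.
\<close>

lemma avg_by_parts:
  assumes p: "real_polynomial_function p" and p': "real_polynomial_function p'"
    and der: "\<And>s. (p has_real_derivative p' s) (at s)"
  shows "avg \<xi> \<tau> p' = avg \<xi> \<tau> (\<lambda>s. p s * (8 * s^3 - 2 * \<tau> * s + \<xi>))"
proof -
  have q: "real_polynomial_function (\<lambda>s. p s * (8 * s^3 - 2 * \<tau> * s + \<xi>))"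
    by (intro polynomial_function_intros p)
  define f where "f = (\<lambda>s. (p' s - p s * (8 * s^3 - 2 * \<tau> * s + \<xi>)) * exp (phase \<xi> \<tau> s))"
  have pf: "real_polynomial_function (\<lambda>s. p' s - p s * (8 * s^3 - 2 * \<tau> * s + \<xi>))"
    by (intro polynomial_function_intros p' q)
  have int: "integrable lborel f" unfolding f_def
    by (rule integrable_polynomial_weight[OF pf])
  have "(LBINT x=-\<infinity>..\<infinity>. f x) = 0 - 0"
  proof (rule interval_integral_FTC_integrable)
    fix x :: real
    show "((\<lambda>s. p s * exp (phase \<xi> \<tau> s)) has_vector_derivative f x) (at x)"
      unfolding f_def phase_def has_real_derivative_iff_has_vector_derivative[symmetric]
      by (auto intro!: derivative_eq_intros der simp: algebra_simps)
    have "continuous_on UNIV f" unfolding f_def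
      by (intro continuous_intros continuous_on_real_polynomial[OF pf])
    thus "isCont f x" by (simp add: continuous_on_eq_continuous_at)
  next
    show "set_integrable lborel (einterval (- \<infinity>) \<infinity>) f" using int by (simp add: set_integrable_def)
    show "(((\<lambda>s. p s * exp (phase \<xi> \<tau> s)) \<circ> real_of_ereal) \<longlongrightarrow> 0) (at_right (- \<infinity>))"
      using weight_tendsto_0(2)[OF p] by (simp add: ereal_tendsto_simps1)
    show "(((\<lambda>s. p s * exp (phase \<xi> \<tau> s)) \<circ> real_of_ereal) \<longlongrightarrow> 0) (at_left \<infinity>)"
      using weight_tendsto_0(1)[OF p] by (simp add: ereal_tendsto_simps1)
  qed auto
  hence "weighted_integral \<xi> \<tau> (\<lambda>s. p' s - p s * (8 * s^3 - 2 * \<tau> * s + \<xi>)) = 0"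
    by (simp add: weighted_integral_def f_def interval_lebesgue_integral_def set_lebesgue_integral_def)
  thus ?thesis using weighted_integral_linear(2)[OF p' q] by (simp add: avg_def)
qed

lemma exp_minus_linear_bound: "\<bar>exp x - 1 - x\<bar> \<le> x\<^sup>2 * exp \<bar>x\<bar>" for x :: real
proof -
  have "norm (exp x - (\<Sum>i\<le>1. x ^ i / fact i)) \<le> exp \<bar>x\<bar> * norm x ^ Suc 1 / fact 1"
    using Taylor_exp_field[of x 1] by (simp add: mult_ac)
  thus ?thesis by (simp add: power2_eq_square algebra_simps)
qed

text \<open>
  The difference quotient differs from the derivative of the integrand by at most
  \<open>|h| s^2 exp |s|\<close> times the weight, which is still integrable, so no convergence
  theorem is involved.
\<close>

lemma weighted_integral_has_derivative:
  assumes p: "real_polynomial_function p"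
  shows "((\<lambda>\<xi>. weighted_integral \<xi> \<tau> p) has_real_derivative - weighted_integral \<xi> \<tau> (\<lambda>s. s * p s)) (at \<xi>)"
proof -
  have sp: "real_polynomial_function (\<lambda>s. s * p s)" "real_polynomial_function (\<lambda>s. s^2 * p s)"
    by (intro polynomial_function_intros p)+
  obtain C c where C: "c \<ge> 0" "C \<ge> 0" "\<And>s. \<bar>s^2 * p s\<bar> \<le> C * exp (c * \<bar>s\<bar>)"
    using polynomial_exp_growth[OF sp(2)] by blast
  note [measurable] = polynomial_measurable[OF p]
  define G where "G = (\<lambda>s. \<bar>s^2 * p s\<bar> * exp \<bar>s\<bar>)"
  have Gi: "integrable lborel (\<lambda>s. G s * exp (phase \<xi> \<tau> s))"
  proof (rule integrable_exp_growth[where C = C and c = "c + 1"])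
    fix s :: real
    have "\<bar>G s\<bar> \<le> C * exp (c * \<bar>s\<bar>) * exp \<bar>s\<bar>" unfolding G_def using C(3)[of s] by (simp add: abs_mult)
    thus "\<bar>G s\<bar> \<le> C * exp ((c + 1) * \<bar>s\<bar>)" by (simp add: exp_add algebra_simps)
  qed (use C in \<open>auto simp: G_def\<close>)
  define K where "K = weighted_integral \<xi> \<tau> G"
  have bound: "\<bar>(weighted_integral (\<xi> + h) \<tau> p - weighted_integral \<xi> \<tau> p) / h + weighted_integral \<xi> \<tau> (\<lambda>s. s * p s)\<bar> \<le> \<bar>h\<bar> * K"
    if h: "h \<noteq> 0" "\<bar>h\<bar> \<le> 1" for h
  proof -
    note i = integrable_polynomial_weight[OF p, of "\<xi> + h" \<tau>] integrable_polynomial_weight[OF p, of \<xi> \<tau>]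
      integrable_polynomial_weight[OF sp(1), of \<xi> \<tau>]
    have eq: "(weighted_integral (\<xi> + h) \<tau> p - weighted_integral \<xi> \<tau> p) / h + weighted_integral \<xi> \<tau> (\<lambda>s. s * p s)
      = (LINT s|lborel. (p s * exp (phase (\<xi> + h) \<tau> s) - p s * exp (phase \<xi> \<tau> s)) / h + s * p s * exp (phase \<xi> \<tau> s))"
      using i by (simp add: weighted_integral_def)
    have "\<bar>LINT s|lborel. (p s * exp (phase (\<xi> + h) \<tau> s) - p s * exp (phase \<xi> \<tau> s)) / h + s * p s * exp (phase \<xi> \<tau> s)\<bar>
      \<le> (LINT s|lborel. \<bar>h\<bar> * (G s * exp (phase \<xi> \<tau> s)))"
    proof (rule integral_abs_bound_integral)
      fix s :: real
      have e: "exp (phase (\<xi> + h) \<tau> s) = exp (phase \<xi> \<tau> s) * exp (- h * s)"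
        by (simp add: phase_def flip: exp_add) (simp add: algebra_simps)
      have "(p s * exp (phase (\<xi> + h) \<tau> s) - p s * exp (phase \<xi> \<tau> s)) / h + s * p s * exp (phase \<xi> \<tau> s)
        = p s * exp (phase \<xi> \<tau> s) * (exp (- h * s) - 1 - (- h * s)) / h"
        unfolding e using h by (simp add: field_simps)
      also have "\<bar>\<dots>\<bar> = \<bar>p s\<bar> * exp (phase \<xi> \<tau> s) * \<bar>exp (- h * s) - 1 - (- h * s)\<bar> / \<bar>h\<bar>"
        by (simp add: abs_mult)
      also have "\<dots> \<le> \<bar>p s\<bar> * exp (phase \<xi> \<tau> s) * ((- h * s)\<^sup>2 * exp \<bar>s\<bar>) / \<bar>h\<bar>"
      proof (intro divide_right_mono mult_left_mono)
        have "\<bar>exp (- h * s) - 1 - (- h * s)\<bar> \<le> (- h * s)\<^sup>2 * exp \<bar>- h * s\<bar>" by (rule exp_minus_linear_bound)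
        also have "\<dots> \<le> (- h * s)\<^sup>2 * exp \<bar>s\<bar>" using h mult_right_mono[of "\<bar>h\<bar>" 1 "\<bar>s\<bar>"]
          by (intro mult_left_mono) (auto simp: abs_mult)
        finally show "\<bar>exp (- h * s) - 1 - (- h * s)\<bar> \<le> (- h * s)\<^sup>2 * exp \<bar>s\<bar>" .
      qed auto
      also have "\<dots> = \<bar>h\<bar> * (G s * exp (phase \<xi> \<tau> s))"
      proof -
        have "(- h * s)\<^sup>2 = \<bar>h\<bar> * \<bar>h\<bar> * s\<^sup>2" by (simp add: power2_eq_square)
        thus ?thesis using h unfolding G_def by (simp add: abs_mult field_simps)
      qed
      finally show "\<bar>(p s * exp (phase (\<xi> + h) \<tau> s) - p s * exp (phase \<xi> \<tau> s)) / h + s * p s * exp (phase \<xi> \<tau> s)\<bar>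
        \<le> \<bar>h\<bar> * (G s * exp (phase \<xi> \<tau> s))" .
    next
      show "integrable lborel (\<lambda>s. (p s * exp (phase (\<xi> + h) \<tau> s) - p s * exp (phase \<xi> \<tau> s)) / h + s * p s * exp (phase \<xi> \<tau> s))"
        by (intro Bochner_Integration.integrable_add Bochner_Integration.integrable_diff integrable_divide i)
      show "integrable lborel (\<lambda>s. \<bar>h\<bar> * (G s * exp (phase \<xi> \<tau> s)))"
        by (intro integrable_mult_right Gi)
    qed
    also have "\<dots> = \<bar>h\<bar> * K" by (simp add: K_def weighted_integral_def)
    finally show ?thesis unfolding eq .
  qed
  have "((\<lambda>h. (weighted_integral (\<xi> + h) \<tau> p - weighted_integral \<xi> \<tau> p) / h + weighted_integral \<xi> \<tau> (\<lambda>s. s * p s)) \<longlongrightarrow> 0) (at 0)"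
  proof (rule Lim_null_comparison)
    show "\<forall>\<^sub>F h in at 0. norm ((weighted_integral (\<xi> + h) \<tau> p - weighted_integral \<xi> \<tau> p) / h + weighted_integral \<xi> \<tau> (\<lambda>s. s * p s)) \<le> \<bar>h\<bar> * K"
      unfolding eventually_at using bound by (intro exI[of _ 1]) auto
    show "((\<lambda>h. \<bar>h\<bar> * K) \<longlongrightarrow> 0) (at 0)"
      by (auto intro!: tendsto_eq_intros)
  qed
  hence "((\<lambda>h. (weighted_integral (\<xi> + h) \<tau> p - weighted_integral \<xi> \<tau> p) / h) \<longlongrightarrow> - weighted_integral \<xi> \<tau> (\<lambda>s. s * p s)) (at 0)"
    by (subst Lim_null) simp
  thus ?thesis by (simp add: DERIV_def)
qed

lemma avg_has_derivative:
  assumes p: "real_polynomial_function p"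
  shows "((\<lambda>\<xi>. avg \<xi> \<tau> p) has_real_derivative
     avg \<xi> \<tau> (\<lambda>s. s) * avg \<xi> \<tau> p - avg \<xi> \<tau> (\<lambda>s. s * p s)) (at \<xi>)"
proof -
  have L: "((\<lambda>\<xi>. Lam \<xi> \<tau>) has_real_derivative - weighted_integral \<xi> \<tau> (\<lambda>s. s)) (at \<xi>)"
    using weighted_integral_has_derivative[OF real_polynomial_function.intros(2)[of 1], of \<tau> \<xi>]
    by (simp flip: Lam_eq_weighted_integral)
  have pos: "Lam \<xi> \<tau> \<noteq> 0" using Lam_pos[of \<xi> \<tau>] by simp
  show ?thesis unfolding avg_def
    by (rule DERIV_cong[OF DERIV_divide[OF weighted_integral_has_derivative[OF p] L pos]])
       (use pos in \<open>simp add: field_simps\<close>)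
qed

lemma w10_eq_avg: "w10 \<phi> \<xi> \<tau> = 2 / deriv (deriv \<phi>) 0 * avg \<xi> \<tau> (\<lambda>s. s)"
proof -
  have "((\<lambda>\<xi>. Lam \<xi> \<tau>) has_real_derivative - weighted_integral \<xi> \<tau> (\<lambda>s. s)) (at \<xi>)"
    using weighted_integral_has_derivative[OF real_polynomial_function.intros(2)[of 1], of \<tau> \<xi>]
    by (simp flip: Lam_eq_weighted_integral)
  thus ?thesis unfolding w10_def avg_def by (simp add: DERIV_imp_deriv)
qed

section \<open>The dominant critical point\<close>

text \<open>
  The roots of the cubic are twice the critical points of the phase. The inequality singles out the
  global maximum (\<open>global_max_iff\<close>) by a condition that needs no comparison of values of
  the phase.
\<close>

definition dominant_root :: "real \<Rightarrow> real \<Rightarrow> real \<Rightarrow> bool" where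
  "dominant_root \<xi> \<tau> h \<longleftrightarrow> h ^ 3 - \<tau> * h + \<xi> = 0 \<and> \<tau> \<le> h\<^sup>2"

text \<open>
  Taylor's formula at a critical point, with the quadratic factor written as a square plus the
  nonnegative number \<open>h^2 - \<tau>\<close>: this form shows that the point is the global maximum
  and how much the second maximum, near \<open>u = - h\<close>, falls short of it.
\<close>

lemma phase_around_root:
  assumes "h ^ 3 - \<tau> * h + \<xi> = 0"
  shows "phase \<xi> \<tau> (h / 2 + u) = phase \<xi> \<tau> (h / 2) - u\<^sup>2 * (2 * (u + h)\<^sup>2 + (h\<^sup>2 - \<tau>))"
proof -
  have \<xi>: "\<xi> = \<tau> * h - h ^ 3" using assms by simp
  show ?thesis unfolding phase_def \<xi>
    by (simp add: power2_eq_square power3_eq_cube power4_eq_xxxx field_simps)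
qed

lemma global_max_iff:
  assumes root: "h ^ 3 - \<tau> * h + \<xi> = 0"
  shows "(\<forall>s. phase \<xi> \<tau> s \<le> phase \<xi> \<tau> (h / 2)) \<longleftrightarrow> \<tau> \<le> h\<^sup>2"
proof
  assume max: "\<forall>s. phase \<xi> \<tau> s \<le> phase \<xi> \<tau> (h / 2)"
  have nonneg: "u\<^sup>2 * (2 * (u + h)\<^sup>2 + (h\<^sup>2 - \<tau>)) \<ge> 0" for u
    using max[rule_format, of "h / 2 + u"] by (simp add: phase_around_root[OF root])
  show "\<tau> \<le> h\<^sup>2"
  proof (cases "h = 0")
    case False
    thus ?thesis using nonneg[of "-h"] by (simp add: zero_le_mult_iff)
  next
    case True
    show ?thesis
    proof (rule ccontr)
      assume "\<not> \<tau> \<le> h\<^sup>2"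
      hence "\<tau> > 0" using True by simp
      moreover have "(sqrt \<tau> / 2)\<^sup>2 = \<tau> / 4" using \<open>\<tau> > 0\<close> by (simp add: power_divide)
      ultimately show False using nonneg[of "sqrt \<tau> / 2"] True by (simp add: zero_le_mult_iff)
    qed
  qed
next
  assume "\<tau> \<le> h\<^sup>2"
  show "\<forall>s. phase \<xi> \<tau> s \<le> phase \<xi> \<tau> (h / 2)"
  proof
    fix s
    have "phase \<xi> \<tau> (h / 2 + (s - h / 2)) \<le> phase \<xi> \<tau> (h / 2)"
      unfolding phase_around_root[OF root] using \<open>\<tau> \<le> h\<^sup>2\<close>
      by (simp add: add_nonneg_nonneg)
    thus "phase \<xi> \<tau> s \<le> phase \<xi> \<tau> (h / 2)" by simp
  qed
qed

lemma dominant_root_uminus: "dominant_root \<xi> \<tau> h \<longleftrightarrow> dominant_root (- \<xi>) \<tau> (- h)"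
  unfolding dominant_root_def by (auto simp: power3_eq_cube)

lemma dominant_root_exists: "\<exists>h. dominant_root \<xi> \<tau> h"
proof -
  have ex: "\<exists>h. dominant_root \<xi> \<tau> h" if \<xi>: "\<xi> \<ge> 0" for \<xi>
  proof -
    define a where "a = sqrt (max \<tau> 0)"
    have a: "a \<ge> 0" "a\<^sup>2 = max \<tau> 0" unfolding a_def by auto
    define b where "b = a + 1 + \<xi>"
    have b: "b \<ge> a" "b \<ge> 1" unfolding b_def using \<xi> a by auto
    have "b\<^sup>2 - \<tau> \<ge> 1"
    proof -
      have "(a + 1)\<^sup>2 \<le> b\<^sup>2" using a \<xi> unfolding b_def by (intro power_mono) auto
      thus ?thesis using a by (simp add: power2_sum)
    qed
    hence "b * 1 \<le> b * (b\<^sup>2 - \<tau>)" using b by (intro mult_left_mono) auto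
    moreover have "b * (b\<^sup>2 - \<tau>) = b ^ 3 - \<tau> * b" by (simp add: power2_eq_square power3_eq_cube algebra_simps)
    moreover have "\<xi> \<le> b" unfolding b_def using a by simp
    ultimately have 1: "b ^ 3 - \<tau> * b - \<xi> \<ge> 0" by simp
    have "a * (a\<^sup>2 - \<tau>) = 0 \<or> \<tau> < 0 \<and> a = 0" using a by (auto simp: max_def)
    hence "a * (a\<^sup>2 - \<tau>) = 0" by auto
    moreover have "a * (a\<^sup>2 - \<tau>) = a ^ 3 - \<tau> * a" by (simp add: power2_eq_square power3_eq_cube algebra_simps)
    ultimately have 2: "a ^ 3 - \<tau> * a - \<xi> \<le> 0" using \<xi> by linarith
    have "continuous_on {a..b} (\<lambda>x. x ^ 3 - \<tau> * x - \<xi>)" by (intro continuous_intros)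
    from IVT'[OF 2 1 b(1) this] obtain x where x: "a \<le> x" "x \<le> b" "x ^ 3 - \<tau> * x - \<xi> = 0" by blast
    have "a\<^sup>2 \<le> x\<^sup>2" using x a by (intro power_mono) auto
    hence "dominant_root \<xi> \<tau> (- x)" using x a unfolding dominant_root_def by (auto simp: power3_eq_cube)
    thus ?thesis by blast
  qed
  show ?thesis
  proof (cases "\<xi> \<ge> 0")
    case False
    then obtain h where "dominant_root (- \<xi>) \<tau> h" using ex[of "- \<xi>"] by auto
    thus ?thesis using dominant_root_uminus[of "- \<xi>" \<tau> h] by auto
  qed (rule ex)
qed

text \<open>
  Two dominant roots of the same sign would make \<open>g^2 + g h + h^2\<close> equal to
  \<open>\<tau>\<close> although \<open>g h > 0\<close> and both squares are at least
  \<open>\<tau>\<close>; roots of opposite sign would give \<open>\<xi>\<close> both signs.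
\<close>

lemma dominant_root_unique:
  assumes g: "dominant_root \<xi> \<tau> g" and h: "dominant_root \<xi> \<tau> h" and "\<xi> \<noteq> 0 \<or> \<tau> \<le> 0"
  shows "g = h"
proof (rule ccontr)
  assume "g \<noteq> h"
  have "(g - h) * (g\<^sup>2 + g * h + h\<^sup>2 - \<tau>) = 0"
    using g h unfolding dominant_root_def by (simp add: power2_eq_square power3_eq_cube algebra_simps)
  hence eq: "g\<^sup>2 + g * h + h\<^sup>2 = \<tau>" using \<open>g \<noteq> h\<close> by simp
  have le: "\<tau> \<le> g\<^sup>2" "\<tau> \<le> h\<^sup>2" using g h by (auto simp: dominant_root_def)
  have pr: "g * (g\<^sup>2 - \<tau>) = - \<xi>" "h * (h\<^sup>2 - \<tau>) = - \<xi>"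
    using g h unfolding dominant_root_def by (auto simp: power2_eq_square power3_eq_cube algebra_simps)
  show False
  proof (cases "\<xi> = 0")
    case True
    hence "\<tau> \<le> 0" using assms by simp
    moreover have "g = 0 \<or> g\<^sup>2 = \<tau>" "h = 0 \<or> h\<^sup>2 = \<tau>" using pr True by auto
    ultimately show False using \<open>g \<noteq> h\<close> by (smt (verit) zero_eq_power2 zero_le_power2)
  next
    case False
    have "(g * (g\<^sup>2 - \<tau>)) * (h * (h\<^sup>2 - \<tau>)) = \<xi>\<^sup>2" unfolding pr by (simp add: power2_eq_square)
    also have "\<dots> > 0" using False by simp
    finally have "(g * h) * ((g\<^sup>2 - \<tau>) * (h\<^sup>2 - \<tau>)) > 0" by (simp add: mult_ac)
    moreover have "(g\<^sup>2 - \<tau>) * (h\<^sup>2 - \<tau>) \<ge> 0" using le by simp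
    ultimately have "g * h > 0" by (smt (verit) mult_nonpos_nonneg)
    moreover from this have "h\<^sup>2 > 0" by auto
    ultimately show False using eq le by linarith
  qed
qed

lemma H_dominant_root:
  assumes "\<xi> \<noteq> 0 \<or> \<tau> \<le> 0"
  shows "dominant_root \<xi> \<tau> (H \<xi> \<tau>)"
proof -
  have "H \<xi> \<tau> = (THE h. dominant_root \<xi> \<tau> h)"
    unfolding H_def dominant_root_def using global_max_iff
    by (intro arg_cong[where f = The] ext) blast
  moreover have "\<exists>!h. dominant_root \<xi> \<tau> h"
    using dominant_root_exists dominant_root_unique assms by blast
  ultimately show ?thesis using theI'[of "dominant_root \<xi> \<tau>"] by simp
qed

lemma Omega1_iff: "(\<xi>, \<tau>) \<in> Omega1 \<gamma> \<longleftrightarrow> \<tau> \<le> 0 \<or> \<bar>\<xi>\<bar> \<ge> \<tau> powr (\<gamma> - 1 / 2)"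
  unfolding Omega1_def by auto

lemma H_dominant_root_Omega1:
  assumes "(\<xi>, \<tau>) \<in> Omega1 \<gamma>"
  shows "dominant_root \<xi> \<tau> (H \<xi> \<tau>)"
proof (rule H_dominant_root)
  show "\<xi> \<noteq> 0 \<or> \<tau> \<le> 0" using assms powr_gt_zero[of \<tau> "\<gamma> - 1/2"] unfolding Omega1_iff by force
qed

section \<open>Moments around the dominant critical point\<close>

text \<open>
  Either the phase drops quadratically at the rate given by \<open>D\<close>, or \<open>u\<close> lies
  near the second maximum \<open>- h\<close>. The second case only matters for
  \<open>h^2 < 2 \<tau>\<close>; then \<open>\<tau>\<close> and \<open>D\<close> are comparable, and
  the gap between the two maxima is of the order \<open>|h| |\<xi>|\<close>, which is at least
  \<open>\<tau> powr \<gamma>\<close> in \<open>\<Omega>\<^sub>1\<close>.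
\<close>

lemma action_lower_bound:
  assumes h: "dominant_root \<xi> \<tau> h" and dom: "(\<xi>, \<tau>) \<in> Omega1 \<gamma>" and D: "D = 3 * h\<^sup>2 - \<tau>" "D > 0"
    and \<gamma>: "\<gamma> > 0"
  shows "D * u\<^sup>2 / 6 \<le> u\<^sup>2 * (2 * (u + h)\<^sup>2 + (h\<^sup>2 - \<tau>)) \<or>
    \<bar>u\<bar> \<le> 2 * sqrt D \<and> (D / 6) powr \<gamma> / 4 \<le> u\<^sup>2 * (2 * (u + h)\<^sup>2 + (h\<^sup>2 - \<tau>))"
proof -
  have le: "\<tau> \<le> h\<^sup>2" and root: "h * (h\<^sup>2 - \<tau>) = - \<xi>"
    using h unfolding dominant_root_def by (auto simp: power2_eq_square power3_eq_cube algebra_simps)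
  have *: ?thesis if "2 * (u + h)\<^sup>2 + (h\<^sup>2 - \<tau>) \<ge> D / 6"
    using mult_left_mono[OF that, of "u\<^sup>2"] by (simp add: mult_ac)
  have sq: "(u + h)\<^sup>2 \<ge> 0" by simp
  consider "\<tau> \<le> 0" | "\<tau> > 0" "h\<^sup>2 \<ge> 2 * \<tau>" | "\<tau> > 0" "h\<^sup>2 < 2 * \<tau>" "\<bar>u + h\<bar> \<ge> \<bar>h\<bar> / 2"
    | "\<tau> > 0" "h\<^sup>2 < 2 * \<tau>" "\<bar>u + h\<bar> < \<bar>h\<bar> / 2" by linarith
  thus ?thesis
  proof cases
    case 1
    show ?thesis by (rule *) (use 1 D sq zero_le_power2[of h] in linarith)
  next
    case 2
    show ?thesis by (rule *) (use 2 D sq in linarith)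
  next
    case 3
    have "(\<bar>h\<bar> / 2)\<^sup>2 \<le> \<bar>u + h\<bar>\<^sup>2" using 3 by (intro power_mono) auto
    hence "h\<^sup>2 / 4 \<le> (u + h)\<^sup>2" by (simp add: power_divide)
    thus ?thesis by (intro *) (use 3 D le in linarith)
  next
    case 4
    have u: "\<bar>u\<bar> \<ge> \<bar>h\<bar> / 2" "\<bar>u\<bar> \<le> 3 / 2 * \<bar>h\<bar>" using 4 by linarith+
    have "\<bar>h\<bar> \<le> sqrt D" using D le by (intro real_le_rsqrt) auto
    hence 1: "\<bar>u\<bar> \<le> 2 * sqrt D" using u by linarith
    have "(\<bar>h\<bar> / 2)\<^sup>2 \<le> \<bar>u\<bar>\<^sup>2" using u by (intro power_mono) auto
    hence u2: "h\<^sup>2 / 4 \<le> u\<^sup>2" by (simp add: power_divide)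
    have "(D / 6) powr \<gamma> \<le> \<tau> powr \<gamma>" using D 4 \<gamma> by (intro powr_mono2) auto
    also have "\<tau> powr \<gamma> = sqrt \<tau> * \<tau> powr (\<gamma> - 1 / 2)"
      using 4 by (simp add: powr_half_sqrt[symmetric] flip: powr_add)
    also have "\<dots> \<le> \<bar>h\<bar> * \<bar>\<xi>\<bar>"
    proof (intro mult_mono)
      show "sqrt \<tau> \<le> \<bar>h\<bar>" using le by (intro real_le_lsqrt) (use 4 in auto)
      show "\<tau> powr (\<gamma> - 1 / 2) \<le> \<bar>\<xi>\<bar>" using dom 4 by (simp add: Omega1_iff)
    qed auto
    also have "\<bar>\<xi>\<bar> = \<bar>h\<bar> * (h\<^sup>2 - \<tau>)" using arg_cong[OF root, of abs] le by (simp add: abs_mult)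
    also have "\<bar>h\<bar> * (\<bar>h\<bar> * (h\<^sup>2 - \<tau>)) = h\<^sup>2 * (h\<^sup>2 - \<tau>)" by (simp add: power2_eq_square)
    finally have "(D / 6) powr \<gamma> / 4 \<le> h\<^sup>2 / 4 * (h\<^sup>2 - \<tau>)" by simp
    also have "\<dots> \<le> u\<^sup>2 * (h\<^sup>2 - \<tau>)" using u2 le by (intro mult_right_mono) auto
    also have "\<dots> \<le> u\<^sup>2 * (2 * (u + h)\<^sup>2 + (h\<^sup>2 - \<tau>))" by (intro mult_left_mono) auto
    finally show ?thesis using 1 by simp
  qed
qed

lemma Lam_lower_bound_root:
  assumes h: "dominant_root \<xi> \<tau> h" and D: "D = 3 * h\<^sup>2 - \<tau>" "D \<ge> 1"
  shows "Lam \<xi> \<tau> \<ge> 2 / sqrt D * exp (phase \<xi> \<tau> (h / 2) - 7)"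
proof -
  have le: "\<tau> \<le> h\<^sup>2" and root: "h ^ 3 - \<tau> * h + \<xi> = 0"
    using h unfolding dominant_root_def by auto
  have sD: "sqrt D \<ge> 1" using D by simp
  have hD: "\<bar>h\<bar> \<le> sqrt D" using D le by (intro real_le_rsqrt) auto
  \<comment> \<open>For \<open>|u| \<le> 1 / \<surd>D\<close> the quadratic, cubic and quartic parts of the drop are at most \<open>1\<close>, \<open>4\<close> and \<open>2\<close>.\<close>
  have "phase \<xi> \<tau> s \<ge> phase \<xi> \<tau> (h / 2) - 7" if s: "s \<in> {h / 2 - 1 / sqrt D..h / 2 + 1 / sqrt D}" for s
  proof -
    define u where "u = s - h / 2"
    have u: "\<bar>u\<bar> \<le> 1 / sqrt D" using s unfolding u_def by (auto simp: abs_le_iff)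
    have u1: "\<bar>u\<bar> \<le> 1" using u sD by (smt (verit) divide_le_eq_1)
    have "u\<^sup>2 \<le> (1 / sqrt D)\<^sup>2" using u by (metis abs_ge_zero power2_abs power_mono)
    hence u2: "u\<^sup>2 * D \<le> 1" using D(2) by (simp add: power_divide field_simps)
    have hu: "\<bar>h * u\<bar> \<le> 1" 
    proof -
      have "\<bar>h * u\<bar> \<le> sqrt D * (1 / sqrt D)" unfolding abs_mult using hD u sD by (intro mult_mono) auto
      thus ?thesis using sD by simp
    qed
    have u2': "u\<^sup>2 \<le> 1" using u1 by (simp add: abs_square_le_1)
    have "u\<^sup>2 * (2 * (u + h)\<^sup>2 + (h\<^sup>2 - \<tau>)) = u\<^sup>2 * D + 4 * u\<^sup>2 * (h * u) + 2 * u\<^sup>2 * u\<^sup>2"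
      unfolding D by (simp add: power2_eq_square algebra_simps)
    also have "\<dots> \<le> 1 + 4 * 1 + 2 * 1"
    proof (intro add_mono u2)
      have "4 * u\<^sup>2 * (h * u) \<le> 4 * u\<^sup>2 * 1" using hu by (intro mult_left_mono) auto
      thus "4 * u\<^sup>2 * (h * u) \<le> 4 * 1" using u2' by simp
      have "2 * u\<^sup>2 * u\<^sup>2 \<le> 2 * 1 * 1" using u2' by (intro mult_mono) auto
      thus "2 * u\<^sup>2 * u\<^sup>2 \<le> 2 * 1" by simp
    qed
    finally have "phase \<xi> \<tau> (h / 2 + u) \<ge> phase \<xi> \<tau> (h / 2) - 7"
      unfolding phase_around_root[OF root] by simp
    thus ?thesis by (simp add: u_def)
  qed
  from Lam_ge_on_interval[where a = "h / 2 - 1 / sqrt D" and b = "h / 2 + 1 / sqrt D", OF this] sD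
  show ?thesis by simp
qed

lemma integrable_gaussian_moment: "integrable lborel (\<lambda>v::real. \<bar>v\<bar> ^ n * exp (- v\<^sup>2 / 6))"
proof -
  have "integrable lborel (\<lambda>v. sqrt (2 * pi * (sqrt 3)\<^sup>2) * (normal_density 0 (sqrt 3) v * \<bar>v - 0\<bar> ^ n))"
    by (intro integrable_mult_right integrable_normal_moment_abs) auto
  thus ?thesis by (simp add: normal_density_def mult_ac)
qed

lemma gaussian_moment_scale:
  assumes "D > 0"
  shows "integrable lborel (\<lambda>s. \<bar>s - m\<bar> ^ n * exp (- (D * (s - m)\<^sup>2 / 6)))" (is ?I)
    and "(LINT s|lborel. \<bar>s - m\<bar> ^ n * exp (- (D * (s - m)\<^sup>2 / 6))) =
      (LINT v|lborel. \<bar>v\<bar> ^ n * exp (- v\<^sup>2 / 6)) / sqrt D ^ (n + 1)" (is ?E)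
proof -
  have s: "sqrt D > 0" using assms by simp
  have eq: "\<bar>(m + (1 / sqrt D) * v) - m\<bar> ^ n * exp (- (D * ((m + (1 / sqrt D) * v) - m)\<^sup>2 / 6))
    = (1 / sqrt D ^ n) * (\<bar>v\<bar> ^ n * exp (- v\<^sup>2 / 6))" for v
    using assms by (simp add: abs_mult power_mult_distrib power_divide)
  have "integrable lborel (\<lambda>v. (1 / sqrt D ^ n) * (\<bar>v\<bar> ^ n * exp (- v\<^sup>2 / 6)))"
    by (intro integrable_mult_right integrable_gaussian_moment)
  thus ?I using s unfolding eq[symmetric]
    by (subst (asm) lborel_integrable_real_affine_iff) auto
  show ?E
    by (subst lborel_integral_real_affine[where c = "1 / sqrt D" and t = m])
       (use s in \<open>simp_all only: eq, simp_all\<close>)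
qed

lemma gaussian_tail_negligible:
  assumes "\<gamma> > 0"
  shows "\<forall>\<^sub>F D in at_top. sqrt D * (2 * sqrt D) ^ n * exp (- ((D / 6) powr \<gamma> / 4)) \<le> 1 / sqrt D ^ (n + 1)"
proof -
  have "((\<lambda>D. D powr (real n + 1) * exp (- ((D / 6) powr \<gamma> / 4))) \<longlongrightarrow> 0) at_top"
    using assms by real_asymp
  hence "((\<lambda>D. 2 ^ n * (D powr (real n + 1) * exp (- ((D / 6) powr \<gamma> / 4)))) \<longlongrightarrow> 0) at_top"
    by (rule tendsto_mult_right_zero)
  hence "\<forall>\<^sub>F D in at_top. 2 ^ n * (D powr (real n + 1) * exp (- ((D / 6) powr \<gamma> / 4))) < 1"
    by (rule order_tendstoD) auto
  thus ?thesis using eventually_gt_at_top[of 0]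
  proof eventually_elim
    case (elim D)
    have "D powr (real n + 1) = D ^ (n + 1)" using elim by (simp add: powr_add powr_realpow)
    also have "\<dots> = (sqrt D * sqrt D) ^ (n + 1)" using elim by simp
    finally have D: "D powr (real n + 1) = sqrt D ^ (n + 1) * sqrt D ^ (n + 1)" by (simp only: power_mult_distrib)
    have "sqrt D * (2 * sqrt D) ^ n * exp (- ((D / 6) powr \<gamma> / 4)) * sqrt D ^ (n + 1)
       = 2 ^ n * (D powr (real n + 1) * exp (- ((D / 6) powr \<gamma> / 4)))"
      unfolding D by (simp add: power_mult_distrib)
    also have "\<dots> \<le> 1" using elim by simp
    finally show ?case using elim by (simp add: field_simps)
  qed
qed

definition laplace_filter :: "real \<Rightarrow> (real \<times> real) filter" where
  "laplace_filter \<gamma> = inf (filtercomap (\<lambda>(\<xi>, \<tau>). 3 * (H \<xi> \<tau>)\<^sup>2 - \<tau>) at_top) (principal (Omega1 \<gamma>))"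

lemma eventually_laplace_filter:
  "eventually P (laplace_filter \<gamma>) \<longleftrightarrow>
     (\<exists>d. \<forall>\<xi> \<tau>. (\<xi>, \<tau>) \<in> Omega1 \<gamma> \<longrightarrow> 3 * (H \<xi> \<tau>)\<^sup>2 - \<tau> \<ge> d \<longrightarrow> P (\<xi>, \<tau>))"
proof -
  have "eventually P (laplace_filter \<gamma>) \<longleftrightarrow>
    (\<exists>Q. eventually Q at_top \<and> (\<forall>\<xi> \<tau>. Q (3 * (H \<xi> \<tau>)\<^sup>2 - \<tau>) \<longrightarrow> (\<xi>, \<tau>) \<in> Omega1 \<gamma> \<longrightarrow> P (\<xi>, \<tau>)))"
    unfolding laplace_filter_def eventually_inf_principal eventually_filtercomap by (simp add: split_paired_All)
  also have "\<dots> \<longleftrightarrow> (\<exists>d. \<forall>\<xi> \<tau>. (\<xi>, \<tau>) \<in> Omega1 \<gamma> \<longrightarrow> 3 * (H \<xi> \<tau>)\<^sup>2 - \<tau> \<ge> d \<longrightarrow> P (\<xi>, \<tau>))"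
    (is "?A \<longleftrightarrow> ?B")
  proof
    assume ?A
    thus ?B unfolding eventually_at_top_linorder by blast
  next
    assume ?B
    then obtain d where "\<forall>\<xi> \<tau>. (\<xi>, \<tau>) \<in> Omega1 \<gamma> \<longrightarrow> 3 * (H \<xi> \<tau>)\<^sup>2 - \<tau> \<ge> d \<longrightarrow> P (\<xi>, \<tau>)" ..
    thus ?A by (intro exI[of _ "\<lambda>D. D \<ge> d"]) (auto simp: eventually_ge_at_top)
  qed
  finally show ?thesis .
qed

lemma filterlim_laplace_filter: "filterlim (\<lambda>(\<xi>, \<tau>). 3 * (H \<xi> \<tau>)\<^sup>2 - \<tau>) at_top (laplace_filter \<gamma>)"
  unfolding laplace_filter_def
  by (rule filterlim_mono[OF filterlim_filtercomap order.refl inf_le1])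

text \<open>
  Points of \<open>\<Omega>\<^sub>1\<close> with a common value \<open>D\<close> of
  \<open>3 H^2 - \<tau>\<close> are treated together, so that uniformity over them is built into the
  limit \<open>D \<rightarrow> \<infinity>\<close>.
\<close>

lemma eventually_laplaceI:
  assumes "\<forall>\<^sub>F D in at_top. \<forall>\<xi> \<tau>. (\<xi>, \<tau>) \<in> Omega1 \<gamma> \<longrightarrow> dominant_root \<xi> \<tau> (H \<xi> \<tau>) \<longrightarrow>
     3 * (H \<xi> \<tau>)\<^sup>2 - \<tau> = D \<longrightarrow> P (\<xi>, \<tau>)"
  shows "eventually P (laplace_filter \<gamma>)"
proof -
  obtain d where d: "\<And>D. D \<ge> d \<Longrightarrow> \<forall>\<xi> \<tau>. (\<xi>, \<tau>) \<in> Omega1 \<gamma> \<longrightarrow> dominant_root \<xi> \<tau> (H \<xi> \<tau>) \<longrightarrow>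
     3 * (H \<xi> \<tau>)\<^sup>2 - \<tau> = D \<longrightarrow> P (\<xi>, \<tau>)" using assms unfolding eventually_at_top_linorder by blast
  show ?thesis unfolding eventually_laplace_filter
    by (intro exI[of _ d] allI impI) (use d H_dominant_root_Omega1 in blast)
qed

text \<open>
  By \<open>action_lower_bound\<close> the weight is at most a Gaussian of variance of order
  \<open>1/D\<close> plus an exponentially small constant on an interval of length of order
  \<open>\<surd>D\<close>; the normalising constant is at least of order \<open>1/\<surd>D\<close>
  relative to the maximum.
\<close>

lemma moment_bound:
  assumes \<gamma>: "\<gamma> > 0"
  shows "(\<lambda>(\<xi>, \<tau>). avg \<xi> \<tau> (\<lambda>s. (s - H \<xi> \<tau> / 2) ^ n)) \<in>
    O[laplace_filter \<gamma>](\<lambda>(\<xi>, \<tau>). (3 * (H \<xi> \<tau>)\<^sup>2 - \<tau>) powr (- real n / 2))"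
proof -
  define G where "G = (LINT v::real|lborel. \<bar>v\<bar> ^ n * exp (- v\<^sup>2 / 6))"
  have G: "G \<ge> 0" unfolding G_def by (intro integral_nonneg_AE) auto
  define C where "C = (G + 4) / 2 * exp 7"
  have "\<forall>\<^sub>F p in laplace_filter \<gamma>. norm ((\<lambda>(\<xi>, \<tau>). avg \<xi> \<tau> (\<lambda>s. (s - H \<xi> \<tau> / 2) ^ n)) p) \<le>
     C * norm ((\<lambda>(\<xi>, \<tau>). (3 * (H \<xi> \<tau>)\<^sup>2 - \<tau>) powr (- real n / 2)) p)"
  proof (rule eventually_laplaceI)
    show "\<forall>\<^sub>F D in at_top. \<forall>\<xi> \<tau>. (\<xi>, \<tau>) \<in> Omega1 \<gamma> \<longrightarrow> dominant_root \<xi> \<tau> (H \<xi> \<tau>) \<longrightarrow>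
     3 * (H \<xi> \<tau>)\<^sup>2 - \<tau> = D \<longrightarrow> norm ((\<lambda>(\<xi>, \<tau>). avg \<xi> \<tau> (\<lambda>s. (s - H \<xi> \<tau> / 2) ^ n)) (\<xi>, \<tau>)) \<le>
     C * norm ((\<lambda>(\<xi>, \<tau>). (3 * (H \<xi> \<tau>)\<^sup>2 - \<tau>) powr (- real n / 2)) (\<xi>, \<tau>))"
      using gaussian_tail_negligible[OF \<gamma>, of n] eventually_ge_at_top[of 1]
    proof (eventually_elim, intro allI impI, unfold split)
      fix D \<xi> \<tau>
      assume tail: "sqrt D * (2 * sqrt D) ^ n * exp (- ((D / 6) powr \<gamma> / 4)) \<le> 1 / sqrt D ^ (n + 1)"
        and D1: "1 \<le> D" and dom: "(\<xi>, \<tau>) \<in> Omega1 \<gamma>" and h: "dominant_root \<xi> \<tau> (H \<xi> \<tau>)"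
        and D: "3 * (H \<xi> \<tau>)\<^sup>2 - \<tau> = D"
      define h where "h = H \<xi> \<tau>"
      define P where "P = exp (phase \<xi> \<tau> (h / 2))"
      define T where "T = exp (- ((D / 6) powr \<gamma> / 4))"
      have P: "P > 0" and T: "T > 0" unfolding P_def T_def by auto
      have D': "D = 3 * h\<^sup>2 - \<tau>" "D > 0" using D D1 by (auto simp: h_def)
      have sD: "sqrt D \<ge> 1" using D1 by simp
      note hh = h[folded h_def]
      have root: "h ^ 3 - \<tau> * h + \<xi> = 0" using hh by (simp add: dominant_root_def)
      define J where "J = {h / 2 - 2 * sqrt D..h / 2 + 2 * sqrt D}"
      define g where "g = (\<lambda>s. P * (\<bar>s - h / 2\<bar> ^ n * exp (- (D * (s - h / 2)\<^sup>2 / 6)))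
          + P * ((2 * sqrt D) ^ n * T) * indicator J s)"
      have g: "integrable lborel g" "(LINT s|lborel. g s) = P * (G / sqrt D ^ (n + 1)) + P * ((2 * sqrt D) ^ n * T) * (4 * sqrt D)"
        unfolding g_def using gaussian_moment_scale[OF D'(2), of "h/2" n] sD
        by (auto simp: G_def J_def)
      have "\<bar>weighted_integral \<xi> \<tau> (\<lambda>s. (s - h / 2) ^ n)\<bar> \<le> (LINT s|lborel. g s)"
        unfolding weighted_integral_def
      proof (rule integral_abs_bound_integral)
        show "integrable lborel (\<lambda>s. (s - h / 2) ^ n * exp (phase \<xi> \<tau> s))"
          by (intro integrable_polynomial_weight polynomial_function_intros)
        fix s :: real
        define u where "u = s - h / 2"
        define A where "A = u\<^sup>2 * (2 * (u + h)\<^sup>2 + (h\<^sup>2 - \<tau>))"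
        have "phase \<xi> \<tau> (h / 2 + u) = phase \<xi> \<tau> (h / 2) - A"
          unfolding A_def by (rule phase_around_root[OF root])
        hence "phase \<xi> \<tau> s = phase \<xi> \<tau> (h / 2) + - A" by (simp add: u_def)
        hence "exp (phase \<xi> \<tau> s) = P * exp (- A)" unfolding P_def by (simp only: exp_add)
        hence "\<bar>(s - h / 2) ^ n * exp (phase \<xi> \<tau> s)\<bar> = P * (\<bar>u\<bar> ^ n * exp (- A))"
          using P by (simp add: abs_mult power_abs u_def)
        also have "\<dots> \<le> g s"
          using action_lower_bound[OF hh dom D' \<gamma>, of u] unfolding A_def[symmetric]
        proof
          assume "D * u\<^sup>2 / 6 \<le> A"
          hence "P * (\<bar>u\<bar> ^ n * exp (- A)) \<le> P * (\<bar>u\<bar> ^ n * exp (- (D * u\<^sup>2 / 6)))"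
            using P by (intro mult_left_mono) auto
          also have "\<dots> \<le> g s" unfolding g_def u_def using P T D' by simp
          finally show ?thesis .
        next
          assume A: "\<bar>u\<bar> \<le> 2 * sqrt D \<and> (D / 6) powr \<gamma> / 4 \<le> A"
          hence "\<bar>u\<bar> ^ n * exp (- A) \<le> (2 * sqrt D) ^ n * T" unfolding T_def
            using D'(2) by (intro mult_mono power_mono) auto
          hence "P * (\<bar>u\<bar> ^ n * exp (- A)) \<le> P * ((2 * sqrt D) ^ n * T)" using P by (intro mult_left_mono) auto
          also have "\<dots> \<le> g s" unfolding g_def using A P by (auto simp: J_def u_def indicator_def abs_le_iff)
          finally show ?thesis .
        qed
        finally show "\<bar>(s - h / 2) ^ n * exp (phase \<xi> \<tau> s)\<bar> \<le> g s" .
      qed (rule g)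
      also have "\<dots> = P * (G / sqrt D ^ (n + 1) + 4 * (sqrt D * (2 * sqrt D) ^ n * T))"
        unfolding g by (simp add: algebra_simps)
      also have "\<dots> \<le> P * (G / sqrt D ^ (n + 1) + 4 * (1 / sqrt D ^ (n + 1)))"
        using tail P unfolding T_def by (intro mult_left_mono add_left_mono) auto
      also have "\<dots> = P * ((G + 4) / sqrt D ^ (n + 1))" by (simp add: add_divide_distrib)
      finally have num: "\<bar>weighted_integral \<xi> \<tau> (\<lambda>s. (s - h / 2) ^ n)\<bar> \<le> P * ((G + 4) / sqrt D ^ (n + 1))" .
      have den: "Lam \<xi> \<tau> \<ge> 2 / sqrt D * (P / exp 7)"
        using Lam_lower_bound_root[OF hh D'(1) D1] by (simp add: P_def exp_diff)
      have den0: "2 / sqrt D * (P / exp 7) > 0" using P D' by simp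
      have "\<bar>avg \<xi> \<tau> (\<lambda>s. (s - h / 2) ^ n)\<bar> = \<bar>weighted_integral \<xi> \<tau> (\<lambda>s. (s - h / 2) ^ n)\<bar> / Lam \<xi> \<tau>"
        using Lam_pos[of \<xi> \<tau>] by (simp add: avg_def)
      also have "\<dots> \<le> P * ((G + 4) / sqrt D ^ (n + 1)) / (2 / sqrt D * (P / exp 7))"
        using num den den0 by (intro frac_le) auto
      also have "\<dots> = C / sqrt D ^ n" using P D' unfolding C_def by (simp add: field_simps)
      also have "sqrt D ^ n = D powr (real n / 2)"
        using D' by (simp add: powr_half_sqrt[symmetric] powr_powr flip: powr_realpow)
      finally show "norm (avg \<xi> \<tau> (\<lambda>s. (s - H \<xi> \<tau> / 2) ^ n)) \<le> C * norm ((3 * (H \<xi> \<tau>)\<^sup>2 - \<tau>) powr (- real n / 2))"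
        unfolding D by (simp add: h_def powr_minus_divide)
    qed
  qed
  thus ?thesis by (rule bigoI)
qed

section \<open>Expansion in powers of the inverse curvature\<close>

text \<open>
  The coefficient of order \<open>j\<close> of the \<open>n\<close>-th moment, obtained by solving
  \<open>moment_recursion\<close> order by order. Passing from \<open>u^(n+1)\<close> to
  \<open>H u^(n+2) / D\<close> gains one order and to \<open>u^(n+3) / D\<close> two, since
  \<open>u\<close> has size \<open>D^(-1/2)\<close> and \<open>H\<close> has size at most
  \<open>D^(1/2)\<close>, while one order counts for a factor \<open>1/D\<close>.
\<close>

fun laplace_coeff :: "nat \<Rightarrow> nat \<Rightarrow> real \<Rightarrow> real \<Rightarrow> real" where
  "laplace_coeff j 0 h d = (if j = 0 then 1 else 0)"
| "laplace_coeff j (Suc n) h d =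
     (if n = 0 then 0 else real n / 2 * inverse d * laplace_coeff j (n - 1) h d)
     - (if j < 1 then 0 else 6 * h * inverse d * laplace_coeff (j - 1) (n + 2) h d)
     - (if j < 2 then 0 else 4 * inverse d * laplace_coeff (j - 2) (n + 3) h d)"

(* Order j refers to higher moments at lower order, so unconditional rewriting with these
   equations need not stop. *)
declare laplace_coeff.simps [simp del]

text \<open>
  The recursion preserves the parity of \<open>n + j\<close>. For the first moment only odd orders
  remain, which is why the weights in the expansion of \<open>w10\<close> descend in steps of four.
\<close>

lemma laplace_coeff_parity: "odd (n + j) \<Longrightarrow> laplace_coeff j n h d = 0"
proof (induction j n h d rule: laplace_coeff.induct)
  case (1 j h d)
  then show ?case by (cases "j = 0") (auto simp: laplace_coeff.simps(1))
next
  case (2 j n h d)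
  note IH = 2
  have 1: "(if n = 0 then 0 else real n / 2 * inverse d * laplace_coeff j (n - 1) h d) = 0"
    using IH(1,4) by (cases n) auto
  have 2: "(if j < 1 then 0 else 6 * h * inverse d * laplace_coeff (j - 1) (n + 2) h d) = 0"
    using IH(2,4) by (cases j) auto
  have 3: "(if j < 2 then 0 else 4 * inverse d * laplace_coeff (j - 2) (n + 3) h d) = 0"
    using IH(3,4) by (auto simp: not_less)
  show ?case unfolding laplace_coeff.simps(2) 1 2 3 by simp
qed

text \<open>
  Integration by parts with \<open>u^n\<close>: the derivative of
  \<open>D u^2 + 4 H u^3 + 2 u^4\<close> is \<open>2 D u + 12 H u^2 + 8 u^3\<close>,
  and the equation is solved for the term with \<open>D\<close>.
\<close>

lemma moment_recursion:
  assumes "h ^ 3 - \<tau> * h + \<xi> = 0" "d = 3 * h\<^sup>2 - \<tau>" "d \<noteq> 0"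
  defines "m \<equiv> \<lambda>n. avg \<xi> \<tau> (\<lambda>s. (s - h / 2) ^ n)"
  shows "m (Suc n) = (if n = 0 then 0 else real n / 2 * inverse d * m (n - 1))
     - 6 * h * inverse d * m (n + 2) - 4 * inverse d * m (n + 3)"
proof -
  have eq: "(s - h / 2) ^ n * (8 * s^3 - 2 * \<tau> * s + \<xi>) =
     2 * d * (s - h / 2) ^ Suc n + (12 * h * (s - h / 2) ^ (n + 2) + 8 * (s - h / 2) ^ (n + 3))" for s
  proof -
    have \<xi>: "\<xi> = \<tau> * h - h ^ 3" using assms(1) by simp
    have "8 * s^3 - 2 * \<tau> * s + \<xi> = 2 * d * (s - h / 2) + 12 * h * (s - h / 2)\<^sup>2 + 8 * (s - h / 2) ^ 3"
      unfolding \<xi> assms(2) by (simp add: power2_eq_square power3_eq_cube field_simps)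
    moreover have "x ^ n * (2 * d * x + 12 * h * x\<^sup>2 + 8 * x ^ 3) =
        2 * d * x ^ Suc n + (12 * h * x ^ (n + 2) + 8 * x ^ (n + 3))" for x
      by (simp add: power_add power2_eq_square power3_eq_cube algebra_simps)
    ultimately show ?thesis by simp
  qed
  have "avg \<xi> \<tau> (\<lambda>s. real n * (s - h / 2) ^ (n - 1)) = avg \<xi> \<tau> (\<lambda>s. (s - h / 2) ^ n * (8 * s^3 - 2 * \<tau> * s + \<xi>))"
    by (rule avg_by_parts) (auto intro!: polynomial_function_intros derivative_eq_intros)
  also have "\<dots> = 2 * d * m (Suc n) + (12 * h * m (n + 2) + 8 * m (n + 3))"
    unfolding eq m_def by (subst avg_add, (intro polynomial_function_intros)+)+ (simp only: avg_cmult)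
  finally have "real n * m (n - 1) = 2 * d * m (Suc n) + (12 * h * m (n + 2) + 8 * m (n + 3))"
    by (simp only: avg_cmult m_def)
  hence "m (Suc n) = (real n * m (n - 1) - 12 * h * m (n + 2) - 8 * m (n + 3)) * inverse d / 2"
    using assms(3) by (simp add: field_simps)
  thus ?thesis by (cases "n = 0") (simp_all add: algebra_simps)
qed

abbreviation (input) curvature :: "real \<times> real \<Rightarrow> real" where
  "curvature \<equiv> \<lambda>(\<xi>, \<tau>). 3 * (H \<xi> \<tau>)\<^sup>2 - \<tau>"

abbreviation (input) laplace_O :: "real \<Rightarrow> real \<Rightarrow> (real \<times> real \<Rightarrow> real) set" where
  "laplace_O \<gamma> e \<equiv> O[laplace_filter \<gamma>](\<lambda>p. curvature p powr e)"

lemma eventually_laplace_root: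
  "\<forall>\<^sub>F p in laplace_filter \<gamma>. curvature p > 0 \<and> dominant_root (fst p) (snd p) (H (fst p) (snd p))"
proof (rule eventually_laplaceI)
  show "\<forall>\<^sub>F D in at_top. \<forall>\<xi> \<tau>. (\<xi>, \<tau>) \<in> Omega1 \<gamma> \<longrightarrow> dominant_root \<xi> \<tau> (H \<xi> \<tau>) \<longrightarrow>
     3 * (H \<xi> \<tau>)\<^sup>2 - \<tau> = D \<longrightarrow>
      curvature (\<xi>, \<tau>) > 0 \<and> dominant_root (fst (\<xi>, \<tau>)) (snd (\<xi>, \<tau>)) (H (fst (\<xi>, \<tau>)) (snd (\<xi>, \<tau>)))"
    using eventually_gt_at_top[of 0] by eventually_elim auto
qed

lemma powr_curvature_bigo_mono:
  "(\<lambda>p. curvature p powr a) \<in> laplace_O \<gamma> b" if "a \<le> b"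
proof (rule bigoI[of _ 1])
  show "\<forall>\<^sub>F p in laplace_filter \<gamma>. norm (curvature p powr a) \<le> 1 * norm (curvature p powr b)"
    using filterlim_laplace_filter[of \<gamma>, unfolded filterlim_at_top, rule_format, of 1]
    by eventually_elim (use that in \<open>auto intro: powr_mono\<close>)
qed

lemma inverse_curvature_bigo:
  "(\<lambda>p. inverse (curvature p)) \<in> laplace_O \<gamma> (- 1)"
proof (rule bigoI[of _ 1])
  show "\<forall>\<^sub>F p in laplace_filter \<gamma>. norm (inverse (curvature p)) \<le> 1 * norm (curvature p powr - 1)"
    using eventually_laplace_root[of \<gamma>] by eventually_elim (auto simp: powr_minus)
qed

lemma H_bigo:
  "(\<lambda>p. H (fst p) (snd p)) \<in> laplace_O \<gamma> (1 / 2)"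
proof (rule bigoI[of _ 1])
  show "\<forall>\<^sub>F p in laplace_filter \<gamma>. norm (H (fst p) (snd p)) \<le> 1 * norm (curvature p powr (1 / 2))"
    using eventually_laplace_root[of \<gamma>]
  proof eventually_elim
    case (elim p)
    have "\<bar>H (fst p) (snd p)\<bar> \<le> sqrt (curvature p)"
      using elim by (intro real_le_rsqrt) (auto simp: dominant_root_def case_prod_unfold)
    thus ?case using elim by (simp add: powr_half_sqrt)
  qed
qed

lemma powr_curvature_mult:
  "(\<lambda>p. curvature p powr a * curvature p powr b) = (\<lambda>p. curvature p powr (a + b))"
  by (simp add: powr_add)

text \<open>
  The remainders obey the same recursion as the moments. On its right-hand side the order of the
  expansion drops by one or two for the higher moments, which the factors \<open>H/D\<close> and
  \<open>1/D\<close> compensate, and the moment drops for the first term; the induction is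
  lexicographic. It starts from \<open>moment_bound\<close>, and the zeroth moment is exactly
  \<open>1\<close>.
\<close>

lemma moment_expansion:
  assumes \<gamma>: "\<gamma> > 0"
  shows "(\<lambda>p. avg (fst p) (snd p) (\<lambda>s. (s - H (fst p) (snd p) / 2) ^ n)
     - (\<Sum>j<N. laplace_coeff j n (H (fst p) (snd p)) (curvature p)))
    \<in> laplace_O \<gamma> (- (real n / 2) - real N)"
proof (induction N arbitrary: n rule: less_induct)
  case (less N)
  note IHN = less.IH
  define m where "m = (\<lambda>n p. avg (fst p) (snd p) (\<lambda>s. (s - H (fst p) (snd p) / 2) ^ n))"
  define c where "c = (\<lambda>j n p. laplace_coeff j n (H (fst p) (snd p)) (curvature p))"
  define h where "h = (\<lambda>p. H (fst p) (snd p))"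
  define i where "i = (\<lambda>p. inverse (curvature p))"
  have i: "i \<in> laplace_O \<gamma> (- 1)" unfolding i_def by (rule inverse_curvature_bigo)
  have h: "h \<in> laplace_O \<gamma> (1 / 2)" unfolding h_def by (rule H_bigo)
  have hi: "(\<lambda>p. h p * i p) \<in> laplace_O \<gamma> (- (1 / 2))"
    using landau_o.big.mult[OF h i] unfolding powr_curvature_mult by simp
  show ?case
  proof (cases "N = 0")
    case True
    show ?thesis using moment_bound[OF \<gamma>, of n] True by (simp add: case_prod_unfold)
  next
    case False
    have "(\<lambda>p. m n p - (\<Sum>j<N. c j n p)) \<in> laplace_O \<gamma> (- (real n / 2) - real N)"
    proof (induction n rule: less_induct)
      case (less n)
      note IHn = less.IH
      show ?case
      proof (cases n)
        case 0
        have "m 0 p - (\<Sum>j<N. c j 0 p) = 0" for p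
          using False by (simp add: m_def c_def avg_const laplace_coeff.simps(1) sum.delta)
        thus ?thesis unfolding 0 by simp
      next
        case (Suc n')
        define e where "e = (\<lambda>N n p. m n p - (\<Sum>j<N. c j n p))"
        have 1: "(\<lambda>p. (if n' = 0 then 0 else real n' / 2 * (i p * e N (n' - 1) p)))
            \<in> laplace_O \<gamma> (- (real n / 2) - real N)"
        proof (cases "n' = 0")
          case False
          have A: "(\<lambda>p. i p * e N (n' - 1) p) \<in> O[laplace_filter \<gamma>](\<lambda>p. curvature p powr (- 1) * curvature p powr (- (real (n' - 1) / 2) - real N))"
            unfolding e_def by (intro landau_o.big.mult i IHn) (use Suc in auto)
          have B: "- 1 + (- (real (n' - 1) / 2) - real N) = - (real n / 2) - real N"
            using False Suc by (simp add: of_nat_diff field_simps)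
          show ?thesis using A[unfolded powr_curvature_mult B] False by simp
        qed simp
        have 2: "(\<lambda>p. 6 * (h p * i p * e (N - 1) (n' + 2) p))
            \<in> laplace_O \<gamma> (- (real n / 2) - real N)"
        proof -
          have "(\<lambda>p. h p * i p * e (N - 1) (n' + 2) p) \<in> O[laplace_filter \<gamma>](\<lambda>p. curvature p powr (- (1 / 2)) * curvature p powr (- (real (n' + 2) / 2) - real (N - 1)))"
            unfolding e_def m_def c_def by (intro landau_o.big.mult hi IHN) (use False in auto)
          moreover have "- (1 / 2) + (- (real (n' + 2) / 2) - real (N - 1)) = - (real n / 2) - real N"
            using False Suc by (simp add: of_nat_diff field_simps)
          ultimately show ?thesis unfolding powr_curvature_mult by simp
        qed
        have 3: "(\<lambda>p. 4 * (i p * e (N - 2) (n' + 3) p))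
            \<in> laplace_O \<gamma> (- (real n / 2) - real N)"
        proof -
          have "(\<lambda>p. i p * e (N - 2) (n' + 3) p) \<in> O[laplace_filter \<gamma>](\<lambda>p. curvature p powr (- 1) * curvature p powr (- (real (n' + 3) / 2) - real (N - 2)))"
            unfolding e_def m_def c_def by (intro landau_o.big.mult i IHN) (use False in auto)
          also have "(\<lambda>p. curvature p powr (- 1) * curvature p powr (- (real (n' + 3) / 2) - real (N - 2)))
             \<in> laplace_O \<gamma> (- (real n / 2) - real N)"
            unfolding powr_curvature_mult
            by (rule powr_curvature_bigo_mono) (use False Suc in \<open>cases "N = 1"; auto simp: of_nat_diff field_simps\<close>)
          finally show ?thesis by simp
        qed
        have "(\<lambda>p. (if n' = 0 then 0 else real n' / 2 * (i p * e N (n' - 1) p))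
           - 6 * (h p * i p * e (N - 1) (n' + 2) p) - 4 * (i p * e (N - 2) (n' + 3) p))
           \<in> laplace_O \<gamma> (- (real n / 2) - real N)"
          by (intro sum_in_bigo 1 2 3)
        also have "?this \<longleftrightarrow> ?thesis"
        proof (rule landau_o.big.in_cong)
          show "\<forall>\<^sub>F p in laplace_filter \<gamma>. (if n' = 0 then 0 else real n' / 2 * (i p * e N (n' - 1) p))
            - 6 * (h p * i p * e (N - 1) (n' + 2) p) - 4 * (i p * e (N - 2) (n' + 3) p) = m n p - (\<Sum>j<N. c j n p)"
            using eventually_laplace_root[of \<gamma>]
          proof eventually_elim
            case (elim p)
            have mrec: "m (Suc n') p = (if n' = 0 then 0 else real n' / 2 * i p * m (n' - 1) p)
                - 6 * h p * i p * m (n' + 2) p - 4 * i p * m (n' + 3) p"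
              unfolding m_def i_def h_def
              by (rule moment_recursion) (use elim in \<open>auto simp: dominant_root_def case_prod_unfold\<close>)
            have s1: "(\<Sum>j<N. if j < 1 then 0 else 6 * h p * i p * c (j - 1) (n' + 2) p)
               = 6 * h p * i p * (\<Sum>j<N - 1. c j (n' + 2) p)"
            proof -
              have "(\<Sum>j<N. if j < 1 then 0 else 6 * h p * i p * c (j - 1) (n' + 2) p)
                = (\<Sum>j<Suc (N - 1). if j < 1 then 0 else 6 * h p * i p * c (j - 1) (n' + 2) p)" using False by simp
              also have "\<dots> = (\<Sum>j<N - 1. 6 * h p * i p * c j (n' + 2) p)"
                by (subst sum.lessThan_Suc_shift) simp
              finally show ?thesis by (simp add: sum_distrib_left)
            qed
            have s2: "(\<Sum>j<N. if j < 2 then 0 else 4 * i p * c (j - 2) (n' + 3) p)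
               = 4 * i p * (\<Sum>j<N - 2. c j (n' + 3) p)"
            proof (cases "N = 1")
              case nN: False
              have "(\<Sum>j<N. if j < 2 then 0 else 4 * i p * c (j - 2) (n' + 3) p)
                = (\<Sum>j<Suc (Suc (N - 2)). if j < 2 then 0 else 4 * i p * c (j - 2) (n' + 3) p)"
                using False nN by (intro sum.cong) auto
              also have "\<dots> = (\<Sum>j<N - 2. 4 * i p * c j (n' + 3) p)"
                unfolding sum.lessThan_Suc_shift by (simp add: numeral_2_eq_2)
              finally show ?thesis by (simp add: sum_distrib_left)
            qed simp
            have "(\<Sum>j<N. c j (Suc n') p) = (\<Sum>j<N. (if n' = 0 then 0 else real n' / 2 * i p * c j (n' - 1) p)
              - (if j < 1 then 0 else 6 * h p * i p * c (j - 1) (n' + 2) p)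
              - (if j < 2 then 0 else 4 * i p * c (j - 2) (n' + 3) p))"
              unfolding c_def i_def h_def by (simp only: laplace_coeff.simps)
            also have "\<dots> = (if n' = 0 then 0 else real n' / 2 * i p * (\<Sum>j<N. c j (n' - 1) p))
              - 6 * h p * i p * (\<Sum>j<N - 1. c j (n' + 2) p) - 4 * i p * (\<Sum>j<N - 2. c j (n' + 3) p)"
              unfolding sum_subtractf s1 s2 by (simp add: sum_distrib_left)
            finally have coeffs: "(\<Sum>j<N. c j (Suc n') p) = (if n' = 0 then 0 else real n' / 2 * i p * (\<Sum>j<N. c j (n' - 1) p))
              - 6 * h p * i p * (\<Sum>j<N - 1. c j (n' + 2) p) - 4 * i p * (\<Sum>j<N - 2. c j (n' + 3) p)" .
            show ?case unfolding Suc mrec e_def coeffs by (cases "n' = 0") (simp_all add: algebra_simps)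
          qed
        qed
        finally show ?thesis .
      qed
    qed
    thus ?thesis unfolding m_def c_def .
  qed
qed

text \<open>
  The homogeneous polynomials in \<open>H\<close> and the inverse curvature, as functions; powers of
  \<open>\<tau>\<close> never occur in the expansion. Building them from monomials makes closure
  properties inductions.
\<close>

inductive homogeneous_fun :: "int \<Rightarrow> (real \<Rightarrow> real \<Rightarrow> real) \<Rightarrow> bool" for w where
  zero: "homogeneous_fun w (\<lambda>h d. 0)"
| add_monomial: "homogeneous_fun w f \<Longrightarrow> int i - 2 * int k = w \<Longrightarrow>
     homogeneous_fun w (\<lambda>h d. f h d + c * h ^ i * inverse d ^ k)"

lemma homogeneous_fun_add:
  assumes "homogeneous_fun w f" "homogeneous_fun w g"
  shows "homogeneous_fun w (\<lambda>h d. f h d + g h d)"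
  using assms(2)
proof induction
  case zero
  show ?case using assms(1) by simp
next
  case (add_monomial g i k c)
  show ?case using homogeneous_fun.add_monomial[OF add_monomial.IH add_monomial.hyps(2), of c]
    by (simp add: add.assoc)
qed

lemma homogeneous_fun_mult_monomial:
  assumes "homogeneous_fun w f" "w' = w + int i - 2 * int k"
  shows "homogeneous_fun w' (\<lambda>h d. c * h ^ i * inverse d ^ k * f h d)"
  using assms(1)
proof induction
  case zero
  show ?case using homogeneous_fun.zero[of w'] by simp
next
  case (add_monomial f j l b)
  have "homogeneous_fun w' (\<lambda>h d. c * h ^ i * inverse d ^ k * f h d + (c * b) * h ^ (i + j) * inverse d ^ (k + l))"
    by (rule homogeneous_fun.add_monomial[OF add_monomial.IH]) (use add_monomial.hyps assms(2) in auto)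
  thus ?case by (simp add: power_add algebra_simps)
qed

lemma homogeneous_laplace_coeff:
  fixes h d :: real
  shows "homogeneous_fun (- int n - 2 * int j) (laplace_coeff j n)"
proof (induction j n h d rule: laplace_coeff.induct)
  case (1 j h d)
  have "homogeneous_fun (- int 0 - 2 * int j) (\<lambda>h d. 0 + (if j = 0 then 1 else 0) * h ^ 0 * inverse d ^ 0)" if "j = 0"
    by (rule homogeneous_fun.add_monomial[OF homogeneous_fun.zero]) (use that in auto)
  moreover have "laplace_coeff j 0 = (\<lambda>h d. if j = 0 then 1 else 0)" by (intro ext) (simp add: laplace_coeff.simps(1))
  ultimately show ?case using homogeneous_fun.zero by (cases "j = 0") auto
next
  case (2 j n h d)
  note IH = 2
  have 1: "homogeneous_fun (- int (Suc n) - 2 * int j) (\<lambda>h d. if n = 0 then 0 else real n / 2 * inverse d * laplace_coeff j (n - 1) h d)"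
  proof (cases "n = 0")
    case False
    have "homogeneous_fun (- int (Suc n) - 2 * int j) (\<lambda>h d. real n / 2 * h ^ 0 * inverse d ^ 1 * laplace_coeff j (n - 1) h d)"
      by (rule homogeneous_fun_mult_monomial[OF IH(1)[OF False]]) (use False in auto)
    thus ?thesis using False by simp
  qed (auto intro: homogeneous_fun.zero)
  have 2: "homogeneous_fun (- int (Suc n) - 2 * int j) (\<lambda>h d. if j < 1 then 0 else (- 6) * h * inverse d * laplace_coeff (j - 1) (n + 2) h d)"
  proof (cases "j < 1")
    case False
    have "homogeneous_fun (- int (Suc n) - 2 * int j) (\<lambda>h d. (- 6) * h ^ 1 * inverse d ^ 1 * laplace_coeff (j - 1) (n + 2) h d)"
      by (rule homogeneous_fun_mult_monomial[OF IH(2)[OF False]]) (use False in auto)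
    thus ?thesis using False by simp
  qed (auto intro: homogeneous_fun.zero)
  have 3: "homogeneous_fun (- int (Suc n) - 2 * int j) (\<lambda>h d. if j < 2 then 0 else (- 4) * inverse d * laplace_coeff (j - 2) (n + 3) h d)"
  proof (cases "j < 2")
    case False
    have "homogeneous_fun (- int (Suc n) - 2 * int j) (\<lambda>h d. (- 4) * h ^ 0 * inverse d ^ 1 * laplace_coeff (j - 2) (n + 3) h d)"
      by (rule homogeneous_fun_mult_monomial[OF IH(3)[OF False]]) (use False in auto)
    thus ?thesis using False by simp
  qed (auto intro: homogeneous_fun.zero)
  have "laplace_coeff j (Suc n) = (\<lambda>h d. (if n = 0 then 0 else real n / 2 * inverse d * laplace_coeff j (n - 1) h d)
     + (if j < 1 then 0 else (- 6) * h * inverse d * laplace_coeff (j - 1) (n + 2) h d)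
     + (if j < 2 then 0 else (- 4) * inverse d * laplace_coeff (j - 2) (n + 3) h d))"
    unfolding laplace_coeff.simps(2)[abs_def] by (intro ext) simp
  thus ?case using homogeneous_fun_add[OF homogeneous_fun_add[OF 1 2] 3] by simp
qed

lemma eval_poly3_superset:
  assumes "finite S" "Poly_Mapping.keys P \<subseteq> S"
  shows "eval_poly3 P \<xi> \<tau> = (\<Sum>(i, j, k)\<in>S. Poly_Mapping.lookup P (i, j, k) *
        H \<xi> \<tau> ^ i * \<tau> ^ j * inverse (3 * (H \<xi> \<tau>)\<^sup>2 - \<tau>) ^ k)"
  unfolding eval_poly3_def using assms
  by (intro sum.mono_neutral_left) (auto simp: in_keys_iff)

lemma eval_poly3_add: "eval_poly3 (P + Q) \<xi> \<tau> = eval_poly3 P \<xi> \<tau> + eval_poly3 Q \<xi> \<tau>"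
proof -
  define S where "S = Poly_Mapping.keys P \<union> Poly_Mapping.keys Q"
  have S: "finite S" "Poly_Mapping.keys P \<subseteq> S" "Poly_Mapping.keys Q \<subseteq> S" "Poly_Mapping.keys (P + Q) \<subseteq> S"
    unfolding S_def using keys_add[of P Q] by auto
  show ?thesis unfolding eval_poly3_superset[OF S(1,2)] eval_poly3_superset[OF S(1,3)] eval_poly3_superset[OF S(1,4)]
    by (simp add: lookup_add sum.distrib[symmetric] case_prod_unfold algebra_simps)
qed

lemma homogeneous_fun_eval_poly3:
  assumes "homogeneous_fun w f"
  shows "\<exists>P. homogeneous_of_power P w \<and> (\<forall>\<xi> \<tau>. eval_poly3 P \<xi> \<tau> = f (H \<xi> \<tau>) (3 * (H \<xi> \<tau>)\<^sup>2 - \<tau>))"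
  using assms
proof induction
  case zero
  show ?case by (intro exI[of _ 0]) (auto simp: homogeneous_of_power_def eval_poly3_def)
next
  case (add_monomial f i k c)
  then obtain P where P: "homogeneous_of_power P w"
    "\<And>\<xi> \<tau>. eval_poly3 P \<xi> \<tau> = f (H \<xi> \<tau>) (3 * (H \<xi> \<tau>)\<^sup>2 - \<tau>)" by blast
  define Q where "Q = Poly_Mapping.single (i, 0::nat, k) c"
  have Q: "Poly_Mapping.keys Q \<subseteq> {(i, 0, k)}" unfolding Q_def by simp
  have "eval_poly3 Q \<xi> \<tau> = c * H \<xi> \<tau> ^ i * inverse (3 * (H \<xi> \<tau>)\<^sup>2 - \<tau>) ^ k" for \<xi> \<tau>
    by (subst eval_poly3_superset[OF _ Q]) (auto simp: Q_def)
  moreover have "homogeneous_of_power (P + Q) w"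
    unfolding homogeneous_of_power_def
  proof (clarify)
    fix a b e assume "(a, b, e) \<in> Poly_Mapping.keys (P + Q)"
    hence "(a, b, e) \<in> Poly_Mapping.keys P \<or> (a, b, e) = (i, 0, k)" using keys_add[of P Q] Q by blast
    thus "int a + 2 * int b - 2 * int e = w"
      using P(1) add_monomial.hyps unfolding homogeneous_of_power_def by auto
  qed
  ultimately show ?case by (intro exI[of _ "P + Q"]) (auto simp: eval_poly3_add P(2))
qed

lemma sum_odd_laplace_coeff:
  "n \<ge> 1 \<Longrightarrow> (\<Sum>j<2 * n - 1. laplace_coeff j 1 h d) = (\<Sum>l=1..<n. laplace_coeff (2 * l - 1) 1 h d)"
proof (induction n rule: nat_induct_at_least)
  case base
  show ?case using laplace_coeff_parity[of 1 0 h d] by simp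
next
  case (Suc n)
  then obtain k where k: "n = Suc k" by (cases n) auto
  have e: "2 * Suc n - 1 = Suc (Suc (2 * n - 1))" "Suc (2 * n - 1) = 2 * n" using k by auto
  have "laplace_coeff (2 * n) 1 h d = 0" by (rule laplace_coeff_parity) simp
  hence "(\<Sum>j<2 * Suc n - 1. laplace_coeff j 1 h d)
     = (\<Sum>j<2 * n - 1. laplace_coeff j 1 h d) + laplace_coeff (2 * n - 1) 1 h d"
    unfolding e(1) sum.lessThan_Suc by (simp only: e(2) add_0_right)
  also have "\<dots> = (\<Sum>l=1..<n. laplace_coeff (2 * l - 1) 1 h d) + laplace_coeff (2 * n - 1) 1 h d"
    by (simp only: Suc.IH)
  also have "\<dots> = (\<Sum>l=1..<Suc n. laplace_coeff (2 * l - 1) 1 h d)"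
    using Suc.hyps by (simp only: sum.atLeastLessThan_Suc)
  finally show ?case .
qed

lemma w10_laplace_expansion:
  assumes \<gamma>: "\<gamma> > 0"
  shows "\<exists>P :: nat \<Rightarrow> ((nat \<times> nat \<times> nat) \<Rightarrow>\<^sub>0 real).
        (\<forall>l\<ge>1. homogeneous_of_power (P l) (1 - 4 * int l)) \<and>
        asymptotic_series (laplace_filter \<gamma>)
          (\<lambda>(\<xi>, \<tau>). w10 \<phi> \<xi> \<tau>)
          (\<lambda>l (\<xi>, \<tau>). if l = 0 then inverse (deriv (deriv \<phi>) 0) * H \<xi> \<tau> else eval_poly3 (P l) \<xi> \<tau>)
          (\<lambda>l (\<xi>, \<tau>). (3 * (H \<xi> \<tau>)\<^sup>2 - \<tau>) powr ((1 - 4 * real l) / 2))"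
proof -
  define a where "a = deriv (deriv \<phi>) 0"
  have "\<exists>P. l \<ge> 1 \<longrightarrow> homogeneous_of_power P (1 - 4 * int l) \<and>
     (\<forall>\<xi> \<tau>. eval_poly3 P \<xi> \<tau> = 2 / a * laplace_coeff (2 * l - 1) 1 (H \<xi> \<tau>) (3 * (H \<xi> \<tau>)\<^sup>2 - \<tau>))" for l
  proof (cases "l \<ge> 1")
    case True
    have "homogeneous_fun (1 - 4 * int l) (\<lambda>h d. 2 / a * h ^ 0 * inverse d ^ 0 * laplace_coeff (2 * l - 1) 1 h d)"
      by (rule homogeneous_fun_mult_monomial[OF homogeneous_laplace_coeff]) (use True in \<open>auto simp: of_nat_diff\<close>)
    from homogeneous_fun_eval_poly3[OF this] show ?thesis by simp
  qed auto
  hence "\<exists>P. \<forall>l. l \<ge> 1 \<longrightarrow> homogeneous_of_power (P l) (1 - 4 * int l) \<and>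
     (\<forall>\<xi> \<tau>. eval_poly3 (P l) \<xi> \<tau> = 2 / a * laplace_coeff (2 * l - 1) 1 (H \<xi> \<tau>) (3 * (H \<xi> \<tau>)\<^sup>2 - \<tau>))"
    by (intro choice allI)
  then obtain P where P: "\<And>l. l \<ge> 1 \<Longrightarrow> homogeneous_of_power (P l) (1 - 4 * int l)"
    "\<And>l \<xi> \<tau>. l \<ge> 1 \<Longrightarrow> eval_poly3 (P l) \<xi> \<tau> = 2 / a * laplace_coeff (2 * l - 1) 1 (H \<xi> \<tau>) (3 * (H \<xi> \<tau>)\<^sup>2 - \<tau>)"
    by blast
  have w: "w10 \<phi> \<xi> \<tau> = inverse a * H \<xi> \<tau> + 2 / a * avg \<xi> \<tau> (\<lambda>s. (s - H \<xi> \<tau> / 2) ^ 1)" for \<xi> \<tau>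
  proof -
    have "avg \<xi> \<tau> (\<lambda>s. s - H \<xi> \<tau> / 2) = avg \<xi> \<tau> (\<lambda>s. s) - H \<xi> \<tau> / 2"
      by (subst avg_diff) (auto intro!: polynomial_function_intros simp: avg_const)
    thus ?thesis unfolding w10_eq_avg a_def[symmetric] power_one_right
      by (simp only: right_diff_distrib) (simp add: inverse_eq_divide)
  qed
  have "asymptotic_series (laplace_filter \<gamma>)
          (\<lambda>(\<xi>, \<tau>). w10 \<phi> \<xi> \<tau>)
          (\<lambda>l (\<xi>, \<tau>). if l = 0 then inverse a * H \<xi> \<tau> else eval_poly3 (P l) \<xi> \<tau>)
          (\<lambda>l (\<xi>, \<tau>). (3 * (H \<xi> \<tau>)\<^sup>2 - \<tau>) powr ((1 - 4 * real l) / 2))"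
    unfolding asymptotic_series_def
  proof (intro conjI allI)
    fix n
    have "((\<lambda>x::real. x powr ((1 - 4 * real (Suc n)) / 2)) \<in> o(\<lambda>x. x powr ((1 - 4 * real n) / 2)))"
      by (subst powr_smallo_iff) (auto intro: filterlim_ident)
    from landau_o.small.compose[OF this filterlim_laplace_filter[of \<gamma>]]
    show "(\<lambda>(\<xi>, \<tau>). (3 * (H \<xi> \<tau>)\<^sup>2 - \<tau>) powr ((1 - 4 * real (Suc n)) / 2)) \<in>
      o[laplace_filter \<gamma>](\<lambda>(\<xi>, \<tau>). (3 * (H \<xi> \<tau>)\<^sup>2 - \<tau>) powr ((1 - 4 * real n) / 2))"
      by (simp add: case_prod_unfold)
  next
    fix n
    show "(\<lambda>x. (case x of (\<xi>, \<tau>) \<Rightarrow> w10 \<phi> \<xi> \<tau>) -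
       (\<Sum>k<n. case x of (\<xi>, \<tau>) \<Rightarrow> if k = 0 then inverse a * H \<xi> \<tau> else eval_poly3 (P k) \<xi> \<tau>))
       \<in> O[laplace_filter \<gamma>](\<lambda>(\<xi>, \<tau>). (3 * (H \<xi> \<tau>)\<^sup>2 - \<tau>) powr ((1 - 4 * real n) / 2))"
    proof (cases "n = 0")
      case True
      have "(\<lambda>p. curvature p powr (- (real 1 / 2) - real 0)) \<in> laplace_O \<gamma> (1 / 2)"
        by (rule powr_curvature_bigo_mono) simp
      from landau_o.big_trans[OF moment_expansion[OF \<gamma>, of 1 0, unfolded lessThan_0 sum.empty diff_zero] this]
      have m: "(\<lambda>p. 2 / a * avg (fst p) (snd p) (\<lambda>s. (s - H (fst p) (snd p) / 2) ^ 1)) \<in>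
        laplace_O \<gamma> (1 / 2)"
        by (rule cmult_in_bigo_iff[THEN iffD2, OF disjI2])
      have "(\<lambda>p. inverse a * H (fst p) (snd p)) \<in> laplace_O \<gamma> (1 / 2)"
        by (rule cmult_in_bigo_iff[THEN iffD2, OF disjI2, OF H_bigo])
      from sum_in_bigo(1)[OF this m] show ?thesis
        unfolding w[symmetric] True by (simp add: case_prod_unfold)
    next
      case False
      have eq: "(case x of (\<xi>, \<tau>) \<Rightarrow> w10 \<phi> \<xi> \<tau>) -
         (\<Sum>k<n. case x of (\<xi>, \<tau>) \<Rightarrow> if k = 0 then inverse a * H \<xi> \<tau> else eval_poly3 (P k) \<xi> \<tau>) =
         2 / a * (avg (fst x) (snd x) (\<lambda>s. (s - H (fst x) (snd x) / 2) ^ 1)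
          - (\<Sum>j<2 * n - 1. laplace_coeff j 1 (H (fst x) (snd x)) (curvature x)))" for x
      proof -
        obtain \<xi> \<tau> where x: "x = (\<xi>, \<tau>)" by (cases x)
        have "(\<Sum>k<n. if k = 0 then inverse a * H \<xi> \<tau> else eval_poly3 (P k) \<xi> \<tau>)
           = inverse a * H \<xi> \<tau> + (\<Sum>k=1..<n. eval_poly3 (P k) \<xi> \<tau>)"
          using False by (simp add: lessThan_atLeast0 sum.atLeast_Suc_lessThan[of 0 n])
        also have "(\<Sum>k=1..<n. eval_poly3 (P k) \<xi> \<tau>) = (\<Sum>k=1..<n. 2 / a * laplace_coeff (2 * k - 1) 1 (H \<xi> \<tau>) (3 * (H \<xi> \<tau>)\<^sup>2 - \<tau>))"
          by (intro sum.cong refl P(2)) auto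
        also have "\<dots> = 2 / a * (\<Sum>j<2 * n - 1. laplace_coeff j 1 (H \<xi> \<tau>) (3 * (H \<xi> \<tau>)\<^sup>2 - \<tau>))"
          using sum_odd_laplace_coeff[of n "H \<xi> \<tau>" "3 * (H \<xi> \<tau>)\<^sup>2 - \<tau>"] False
          by (simp add: sum_distrib_left)
        finally show ?thesis unfolding x w by (simp only: split fst_conv snd_conv right_diff_distrib add_diff_add diff_add_eq diff_diff_add add_diff_cancel_left)
      qed
      have "- (real 1 / 2) - real (2 * n - 1) = (1 - 4 * real n) / 2" using False by (simp add: of_nat_diff field_simps)
      with moment_expansion[OF \<gamma>, of 1 "2 * n - 1"]
      have "(\<lambda>x. avg (fst x) (snd x) (\<lambda>s. (s - H (fst x) (snd x) / 2) ^ 1)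
          - (\<Sum>j<2 * n - 1. laplace_coeff j 1 (H (fst x) (snd x)) (curvature x)))
         \<in> O[laplace_filter \<gamma>](\<lambda>x. curvature x powr ((1 - 4 * real n) / 2))" by (simp only:)
      from cmult_in_bigo_iff[THEN iffD2, OF disjI2, OF this, of "2 / a"]
      show ?thesis unfolding eq by (simp only: case_prod_unfold)
    qed
  qed
  thus ?thesis using P(1) unfolding a_def by blast
qed

section \<open>A contracting linear differential equation\<close>

text \<open>
  The factor \<open>\<mu>\<close> solves \<open>\<mu>' = (tanh t - 1/2) \<mu>\<close>, so that
  \<open>v = \<mu> e\<close> satisfies an equation whose linear coefficient is nonpositive and whose
  forcing is at most \<open>K exp (t/2)\<close>. As \<open>\<mu>\<close> itself is comparable to
  \<open>exp (t/2)\<close>, the growth cancels and the bound does not depend on \<open>z\<close>. Only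
  an upper bound for \<open>p\<close> enters, which later spares any a priori smallness of the unknown.
\<close>

lemma stable_linear_ode_bound_pos:
  fixes e p r :: "real \<Rightarrow> real"
  assumes z: "z \<ge> 0" and e0: "e 0 = 0"
    and der: "\<And>t. 0 \<le> t \<Longrightarrow> t \<le> z \<Longrightarrow> (e has_real_derivative p t * e t + r t) (at t)"
    and p: "\<And>t. 0 \<le> t \<Longrightarrow> t \<le> z \<Longrightarrow> p t \<le> 1 / 2 - tanh t"
    and r: "\<And>t. 0 \<le> t \<Longrightarrow> t \<le> z \<Longrightarrow> \<bar>r t\<bar> \<le> K"
  shows "\<bar>e z\<bar> \<le> 4 * K"
proof -
  define \<mu> where "\<mu> = (\<lambda>t::real. cosh t * exp (- t / 2))"
  have \<mu>pos: "\<mu> t > 0" for t unfolding \<mu>_def by (simp add: cosh_real_pos)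
  have \<mu>le: "\<mu> t \<le> exp (t / 2)" if "t \<ge> 0" for t
  proof -
    have "cosh t \<le> exp t" using that by (simp add: cosh_def)
    hence "\<mu> t \<le> exp t * exp (- t / 2)" unfolding \<mu>_def by (intro mult_right_mono) auto
    also have "\<dots> = exp (t / 2)" by (simp flip: exp_add)
    finally show ?thesis .
  qed
  have \<mu>ge: "exp (t / 2) / 2 \<le> \<mu> t" for t
  proof -
    have "exp t / 2 * exp (- t / 2) \<le> \<mu> t" unfolding \<mu>_def by (intro mult_right_mono) (auto simp: cosh_def)
    moreover have "exp t * exp (- t / 2) = exp (t / 2)" by (simp flip: exp_add)
    ultimately show ?thesis by simp
  qed
  have K: "K \<ge> 0" using r[of 0] z by simp
  define v where "v = (\<lambda>t. \<mu> t * e t)"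
  have v': "(v has_real_derivative (tanh t - 1 / 2 + p t) * v t + \<mu> t * r t) (at t)" if "0 \<le> t" "t \<le> z" for t
  proof -
    have c: "cosh t \<noteq> 0" using cosh_real_pos[of t] by linarith
    have "(\<mu> has_real_derivative (tanh t - 1 / 2) * \<mu> t) (at t)"
      unfolding \<mu>_def by (auto intro!: derivative_eq_intros simp: tanh_def field_simps c)
    thus ?thesis unfolding v_def
      by (rule DERIV_cong[OF DERIV_mult[OF _ der[OF that]]]) (simp add: algebra_simps)
  qed
  \<comment> \<open>\<open>\<surd>(v^2 + \<delta>^2)\<close> replaces \<open>|v|\<close>, which need not be differentiable.\<close>
  have bound: "\<bar>v z\<bar> \<le> \<delta> + 2 * K * exp (z / 2)" if \<delta>: "\<delta> > 0" for \<delta>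
  proof -
    define w where "w = (\<lambda>t. sqrt ((v t)\<^sup>2 + \<delta>\<^sup>2))"
    have pos: "(v t)\<^sup>2 + \<delta>\<^sup>2 > 0" for t using \<delta> by (simp add: add_nonneg_pos)
    have wpos: "w t > 0" and vw: "\<bar>v t\<bar> \<le> w t" for t unfolding w_def using pos[of t] by (auto intro!: real_le_rsqrt)
    define g where "g = (\<lambda>t. w t - 2 * K * exp (t / 2))"
    have "g z \<le> g 0"
    proof (rule DERIV_nonpos_imp_nonincreasing[OF z])
      fix t assume t: "0 \<le> t" "t \<le> z"
      define d where "d = (tanh t - 1 / 2 + p t) * v t + \<mu> t * r t"
      have g': "(g has_real_derivative v t * d / w t - K * exp (t / 2)) (at t)"
      proof -
        have "((\<lambda>t. (v t)\<^sup>2 + \<delta>\<^sup>2) has_real_derivative 2 * v t * d) (at t)"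
          by (auto intro!: derivative_eq_intros v'[OF t, folded d_def])
        from DERIV_chain2[OF DERIV_real_sqrt[OF pos] this]
        have "(w has_real_derivative inverse (w t) / 2 * (2 * v t * d)) (at t)" unfolding w_def .
        moreover have "((\<lambda>t. 2 * K * exp (t / 2)) has_real_derivative K * exp (t / 2)) (at t)"
          by (auto intro!: derivative_eq_intros)
        ultimately have "(g has_real_derivative inverse (w t) / 2 * (2 * v t * d) - K * exp (t / 2)) (at t)"
          unfolding g_def by (rule DERIV_diff)
        thus ?thesis by (rule DERIV_cong) (use wpos[of t] in \<open>simp add: field_simps\<close>)
      qed
      have "v t * d = (tanh t - 1 / 2 + p t) * (v t)\<^sup>2 + v t * (\<mu> t * r t)"
        unfolding d_def by (simp add: algebra_simps power2_eq_square)
      also have "\<dots> \<le> 0 + w t * (exp (t / 2) * K)"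
      proof (rule add_mono)
        show "(tanh t - 1 / 2 + p t) * (v t)\<^sup>2 \<le> 0" using p[OF t] by (intro mult_nonpos_nonneg) auto
        have "v t * (\<mu> t * r t) \<le> \<bar>v t\<bar> * (\<mu> t * \<bar>r t\<bar>)"
          using \<mu>pos[of t] by (metis abs_ge_self abs_mult abs_of_pos)
        also have "\<dots> \<le> w t * (exp (t / 2) * K)"
          using vw[of t] \<mu>le[OF t(1)] r[OF t] \<mu>pos[of t] wpos[of t]
          by (intro mult_mono) auto
        finally show "v t * (\<mu> t * r t) \<le> w t * (exp (t / 2) * K)" .
      qed
      finally have "v t * d / w t \<le> K * exp (t / 2)" using wpos[of t] by (simp add: field_simps)
      thus "\<exists>y. (g has_real_derivative y) (at t) \<and> y \<le> 0" using g' by (intro exI conjI) auto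
    qed
    hence "w z \<le> w 0 + 2 * K * exp (z / 2) - 2 * K" by (simp add: g_def)
    also have "w 0 = \<delta>" using \<delta> by (simp add: w_def v_def e0)
    finally show ?thesis using vw[of z] K by linarith
  qed
  have "\<bar>v z\<bar> \<le> 2 * K * exp (z / 2)" by (rule field_le_epsilon) (use bound in \<open>auto simp: add.commute\<close>)
  hence "\<mu> z * \<bar>e z\<bar> \<le> 2 * K * exp (z / 2)" unfolding v_def using \<mu>pos[of z] by (simp add: abs_mult)
  moreover have "exp (z / 2) / 2 * \<bar>e z\<bar> \<le> \<mu> z * \<bar>e z\<bar>" using \<mu>ge[of z] by (intro mult_right_mono) auto
  ultimately have "exp (z / 2) / 2 * \<bar>e z\<bar> \<le> 2 * K * exp (z / 2)" by (rule order_trans[rotated])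
  also have "2 * K * exp (z / 2) = exp (z / 2) / 2 * (4 * K)" by simp
  finally have "0 \<le> exp (z / 2) / 2 * (4 * K - \<bar>e z\<bar>)" by (simp only: right_diff_distrib diff_ge_0_iff_ge)
  thus ?thesis by (simp add: zero_le_mult_iff)
qed

lemma stable_linear_ode_bound:
  fixes e p r :: "real \<Rightarrow> real"
  assumes e0: "e 0 = 0"
    and der: "\<And>t. \<bar>t\<bar> \<le> \<bar>z\<bar> \<Longrightarrow> (e has_real_derivative p t * e t + r t) (at t)"
    and p: "\<And>t. \<bar>t\<bar> \<le> \<bar>z\<bar> \<Longrightarrow> t \<ge> 0 \<Longrightarrow> p t \<le> 1 / 2 - tanh t"
    and p_neg: "\<And>t. \<bar>t\<bar> \<le> \<bar>z\<bar> \<Longrightarrow> t \<le> 0 \<Longrightarrow> - p t \<le> 1 / 2 + tanh t"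
    and r: "\<And>t. \<bar>t\<bar> \<le> \<bar>z\<bar> \<Longrightarrow> \<bar>r t\<bar> \<le> K"
  shows "\<bar>e z\<bar> \<le> 4 * K"
proof (cases "z \<ge> 0")
  case True
  show ?thesis
    by (rule stable_linear_ode_bound_pos[OF True e0 der p r]) (use True in auto)
next
  case False
  have "\<bar>(\<lambda>t. e (- t)) (- z)\<bar> \<le> 4 * K"
  proof (rule stable_linear_ode_bound_pos[where e = "\<lambda>t. e (- t)" and z = "- z" and p = "\<lambda>t. - p (- t)" and r = "\<lambda>t. - r (- t)"])
    fix t assume t: "0 \<le> t" "t \<le> - z"
    have "((\<lambda>t. e (- t)) has_real_derivative (p (- t) * e (- t) + r (- t)) * (- 1)) (at t)"
      by (rule DERIV_chain2[OF der]) (use t False in \<open>auto intro!: derivative_eq_intros\<close>)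
    thus "((\<lambda>t. e (- t)) has_real_derivative - p (- t) * e (- t) + - r (- t)) (at t)" by simp
    show "- p (- t) \<le> 1 / 2 - tanh t" using p_neg[of "- t"] t False by simp
    show "\<bar>- r (- t)\<bar> \<le> K" using r[of "- t"] t False by simp
  qed (use False e0 in auto)
  thus ?thesis by simp
qed

section \<open>The coefficients of the expansion across the shock\<close>

text \<open>
  The antiderivative that vanishes at \<open>0\<close>, on both sides of \<open>0\<close> at once; a
  continuous function determines it uniquely.
\<close>

definition antiderivative :: "(real \<Rightarrow> real) \<Rightarrow> real \<Rightarrow> real" where
  "antiderivative f = (SOME F. F 0 = 0 \<and> (\<forall>z. (F has_real_derivative f z) (at z)))"

lemma antiderivative:
  assumes "continuous_on UNIV f"
  shows "antiderivative f 0 = 0" "(antiderivative f has_real_derivative f z) (at z)"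
proof -
  have "isCont f x" for x using assms by (simp add: continuous_on_eq_continuous_at)
  then obtain F where F: "\<And>x. (F has_real_derivative f x) (at x)"
    using einterval_antiderivative[of "-\<infinity>" "\<infinity>" f]
    by (auto simp: has_real_derivative_iff_has_vector_derivative)
  have "\<exists>F. F 0 = 0 \<and> (\<forall>z. (F has_real_derivative f z) (at z))"
    by (intro exI[of _ "\<lambda>x. F x - F 0"]) (auto intro!: derivative_eq_intros F)
  from someI_ex[OF this] show "antiderivative f 0 = 0" "(antiderivative f has_real_derivative f z) (at z)"
    unfolding antiderivative_def by auto
qed

text \<open>
  The coefficients of \<open>\<epsilon>^k\<close> in the moments \<open>A\<^sub>n\<close> and
  \<open>B\<^sub>n\<close>. The equations for \<open>n \<ge> 1\<close> are the recurrences
  \<open>momA_recursion\<close> and \<open>momB_recursion\<close> at order \<open>k\<close>; the former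
  ties \<open>A\<^sub>n\<close> to \<open>A\<^sub>n\<^sub>+\<^sub>1\<close> at the same order, which
  terminates because \<open>A\<^sub>n\<close> has no terms of order below \<open>n/2\<close>. The
  equation for \<open>n = 0\<close> solves the order \<open>k\<close> of the Riccati equation,
  \<open>Q\<^sub>k' = - 2 tanh z Q\<^sub>k + \<dots>\<close>, by variation of constants; its
  homogeneous solution is \<open>1 / (cosh z)^2\<close>.
\<close>

function coefA coefB :: "nat \<Rightarrow> nat \<Rightarrow> real \<Rightarrow> real" where
  "coefA n k = (if n = 0 then (\<lambda>z. if k = 0 then 1 else 0)
     else if k = 0 \<or> n > 2 * k then (\<lambda>z. 0)
     else (\<lambda>z. ((2 * real n - 1) * coefA (n - 1) (k - 1) z + 2 * real (n - 1) * coefA (n - 2) (k - 1) z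
        - z * coefB (n - 1) (k - 1) z) / 4 - coefA (n + 1) k z))"
| "coefB n k = (if n = 0 then (if k = 0 then (\<lambda>z. - tanh z)
        else (\<lambda>z. antiderivative (\<lambda>t. (cosh t)\<^sup>2 * ((\<Sum>i=1..<k. coefB 0 i t * coefB 0 (k - i) t) - coefA 1 k t)) z / (cosh z)\<^sup>2))
     else if k = 0 then (\<lambda>z. 0)
     else (\<lambda>z. (2 * real (n - 1) * coefB (n - 2) (k - 1) z - z * coefA (n - 1) (k - 1) z) / 4))"
  by pat_completeness auto
termination
  by (relation "inv_image (less_than <*lex*> less_than)
      (\<lambda>x. case x of Inl (n, k) \<Rightarrow> (k, 2 * k + 1 - n) | Inr (n, k) \<Rightarrow> (k, 2 * k + 2))") auto

(* The equations are unconditional, so rewriting with them would not stop. *)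
declare coefA.simps [simp del] coefB.simps [simp del]

lemma coefA_0: "coefA 0 k z = (if k = 0 then 1 else 0)"
  by (subst coefA.simps) simp

lemma coefA_vanish: "n > 2 * k \<Longrightarrow> coefA n k z = 0"
  by (subst coefA.simps) simp

lemma coefB_Suc_0: "coefB (Suc n) 0 z = 0"
  by (subst coefB.simps) simp

lemma coefB_Suc_Suc: "coefB (Suc n) (Suc k) z = (2 * real n * coefB (n - 1) k z - z * coefA n k z) / 4"
  by (subst coefB.simps) simp

lemma coefB_vanish: "n > 2 * k \<Longrightarrow> coefB n k z = 0"
proof (induction k arbitrary: n)
  case 0
  thus ?case by (cases n) (auto simp: coefB_Suc_0)
next
  case (Suc k)
  then obtain m where m: "n = Suc m" by (cases n) auto
  show ?case using Suc by (simp add: m coefB_Suc_Suc coefA_vanish)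
qed

lemma coefA_recursion:
  "coefA (Suc n) (Suc k) z + coefA (n + 2) (Suc k) z =
     ((1 + 2 * real n) * coefA n k z + 2 * real n * coefA (n - 1) k z - z * coefB n k z) / 4"
proof (cases "Suc n > 2 * Suc k")
  case True
  thus ?thesis by (simp add: coefA_vanish coefB_vanish)
next
  case False
  thus ?thesis by (subst coefA.simps) (simp add: algebra_simps)
qed

lemma coefB_0_0: "coefB 0 0 z = - tanh z"
  by (subst coefB.simps) simp


text \<open>
  Induction along the definition of the coefficients, for properties that may depend on the index and
  the order. Differentiability, membership in an algebra of functions, and growth all follow this
  pattern.
\<close>

lemma coef_induct:
  assumes zero: "\<And>n k. n > 2 * k \<Longrightarrow> P n k (\<lambda>z. 0 :: real)" and one: "P 0 0 (\<lambda>z. 1)" "\<And>k. P 0 k (\<lambda>z. 0)"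
    and B0: "\<And>k. (\<And>n. P n k (coefA n k)) \<Longrightarrow> (\<And>n j. j < k \<Longrightarrow> P n j (coefB n j)) \<Longrightarrow> P 0 k (coefB 0 k)"
    and A: "\<And>n k. P n k (coefA n k) \<Longrightarrow> P (n - 1) k (coefA (n - 1) k) \<Longrightarrow> P n k (coefB n k) \<Longrightarrow> P (n + 2) (Suc k) (coefA (n + 2) (Suc k))
       \<Longrightarrow> P (Suc n) (Suc k) (\<lambda>z. ((1 + 2 * real n) * coefA n k z + 2 * real n * coefA (n - 1) k z - z * coefB n k z) / 4 - coefA (n + 2) (Suc k) z)"
    and B: "\<And>n k. P (n - 1) k (coefB (n - 1) k) \<Longrightarrow> P n k (coefA n k) \<Longrightarrow> P (Suc n) (Suc k) (\<lambda>z. (2 * real n * coefB (n - 1) k z - z * coefA n k z) / 4)"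
  shows "P n k (coefA n k) \<and> P n k (coefB n k)"
proof (induction k arbitrary: n rule: less_induct)
  case (less k)
  note IH = less.IH
  have PA: "P n k (coefA n k)" for n
  proof (induction "2 * k + 1 - n" arbitrary: n rule: less_induct)
    case less
    consider "n = 0" | "n > 2 * k" | m j where "n = Suc m" "k = Suc j" "n \<le> 2 * k"
      by (cases n; cases k) (simp, simp, simp, use not_less in blast)
    thus ?case
    proof cases
      case 1
      hence "coefA n k = (if k = 0 then (\<lambda>z. 1) else (\<lambda>z. 0))" by (auto simp: coefA_0)
      thus ?thesis using 1 one by auto
    next
      case 2
      hence "coefA n k = (\<lambda>z. 0)" by (auto simp: coefA_vanish)
      thus ?thesis using 2 zero by simp
    next
      case 3
      have eq: "coefA n k = (\<lambda>z. ((1 + 2 * real m) * coefA m j z + 2 * real m * coefA (m - 1) j z - z * coefB m j z) / 4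
         - coefA (m + 2) k z)"
        using coefA_recursion[of m j] 3 by (auto simp: fun_eq_iff algebra_simps)
      have "P (m + 2) (Suc j) (coefA (m + 2) (Suc j))" using less[of "m + 2"] 3 by simp
      thus ?thesis unfolding eq unfolding 3 using IH[of j] 3 by (intro A) auto
    qed
  qed
  have PB: "P n k (coefB n k)" for n
  proof (cases n)
    case 0
    show ?thesis unfolding 0 by (rule B0) (use PA IH in auto)
  next
    case (Suc m)
    show ?thesis
    proof (cases k)
      case 0
      have "coefB n k = (\<lambda>z. 0)" unfolding 0 Suc by (auto simp: coefB_Suc_0)
      thus ?thesis using zero[of k n] 0 Suc by simp
    next
      case (Suc j)
      have eq: "coefB n k = (\<lambda>z. (2 * real m * coefB (m - 1) j z - z * coefA m j z) / 4)"
        unfolding Suc \<open>n = Suc m\<close> by (auto simp: coefB_Suc_Suc)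
      show ?thesis unfolding eq unfolding Suc \<open>n = Suc m\<close> using IH[of j] Suc by (intro B) auto
    qed
  qed
  from PA PB show ?case by blast
qed

lemma coef_differentiable: "(\<forall>z. coefA n k differentiable at z) \<and> (\<forall>z. coefB n k differentiable at z)"
proof (rule coef_induct[where P = "\<lambda>n k f. \<forall>z. f differentiable at z"]; (intro allI)?)
  fix k :: nat and z :: real
  assume A: "\<And>n. \<forall>z. coefA n k differentiable at z" and B: "\<And>n j. j < k \<Longrightarrow> \<forall>z. coefB n j differentiable at z"
  show "coefB 0 k differentiable at z"
  proof (cases "k = 0")
    case True
    have "((\<lambda>z. - tanh z) has_real_derivative - (1 - (tanh z)\<^sup>2)) (at z)"
      using cosh_real_pos[of z] by (auto intro!: derivative_eq_intros)
    moreover have "coefB 0 k = (\<lambda>z. - tanh z)" unfolding True by (auto simp: coefB_0_0)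
    ultimately show ?thesis unfolding real_differentiable_def by auto
  next
    case False
    define R where "R = (\<lambda>t. (cosh t)\<^sup>2 * ((\<Sum>i=1..<k. coefB 0 i t * coefB 0 (k - i) t) - coefA 1 k t))"
    have cont: "continuous_on UNIV f" if "\<forall>z. f differentiable at z" for f :: "real \<Rightarrow> real"
      using that by (auto simp: continuous_on_eq_continuous_at intro!: differentiable_imp_continuous_within)
    have "continuous_on UNIV R" unfolding R_def
      by (intro continuous_intros cont A B) auto
    hence d: "antiderivative R differentiable at z"
      unfolding real_differentiable_def using antiderivative(2) by blast
    have eq: "coefB 0 k = (\<lambda>z. antiderivative R z / (cosh z)\<^sup>2)"
      unfolding R_def by (subst coefB.simps) (use False in simp)
    have "((\<lambda>z. (cosh z)\<^sup>2) has_real_derivative 2 * cosh z * sinh z) (at z)"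
      by (auto intro!: derivative_eq_intros)
    hence "(\<lambda>z. (cosh z)\<^sup>2) differentiable at z" unfolding real_differentiable_def by blast
    thus ?thesis unfolding eq using cosh_real_pos[of z] by (intro differentiable_divide d) auto
  qed
qed (intro differentiable_diff differentiable_divide differentiable_add differentiable_mult
      differentiable_const differentiable_ident; simp)+

definition coefA' where "coefA' n k z = deriv (coefA n k) z"
definition coefB' where "coefB' n k z = deriv (coefB n k) z"

lemma coefA_deriv: "(coefA n k has_real_derivative coefA' n k z) (at z)"
  unfolding coefA'_def using coef_differentiable[of n k]
  by (simp add: DERIV_deriv_iff_real_differentiable)

lemma coefB_deriv: "(coefB n k has_real_derivative coefB' n k z) (at z)"
  unfolding coefB'_def using coef_differentiable[of n k]
  by (simp add: DERIV_deriv_iff_real_differentiable)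

lemma coef_continuous: "continuous_on S (coefA n k)" "continuous_on S (coefB n k)"
  using coefA_deriv coefB_deriv by (meson DERIV_continuous_on has_field_derivative_at_within)+

lemma coefB_0_at_0: "coefB 0 k 0 = 0"
proof (cases "k = 0")
  case False
  have "continuous_on UNIV (\<lambda>t. (cosh t)\<^sup>2 * ((\<Sum>i=1..<k. coefB 0 i t * coefB 0 (k - i) t) - coefA 1 k t))"
    by (intro continuous_intros coef_continuous)
  thus ?thesis using False antiderivative(1) by (subst coefB.simps) simp
qed (simp add: coefB_0_0)

text \<open>
  The order \<open>k\<close> of the Riccati equation
  \<open>\<partial>B\<^sub>0/\<partial>z = B\<^sub>0^2 - 1 - A\<^sub>1\<close>; the terms
  \<open>i = 0\<close> and \<open>i = k\<close> of the sum make up the linear part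
  \<open>- 2 tanh z Q\<^sub>k\<close>.
\<close>

lemma riccati_coefficients:
  "coefB' 0 k z = (\<Sum>i\<le>k. coefB 0 i z * coefB 0 (k - i) z) - (if k = 0 then 1 else 0) - coefA 1 k z"
proof (cases "k = 0")
  case True
  have "coefB 0 0 = (\<lambda>z. - tanh z)" by (auto simp: coefB_0_0)
  hence "(coefB 0 0 has_real_derivative (tanh z)\<^sup>2 - 1) (at z)"
    using cosh_real_pos[of z] by (auto intro!: derivative_eq_intros)
  hence "coefB' 0 0 z = (tanh z)\<^sup>2 - 1" unfolding coefB'_def by (rule DERIV_imp_deriv)
  thus ?thesis using True by (simp add: coefB_0_0 coefA_vanish power2_eq_square)
next
  case False
  define S where "S = (\<lambda>t. (\<Sum>i=1..<k. coefB 0 i t * coefB 0 (k - i) t) - coefA 1 k t)"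
  define R where "R = (\<lambda>t. (cosh t)\<^sup>2 * S t)"
  have cont: "continuous_on UNIV R" unfolding R_def S_def by (intro continuous_intros coef_continuous)
  have eq: "coefB 0 k = (\<lambda>z. antiderivative R z / (cosh z)\<^sup>2)"
    unfolding R_def S_def by (subst coefB.simps) (use False in simp)
  have c: "cosh z \<noteq> 0" using cosh_real_pos[of z] by linarith
  have "(coefB 0 k has_real_derivative S z - 2 * tanh z * coefB 0 k z) (at z)"
  proof -
    have "((\<lambda>z. (cosh z)\<^sup>2) has_real_derivative 2 * cosh z * sinh z) (at z)"
      by (auto intro!: derivative_eq_intros)
    from DERIV_divide[OF antiderivative(2)[OF cont] this] c
    have "(coefB 0 k has_real_derivative (R z * (cosh z)\<^sup>2 - antiderivative R z * (2 * cosh z * sinh z)) / ((cosh z)\<^sup>2 * (cosh z)\<^sup>2)) (at z)"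
      unfolding eq by simp
    moreover have "(R z * (cosh z)\<^sup>2 - antiderivative R z * (2 * cosh z * sinh z)) / ((cosh z)\<^sup>2 * (cosh z)\<^sup>2)
       = S z - 2 * tanh z * coefB 0 k z"
      unfolding eq using c by (simp add: R_def tanh_def field_simps power2_eq_square)
    ultimately show ?thesis by simp
  qed
  hence "coefB' 0 k z = S z - 2 * tanh z * coefB 0 k z" unfolding coefB'_def by (rule DERIV_imp_deriv)
  moreover have "(\<Sum>i\<le>k. coefB 0 i z * coefB 0 (k - i) z) =
      (\<Sum>i=1..<k. coefB 0 i z * coefB 0 (k - i) z) + 2 * coefB 0 0 z * coefB 0 k z"
  proof -
    have "{..k} = insert 0 (insert k {1..<k})" using False by auto
    thus ?thesis using False by simp
  qed
  ultimately show ?thesis using False by (simp add: S_def coefB_0_0)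
qed

section \<open>The coefficients as formal power series\<close>

(* The dollar sign denotes coefficients of power series from here on, not vector components. *)
unbundle fps_syntax
no_notation vec_nth (infixl \<open>$\<close> 90)

text \<open>
  Coefficientwise derivative in the parameter \<open>z\<close> of a family of power series in
  \<open>\<epsilon>\<close>.
\<close>

definition has_zderiv :: "(real \<Rightarrow> real fps) \<Rightarrow> (real \<Rightarrow> real fps) \<Rightarrow> bool" where
  "has_zderiv F F' \<longleftrightarrow> (\<forall>k z. ((\<lambda>z. F z $ k) has_real_derivative F' z $ k) (at z))"

lemma has_zderiv_unique: "has_zderiv F F' \<Longrightarrow> has_zderiv F G' \<Longrightarrow> F' z = G' z"
  unfolding has_zderiv_def by (intro fps_ext) (meson DERIV_unique)

lemma has_zderiv_const: "has_zderiv (\<lambda>z. c) (\<lambda>z. 0)"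
  unfolding has_zderiv_def by simp

lemma has_zderiv_ident: "has_zderiv (\<lambda>z. fps_const z) (\<lambda>z. 1)"
  unfolding has_zderiv_def
proof (intro allI)
  fix k :: nat and z :: real
  show "((\<lambda>z. fps_const z $ k) has_real_derivative 1 $ k) (at z)" by (cases k) auto
qed

lemma has_zderiv_add: "has_zderiv F F' \<Longrightarrow> has_zderiv G G' \<Longrightarrow> has_zderiv (\<lambda>z. F z + G z) (\<lambda>z. F' z + G' z)"
  unfolding has_zderiv_def by (auto intro!: derivative_intros)

lemma has_zderiv_diff: "has_zderiv F F' \<Longrightarrow> has_zderiv G G' \<Longrightarrow> has_zderiv (\<lambda>z. F z - G z) (\<lambda>z. F' z - G' z)"
  unfolding has_zderiv_def by (auto intro!: derivative_intros)

lemma has_zderiv_mult: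
  assumes "has_zderiv F F'" "has_zderiv G G'"
  shows "has_zderiv (\<lambda>z. F z * G z) (\<lambda>z. F' z * G z + F z * G' z)"
  unfolding has_zderiv_def fps_add_nth fps_mult_nth sum.distrib[symmetric]
  using assms unfolding has_zderiv_def
  by (auto intro!: DERIV_sum derivative_eq_intros)

lemma has_zderiv_cmult: "has_zderiv F F' \<Longrightarrow> has_zderiv (\<lambda>z. c * F z) (\<lambda>z. c * F' z)"
  using has_zderiv_mult[OF has_zderiv_const[of c], of F F'] by simp

lemma has_zderiv_fps_deriv: "has_zderiv F F' \<Longrightarrow> has_zderiv (\<lambda>z. fps_deriv (F z)) (\<lambda>z. fps_deriv (F' z))"
  unfolding has_zderiv_def by (auto intro!: derivative_eq_intros)

definition quarter_eps :: "real fps" where "quarter_eps = fps_const (1 / 4) * fps_X"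

lemma quarter_eps_nth: "(quarter_eps * F) $ k = (if k = 0 then 0 else F $ (k - 1) / 4)"
  unfolding quarter_eps_def mult.assoc by (cases k) (auto simp: fps_X_mult_nth)

text \<open>
  The recurrences between the moments, for formal power series in \<open>\<epsilon>\<close>. The last
  condition, that only finitely many members of the first family have a term of a given order, is what
  makes solutions unique, since the first recurrence determines a sum of two neighbours only.
\<close>

definition moment_system :: "real \<Rightarrow> (nat \<Rightarrow> real fps) \<Rightarrow> (nat \<Rightarrow> real fps) \<Rightarrow> bool" where
  "moment_system z A B \<longleftrightarrow>
     (\<forall>n. A (Suc n) + A (Suc (Suc n)) = quarter_eps * ((1 + 2 * of_nat n) * A n + 2 * of_nat n * A (n - 1) - fps_const z * B n)) \<and>
     (\<forall>n. B (Suc n) = quarter_eps * (2 * of_nat n * B (n - 1) - fps_const z * A n)) \<and>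
     (\<forall>k. \<forall>\<^sub>F n in sequentially. A n $ k = 0)"

lemma of_nat_fps_mult_nth: "((of_nat n :: real fps) * F) $ k = real n * F $ k"
  by (simp add: fps_of_nat[symmetric])

text \<open>
  A solution of the recurrences is determined by \<open>A\<^sub>0\<close> and \<open>B\<^sub>0\<close>.
  The right-hand sides carry a factor \<open>\<epsilon>\<close>, so at the first order at which
  something might survive they vanish; then \<open>A\<^sub>n\<close> is minus
  \<open>A\<^sub>n\<^sub>+\<^sub>1\<close> there, and both are \<open>0\<close> because
  \<open>A\<^sub>m\<close> is for large \<open>m\<close>. The truncated version, with
  \<open>B\<^sub>0\<close> zero only up to order \<open>K\<close>, yields one order more for the
  \<open>A\<^sub>n\<close> than is put in.
\<close>

lemma moment_system_zero:
  assumes sys: "moment_system z A B" and A0: "A 0 = 0" and B0: "\<And>j. j < K \<Longrightarrow> B 0 $ j = 0"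
  shows "k \<le> K \<Longrightarrow> A n $ k = 0" "k < K \<Longrightarrow> B n $ k = 0"
proof -
  have recA: "A (Suc n) + A (Suc (Suc n)) = quarter_eps * ((1 + 2 * of_nat n) * A n + 2 * of_nat n * A (n - 1) - fps_const z * B n)"
    and recB: "B (Suc n) = quarter_eps * (2 * of_nat n * B (n - 1) - fps_const z * A n)"
    and fin: "\<forall>\<^sub>F n in sequentially. A n $ k = 0" for n k
    using sys unfolding moment_system_def by blast+
  have main: "(k \<le> K \<longrightarrow> (\<forall>n. A n $ k = 0)) \<and> (k < K \<longrightarrow> (\<forall>n. B n $ k = 0))" for k
  proof (induction k rule: less_induct)
    case (less k)
    have IH: "k \<noteq> 0 \<Longrightarrow> k \<le> K \<Longrightarrow> A n $ (k - 1) = 0" "k \<noteq> 0 \<Longrightarrow> k \<le> K \<Longrightarrow> B n $ (k - 1) = 0" for n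
      using less.IH[of "k - 1"] by auto
    have A: "A n $ k = 0" if k: "k \<le> K" for n
    proof -
      have step: "A (Suc n) $ k = - A (Suc (Suc n)) $ k" for n
      proof -
        have "(A (Suc n) + A (Suc (Suc n))) $ k = 0"
          unfolding recA quarter_eps_nth using IH k
          by (simp add: ring_distribs mult.assoc of_nat_fps_mult_nth numeral_fps_const)
        thus ?thesis by simp
      qed
      obtain m where m: "\<And>n. n \<ge> m \<Longrightarrow> A n $ k = 0" using fin[of k] unfolding eventually_sequentially by blast
      have "A (Suc n) $ k = 0" for n
      proof (induction "m - n" arbitrary: n)
        case 0
        thus ?case using m by simp
      next
        case (Suc d)
        hence "A (Suc (Suc n)) $ k = 0" by simp
        thus ?case using step[of n] by simp
      qed
      thus ?thesis using A0 by (cases n) auto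
    qed
    have B: "B n $ k = 0" if k: "k < K" for n
    proof (cases n)
      case 0
      thus ?thesis using B0 k by simp
    next
      case (Suc m)
      show ?thesis unfolding Suc recB quarter_eps_nth using IH k
        by (simp add: mult.assoc of_nat_fps_mult_nth numeral_fps_const)
    qed
    from A B show ?case by blast
  qed
  show "k \<le> K \<Longrightarrow> A n $ k = 0" "k < K \<Longrightarrow> B n $ k = 0" using main[of k] by auto
qed

definition serA where "serA n z = Abs_fps (\<lambda>k. coefA n k z)"
definition serB where "serB n z = Abs_fps (\<lambda>k. coefB n k z)"
definition serA' where "serA' n z = Abs_fps (\<lambda>k. coefA' n k z)"
definition serB' where "serB' n z = Abs_fps (\<lambda>k. coefB' n k z)"

lemma has_zderiv_serA: "has_zderiv (serA n) (serA' n)" and has_zderiv_serB: "has_zderiv (serB n) (serB' n)"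
  unfolding has_zderiv_def serA_def serB_def serA'_def serB'_def by (simp_all add: coefA_deriv coefB_deriv)

lemma serA_0: "serA 0 z = 1"
  by (rule fps_ext) (simp add: serA_def coefA_0)

lemma moment_system_series: "moment_system z (\<lambda>n. serA n z) (\<lambda>n. serB n z)"
  unfolding moment_system_def
proof (intro conjI allI)
  fix n
  show "serA (Suc n) z + serA (Suc (Suc n)) z = quarter_eps * ((1 + 2 * of_nat n) * serA n z + 2 * of_nat n * serA (n - 1) z - fps_const z * serB n z)"
  proof (rule fps_ext)
    fix k
    show "(serA (Suc n) z + serA (Suc (Suc n)) z) $ k =
      (quarter_eps * ((1 + 2 * of_nat n) * serA n z + 2 * of_nat n * serA (n - 1) z - fps_const z * serB n z)) $ k"
    proof (cases k)
      case 0
      show ?thesis unfolding 0 quarter_eps_nth by (simp add: serA_def coefA_vanish)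
    next
      case (Suc j)
      show ?thesis unfolding Suc quarter_eps_nth using coefA_recursion[of n j z]
        by (simp add: serA_def serB_def ring_distribs mult.assoc of_nat_fps_mult_nth numeral_fps_const)
    qed
  qed
next
  fix n
  show "serB (Suc n) z = quarter_eps * (2 * of_nat n * serB (n - 1) z - fps_const z * serA n z)"
  proof (rule fps_ext)
    fix k
    show "serB (Suc n) z $ k = (quarter_eps * (2 * of_nat n * serB (n - 1) z - fps_const z * serA n z)) $ k"
    proof (cases k)
      case 0
      show ?thesis unfolding 0 quarter_eps_nth by (simp add: serB_def coefB_Suc_0)
    next
      case (Suc j)
      show ?thesis unfolding Suc quarter_eps_nth
        by (simp add: serA_def serB_def coefB_Suc_Suc mult.assoc of_nat_fps_mult_nth numeral_fps_const)
    qed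
  qed
next
  fix k
  show "\<forall>\<^sub>F n in sequentially. serA n z $ k = 0"
    using eventually_gt_at_top[of "2 * k"] by eventually_elim (simp add: serA_def coefA_vanish)
qed

lemmas serA_recursion = moment_system_series[unfolded moment_system_def, THEN conjunct1, rule_format]
lemmas serB_recursion = moment_system_series[unfolded moment_system_def, THEN conjunct2, THEN conjunct1, rule_format]

lemma serA_eventually_0_upto: "\<forall>\<^sub>F n in sequentially. \<forall>j\<le>k. serA n z $ j = 0"
  using eventually_gt_at_top[of "2 * k"] by eventually_elim (simp add: serA_def coefA_vanish)

lemma serB_nth_eventually_0: "\<forall>\<^sub>F n in sequentially. serB n z $ k = 0"
  using eventually_gt_at_top[of "2 * k"] by eventually_elim (simp add: serB_def coefB_vanish)

lemma riccati_series: "serB' 0 z = serB 0 z * serB 0 z - 1 - serA 1 z"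
  by (rule fps_ext) (simp add: serB'_def serB_def serA_def riccati_coefficients fps_mult_nth atLeast0AtMost)

lemma serA'_recursion:
  "serA' (Suc n) z + serA' (Suc (Suc n)) z = quarter_eps * ((1 + 2 * of_nat n) * serA' n z
     + 2 * of_nat n * serA' (n - 1) z - (serB n z + fps_const z * serB' n z))"
proof (rule has_zderiv_unique[OF has_zderiv_add[OF has_zderiv_serA has_zderiv_serA]])
  have "has_zderiv (\<lambda>z. quarter_eps * ((1 + 2 * of_nat n) * serA n z + 2 * of_nat n * serA (n - 1) z - fps_const z * serB n z))
    (\<lambda>z. quarter_eps * ((1 + 2 * of_nat n) * serA' n z + 2 * of_nat n * serA' (n - 1) z - (1 * serB n z + fps_const z * serB' n z)))"
    by (intro has_zderiv_cmult has_zderiv_add has_zderiv_diff has_zderiv_mult has_zderiv_serA has_zderiv_serB has_zderiv_ident)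
  thus "has_zderiv (\<lambda>z. serA (Suc n) z + serA (Suc (Suc n)) z) (\<lambda>z. quarter_eps * ((1 + 2 * of_nat n) * serA' n z
     + 2 * of_nat n * serA' (n - 1) z - (serB n z + fps_const z * serB' n z)))"
    by (simp only: serA_recursion mult_1_left)
qed

lemma serB'_recursion:
  "serB' (Suc n) z = quarter_eps * (2 * of_nat n * serB' (n - 1) z - (serA n z + fps_const z * serA' n z))"
proof (rule has_zderiv_unique[OF has_zderiv_serB])
  have "has_zderiv (\<lambda>z. quarter_eps * (2 * of_nat n * serB (n - 1) z - fps_const z * serA n z))
    (\<lambda>z. quarter_eps * (2 * of_nat n * serB' (n - 1) z - (1 * serA n z + fps_const z * serA' n z)))"
    by (intro has_zderiv_cmult has_zderiv_diff has_zderiv_mult has_zderiv_serA has_zderiv_serB has_zderiv_ident)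
  moreover have "serB (Suc n) = (\<lambda>z. quarter_eps * (2 * of_nat n * serB (n - 1) z - fps_const z * serA n z))"
    by (intro ext) (rule serB_recursion)
  ultimately show "has_zderiv (serB (Suc n)) (\<lambda>z. quarter_eps * (2 * of_nat n * serB' (n - 1) z - (serA n z + fps_const z * serA' n z)))"
    by (simp only: mult_1_left)
qed

lemma serA'_nth_eventually_0: "\<forall>\<^sub>F n in sequentially. serA' n z $ k = 0"
proof -
  have zero: "coefA' n k z = 0" if "n > 2 * k" for n
  proof -
    have "coefA n k = (\<lambda>_. 0)" using that by (auto simp: coefA_vanish)
    thus ?thesis by (simp add: coefA'_def)
  qed
  show ?thesis using eventually_gt_at_top[of "2 * k"]
    by eventually_elim (simp add: serA'_def zero)
qed

text \<open>
  Formal counterparts of the fact that the \<open>z\<close>-derivative of a mean is minus a covariance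
  with \<open>r\<close>. For actual means this is \<open>avg_has_derivative\<close>; for the formal
  series, which are defined through recurrences, the defects \<open>P\<close> and \<open>R\<close> of
  the two rules satisfy the same recurrences as the series themselves. \<open>P 0\<close> vanishes
  trivially and \<open>R 0\<close> by the Riccati equation.
\<close>

lemma serA'_eq: "serA' n z = serB 0 z * serA n z - serB n z"
  and serB'_eq: "serB' n z = serB 0 z * serB n z - serA n z - serA (Suc n) z"
proof -
  define y where "y = serB 0 z"
  define P where "P = (\<lambda>n. serA' n z - y * serA n z + serB n z)"
  define R where "R = (\<lambda>n. serB' n z - y * serB n z + serA n z + serA (Suc n) z)"
  have A': "serA' n z = P n + y * serA n z - serB n z" and B': "serB' n z = R n + y * serB n z - serA n z - serA (Suc n) z" for n
    by (simp_all add: P_def R_def)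
  have nR: "of_nat n * serB' (n - 1) z = of_nat n * (R (n - 1) + y * serB (n - 1) z - serA (n - 1) z - serA n z)" for n
    by (cases n) (simp_all add: B')
  have P0: "P 0 = 0"
  proof -
    have "serA' 0 z = 0"
    proof (rule has_zderiv_unique[OF has_zderiv_serA[of 0]])
      have "serA 0 = (\<lambda>z. 1)" by (intro ext) (rule serA_0)
      thus "has_zderiv (serA 0) (\<lambda>z. 0)" using has_zderiv_const[of 1] by simp
    qed
    thus ?thesis by (simp add: P_def y_def serA_0)
  qed
  have R0: "R 0 = 0" by (simp add: R_def riccati_series y_def serA_0)
  have sys: "moment_system z P R" unfolding moment_system_def
  proof (intro conjI allI)
    fix n
    have rB: "serB (Suc n) z + serB (Suc (Suc n)) z = quarter_eps * (2 * of_nat n * serB (n - 1) z - fps_const z * serA n z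
        + 2 * (1 + of_nat n) * serB n z - fps_const z * serA (Suc n) z)"
      unfolding serB_recursion by (simp add: algebra_simps)
    have "P (Suc n) + P (Suc (Suc n)) = (serA' (Suc n) z + serA' (Suc (Suc n)) z) - y * (serA (Suc n) z + serA (Suc (Suc n)) z)
       + (serB (Suc n) z + serB (Suc (Suc n)) z)"
      unfolding P_def by (simp add: algebra_simps)
    also have "\<dots> = quarter_eps * ((1 + 2 * of_nat n) * P n + 2 * of_nat n * P (n - 1) - fps_const z * R n)"
      unfolding serA'_recursion serA_recursion rB unfolding A' B' by (simp add: algebra_simps)
    finally show "P (Suc n) + P (Suc (Suc n)) = quarter_eps * ((1 + 2 * of_nat n) * P n + 2 * of_nat n * P (n - 1) - fps_const z * R n)" .
    have "R (Suc n) = serB' (Suc n) z - y * serB (Suc n) z + (serA (Suc n) z + serA (Suc (Suc n)) z)"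
      unfolding R_def by (simp add: algebra_simps)
    also have "\<dots> = quarter_eps * (2 * (of_nat n * serB' (n - 1) z) - (serA n z + fps_const z * serA' n z))
       - y * (quarter_eps * (2 * of_nat n * serB (n - 1) z - fps_const z * serA n z))
       + quarter_eps * ((1 + 2 * of_nat n) * serA n z + 2 * of_nat n * serA (n - 1) z - fps_const z * serB n z)"
      unfolding serB'_recursion serB_recursion serA_recursion by (simp add: mult.assoc)
    also have "\<dots> = quarter_eps * (2 * of_nat n * R (n - 1) - fps_const z * P n)"
      unfolding nR A' by (simp add: algebra_simps)
    finally show "R (Suc n) = quarter_eps * (2 * of_nat n * R (n - 1) - fps_const z * P n)" .
  next
    fix k
    show "\<forall>\<^sub>F n in sequentially. P n $ k = 0"
    proof -
      have "\<forall>\<^sub>F n in sequentially. \<forall>j\<le>k. serA n z $ j = 0"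
        by (rule serA_eventually_0_upto)
      thus ?thesis using serA'_nth_eventually_0[of z k] serB_nth_eventually_0[of z k]
        by eventually_elim (simp add: P_def fps_mult_nth)
    qed
  qed
  have "P n = 0" for n
    by (rule fps_ext) (use moment_system_zero(1)[OF sys P0, of _ _ n] R0 in auto)
  thus "serA' n z = serB 0 z * serA n z - serB n z" using A' by (simp add: y_def)
  have "R n = 0" for n
    by (rule fps_ext) (use moment_system_zero(2)[OF sys P0, of "Suc _" _ n] R0 in auto)
  thus "serB' n z = serB 0 z * serB n z - serA n z - serA (Suc n) z" using B' by (simp add: y_def)
qed

text \<open>
  The derivation \<open>\<epsilon>^2 \<partial>/\<partial>\<epsilon>\<close>. For means it is
  \<open>- \<partial>/\<partial>T\<close> with \<open>T = 1/\<epsilon> = \<tau>^2/8\<close>, the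
  factor in front of \<open>x^2\<close> in the exponent.
\<close>

definition eps_deriv :: "real fps \<Rightarrow> real fps" where "eps_deriv F = fps_X * fps_X * fps_deriv F"

lemma eps_deriv_add: "eps_deriv (F + G) = eps_deriv F + eps_deriv G"
  and eps_deriv_diff: "eps_deriv (F - G) = eps_deriv F - eps_deriv G"
  and eps_deriv_mult: "eps_deriv (F * G) = eps_deriv F * G + F * eps_deriv G"
  and eps_deriv_1: "eps_deriv 1 = 0" and eps_deriv_0: "eps_deriv 0 = 0"
  and eps_deriv_const: "eps_deriv (fps_const c) = 0" and eps_deriv_of_nat: "eps_deriv (of_nat n) = 0"
  and eps_deriv_numeral: "eps_deriv (numeral m) = 0"
  by (simp_all add: eps_deriv_def algebra_simps)

lemma eps_deriv_quarter_eps: "eps_deriv quarter_eps = fps_X * quarter_eps"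
  by (simp add: eps_deriv_def quarter_eps_def algebra_simps)

lemma fps_X_eq_quarter_eps: "fps_X = 4 * quarter_eps"
  by (simp add: quarter_eps_def numeral_fps_const mult.assoc[symmetric] fps_const_mult)

lemma eps_deriv_nth: "eps_deriv F $ k = (if k = 0 then 0 else real (k - 1) * F $ (k - 1))"
proof -
  consider "k = 0" | "k = 1" | j where "k = Suc (Suc j)" by (cases k; cases "k - 1") auto
  thus ?thesis by cases (auto simp: eps_deriv_def mult.assoc fps_X_mult_nth)
qed

lemma has_zderiv_eps_deriv: "has_zderiv F F' \<Longrightarrow> has_zderiv (\<lambda>z. eps_deriv (F z)) (\<lambda>z. eps_deriv (F' z))"
  unfolding eps_deriv_def by (intro has_zderiv_cmult has_zderiv_fps_deriv)

text \<open>
  Differentiating the density in \<open>T\<close> brings down \<open>- x^2\<close>, so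
  \<open>eps_deriv\<close> should send the mean of \<open>g\<close> to the covariance of
  \<open>g\<close> with \<open>x^2\<close>. This is the defect of that rule for \<open>g = r\<close>.
\<close>

definition eps_defect :: "real \<Rightarrow> real fps" where
  "eps_defect z = eps_deriv (serB 0 z) - serB 2 z + serA 2 z * serB 0 z"

text \<open>
  The defects \<open>U\<close> and \<open>V\<close> of the rule for \<open>g = x^n\<close> and
  \<open>g = r x^n\<close> form a solution of the recurrences with \<open>U 0 = 0\<close> and
  \<open>V 0\<close> the \<open>eps_defect\<close>, so \<open>U\<close> vanishes one order further than
  the latter.
\<close>

lemma eps_defect_lower_order:
  fixes z
  defines "U \<equiv> \<lambda>n. eps_deriv (serA n z) - serA (n + 2) z + serA 2 z * serA n z"
  assumes "\<And>j. j < K \<Longrightarrow> eps_defect z $ j = 0"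
  shows "U n $ K = 0"
proof -
  define V where "V = (\<lambda>n. eps_deriv (serB n z) - serB (n + 2) z + serA 2 z * serB n z)"
  define a where "a = serA 2 z"
  have DA: "eps_deriv (serA n z) = U n + serA (n + 2) z - a * serA n z" and
    DB: "eps_deriv (serB n z) = V n + serB (n + 2) z - a * serB n z" for n
    by (simp_all add: U_def V_def a_def)
  have nDA: "of_nat n * eps_deriv (serA (n - 1) z) = of_nat n * (U (n - 1) + serA (Suc n) z - a * serA (n - 1) z)" for n
    by (cases n) (simp_all add: DA)
  have nDB: "of_nat n * eps_deriv (serB (n - 1) z) = of_nat n * (V (n - 1) + serB (Suc n) z - a * serB (n - 1) z)" for n
    by (cases n) (simp_all add: DB)
  have U0: "U 0 = 0" by (simp add: U_def serA_0 eps_deriv_1 numeral_2_eq_2)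
  note D = eps_deriv_add eps_deriv_diff eps_deriv_mult eps_deriv_1 eps_deriv_const eps_deriv_of_nat eps_deriv_numeral eps_deriv_quarter_eps
  have sys: "moment_system z U V" unfolding moment_system_def
  proof (intro conjI allI)
    fix n
    define S where "S = (1 + 2 * of_nat n) * serA n z + 2 * of_nat n * serA (n - 1) z - fps_const z * serB n z"
    have sum1: "serA (Suc n) z + serA (Suc (Suc n)) z = quarter_eps * S" unfolding S_def by (rule serA_recursion)
    have sum3: "serA (Suc (Suc (Suc n))) z + serA (Suc (Suc (Suc (Suc n)))) z =
       quarter_eps * ((5 + 2 * of_nat n) * serA (n + 2) z + (4 + 2 * of_nat n) * serA (Suc n) z - fps_const z * serB (n + 2) z)"
      unfolding serA_recursion[of "Suc (Suc n)"] by (simp add: algebra_simps)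
    have "eps_deriv (serA (Suc n) z) + eps_deriv (serA (Suc (Suc n)) z) = eps_deriv (quarter_eps * S)"
      by (simp only: sum1 flip: eps_deriv_add)
    also have "\<dots> = fps_X * (quarter_eps * S) + quarter_eps * ((1 + 2 * of_nat n) * eps_deriv (serA n z)
        + 2 * (of_nat n * eps_deriv (serA (n - 1) z)) - fps_const z * eps_deriv (serB n z))"
      unfolding S_def D by (simp add: algebra_simps)
    also have "fps_X * (quarter_eps * S) = quarter_eps * (4 * (serA (Suc n) z + serA (Suc (Suc n)) z))"
      unfolding fps_X_eq_quarter_eps sum1 by (simp add: algebra_simps)
    finally have dsum: "eps_deriv (serA (Suc n) z) + eps_deriv (serA (Suc (Suc n)) z) =
       quarter_eps * (4 * (serA (Suc n) z + serA (Suc (Suc n)) z)) + quarter_eps * ((1 + 2 * of_nat n) * eps_deriv (serA n z)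
        + 2 * (of_nat n * eps_deriv (serA (n - 1) z)) - fps_const z * eps_deriv (serB n z))" .
    have "U (Suc n) + U (Suc (Suc n)) = (eps_deriv (serA (Suc n) z) + eps_deriv (serA (Suc (Suc n)) z))
       - (serA (Suc (Suc (Suc n))) z + serA (Suc (Suc (Suc (Suc n)))) z) + a * (serA (Suc n) z + serA (Suc (Suc n)) z)"
      unfolding U_def a_def by (simp add: algebra_simps)
    also have "a * (serA (Suc n) z + serA (Suc (Suc n)) z) = quarter_eps * (a * S)" unfolding sum1 by (simp add: algebra_simps)
    finally have "U (Suc n) + U (Suc (Suc n)) = (eps_deriv (serA (Suc n) z) + eps_deriv (serA (Suc (Suc n)) z))
       - (serA (Suc (Suc (Suc n))) z + serA (Suc (Suc (Suc (Suc n)))) z) + quarter_eps * (a * S)" .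
    thus "U (Suc n) + U (Suc (Suc n)) = quarter_eps * ((1 + 2 * of_nat n) * U n + 2 * of_nat n * U (n - 1) - fps_const z * V n)"
      unfolding dsum sum3 unfolding nDA unfolding DA DB S_def by (simp add: algebra_simps)
    define T where "T = 2 * of_nat n * serB (n - 1) z - fps_const z * serA n z"
    have b1: "serB (Suc n) z = quarter_eps * T" unfolding T_def by (rule serB_recursion)
    have b3: "serB (Suc n + 2) z = quarter_eps * (2 * (2 + of_nat n) * serB (Suc n) z - fps_const z * serA (n + 2) z)"
      using serB_recursion[of "Suc (Suc n)" z] by (simp add: algebra_simps)
    have "eps_deriv (serB (Suc n) z) = fps_X * (quarter_eps * T) + quarter_eps * (2 * (of_nat n * eps_deriv (serB (n - 1) z))
        - fps_const z * eps_deriv (serA n z))"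
      unfolding b1 T_def D by (simp add: algebra_simps)
    also have "fps_X * (quarter_eps * T) = quarter_eps * (4 * serB (Suc n) z)"
      unfolding fps_X_eq_quarter_eps b1 by (simp add: algebra_simps)
    finally have db: "eps_deriv (serB (Suc n) z) = quarter_eps * (4 * serB (Suc n) z) + quarter_eps * (2 * (of_nat n * eps_deriv (serB (n - 1) z))
        - fps_const z * eps_deriv (serA n z))" .
    have "V (Suc n) = eps_deriv (serB (Suc n) z) - serB (Suc n + 2) z + a * serB (Suc n) z"
      unfolding V_def a_def by simp
    also have "a * serB (Suc n) z = quarter_eps * (a * T)" unfolding b1 by (simp add: algebra_simps)
    finally have "V (Suc n) = eps_deriv (serB (Suc n) z) - serB (Suc n + 2) z + quarter_eps * (a * T)" .
    thus "V (Suc n) = quarter_eps * (2 * of_nat n * V (n - 1) - fps_const z * U n)"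
      unfolding db b3 nDB DA T_def by (simp add: algebra_simps)
  next
    fix k
    have "\<forall>\<^sub>F n in sequentially. \<forall>j\<le>k. serA n z $ j = 0"
      by (rule serA_eventually_0_upto)
    moreover from this have "\<forall>\<^sub>F n in sequentially. \<forall>j\<le>k. serA (n + 2) z $ j = 0"
      by (rule eventually_sequentially_seg[THEN iffD2])
    ultimately show "\<forall>\<^sub>F n in sequentially. U n $ k = 0"
      by eventually_elim (auto simp: U_def eps_deriv_nth fps_mult_nth)
  qed
  have "V 0 = eps_defect z" by (simp add: V_def eps_defect_def numeral_2_eq_2)
  thus ?thesis using moment_system_zero(1)[OF sys U0, of K K n] assms(2) by simp
qed

text \<open>
  Differentiating the defect in \<open>z\<close> gives the linear equation
  \<open>V' = 2 B\<^sub>0 V - U\<^sub>1\<close>. At the lowest order at which \<open>V\<close>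
  might not vanish, \<open>U\<^sub>1\<close> is zero and \<open>B\<^sub>0\<close> contributes
  \<open>- tanh z\<close>, so the coefficient times \<open>(cosh z)^2\<close> is constant; it is zero
  at \<open>z = 0\<close>, where all \<open>B\<^sub>n\<close> needed vanish.
\<close>

lemma eps_defect_0: "eps_defect z = 0"
proof (rule fps_ext)
  fix k
  show "eps_defect z $ k = 0 $ k"
  proof (induction k arbitrary: z rule: less_induct)
    case (less k)
    define U1 where "U1 = (\<lambda>z. eps_deriv (serA 1 z) - serA 3 z + serA 2 z * serA 1 z)"
    have "has_zderiv eps_defect (\<lambda>z. eps_deriv (serB' 0 z) - serB' 2 z + (serA' 2 z * serB 0 z + serA 2 z * serB' 0 z))"
      unfolding eps_defect_def[abs_def]
      by (intro has_zderiv_add has_zderiv_diff has_zderiv_eps_deriv has_zderiv_mult has_zderiv_serA has_zderiv_serB)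
    moreover have "eps_deriv (serB' 0 z) - serB' 2 z + (serA' 2 z * serB 0 z + serA 2 z * serB' 0 z) =
       2 * serB 0 z * eps_defect z - U1 z" for z
      unfolding riccati_series serA'_eq serB'_eq eps_defect_def U1_def
        eps_deriv_add eps_deriv_diff eps_deriv_mult eps_deriv_1 
      by (simp add: algebra_simps numeral_3_eq_3 numeral_2_eq_2 serA_0 eps_deriv_1)
    ultimately have zd: "has_zderiv eps_defect (\<lambda>z. 2 * serB 0 z * eps_defect z - U1 z)" by simp
    have U1: "U1 z $ k = 0" for z
      using eps_defect_lower_order[of k z 1] less.IH by (simp add: U1_def numeral_3_eq_3)
    have eq: "(2 * serB 0 z * eps_defect z - U1 z) $ k = - 2 * tanh z * eps_defect z $ k" for z
    proof -
      have "(serB 0 z * eps_defect z) $ k = (\<Sum>i=0..k. serB 0 z $ i * eps_defect z $ (k - i))" by (rule fps_mult_nth)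
      also have "\<dots> = (\<Sum>i\<in>{0}. serB 0 z $ i * eps_defect z $ (k - i))"
        by (intro sum.mono_neutral_right) (use less.IH in auto)
      finally show ?thesis using U1[of z] by (simp add: mult.assoc numeral_fps_const serB_def coefB_0_0)
    qed
    define f where "f = (\<lambda>z. eps_defect z $ k * (cosh z)\<^sup>2)"
    have "(f has_real_derivative 0) (at z)" for z
    proof -
      have "((\<lambda>z. eps_defect z $ k) has_real_derivative - 2 * tanh z * eps_defect z $ k) (at z)"
        by (rule zd[unfolded has_zderiv_def, rule_format, of k z, unfolded eq])
      moreover have "((\<lambda>z. (cosh z)\<^sup>2) has_real_derivative 2 * cosh z * sinh z) (at z)"
        by (auto intro!: derivative_eq_intros)
      moreover have "cosh z \<noteq> 0" using cosh_real_pos[of z] by linarith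
      ultimately show ?thesis unfolding f_def
        by (intro DERIV_cong[OF DERIV_mult]) (auto simp: tanh_def field_simps power2_eq_square)
    qed
    hence "f z = f 0" by (rule DERIV_isconst_all[rule_format]) 
    also have "f 0 = 0"
    proof -
      have y0: "serB 0 0 = 0" by (rule fps_ext) (simp add: serB_def coefB_0_at_0)
      have "serB 2 0 = 0" using serB_recursion[of 1 0] by (simp add: y0 numeral_2_eq_2)
      thus ?thesis by (simp add: f_def eps_defect_def y0 eps_deriv_0)
    qed
    finally show ?case unfolding f_def using cosh_real_pos[of z] by simp
  qed
qed

section \<open>Burgers' equation, smoothness and growth of the coefficients\<close>

text \<open>
  This is Burgers' equation in disguise: by the Riccati equation
  \<open>A\<^sub>1 = y^2 - 1 - y'\<close> for \<open>y = B\<^sub>0\<close>, so that the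
  left-hand side is \<open>2 y y' - y''\<close>.
\<close>

lemma serA'_1: "serA' 1 z = eps_deriv (serB 0 z) - quarter_eps * (serB 0 z + fps_const z * serB' 0 z)"
proof -
  have "serA' 0 z = 0" by (simp add: serA'_eq serA_0)
  hence "serA' 1 z + serA' 2 z = - quarter_eps * (serB 0 z + fps_const z * serB' 0 z)"
    using serA'_recursion[of 0 z] by (simp add: numeral_2_eq_2 algebra_simps)
  moreover have "serA' 2 z = - eps_deriv (serB 0 z)"
    using eps_defect_0[of z] unfolding serA'_eq eps_defect_def by (simp add: algebra_simps eq_neg_iff_add_eq_0)
  ultimately show ?thesis by (simp add: algebra_simps)
qed

lemma coefA'_1: "coefA' 1 (Suc k) z = real k * coefB 0 k z - (coefB 0 k z + z * coefB' 0 k z) / 4"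
proof -
  have "serA' 1 z $ Suc k = (eps_deriv (serB 0 z) - quarter_eps * (serB 0 z + fps_const z * serB' 0 z)) $ Suc k"
    by (simp only: serA'_1)
  thus ?thesis unfolding fps_sub_nth quarter_eps_nth eps_deriv_nth
    by (simp add: serA'_def serB_def serB'_def)
qed

lemma coefB_second_deriv:
  "(coefB' 0 k has_real_derivative 2 * (\<Sum>i\<le>k. coefB 0 i z * coefB' 0 (k - i) z) - coefA' 1 k z) (at z)"
proof -
  have "has_zderiv (\<lambda>z. serB 0 z * serB 0 z - 1 - serA 1 z) (\<lambda>z. serB' 0 z * serB 0 z + serB 0 z * serB' 0 z - 0 - serA' 1 z)"
    by (intro has_zderiv_diff has_zderiv_mult has_zderiv_serA has_zderiv_serB has_zderiv_const)
  hence "has_zderiv (\<lambda>z. serB' 0 z) (\<lambda>z. serB' 0 z * serB 0 z + serB 0 z * serB' 0 z - 0 - serA' 1 z)"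
    by (simp only: riccati_series)
  hence "((\<lambda>z. serB' 0 z $ k) has_real_derivative (serB' 0 z * serB 0 z + serB 0 z * serB' 0 z - 0 - serA' 1 z) $ k) (at z)"
    unfolding has_zderiv_def by blast
  moreover have "serB' 0 z * serB 0 z + serB 0 z * serB' 0 z - 0 - serA' 1 z = serB 0 z * serB' 0 z + serB 0 z * serB' 0 z - serA' 1 z"
    by (simp add: mult.commute)
  ultimately have "(coefB' 0 k has_real_derivative (serB 0 z * serB' 0 z + serB 0 z * serB' 0 z - serA' 1 z) $ k) (at z)"
    by (simp add: serB'_def)
  thus ?thesis unfolding fps_sub_nth fps_add_nth fps_mult_nth
    by (simp add: serB_def serB'_def serA'_def atLeast0AtMost)
qed

text \<open>
  Since \<open>\<epsilon> = 8/\<tau>^2\<close>, the coefficient of \<open>\<tau>^(-2k)\<close> is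
  \<open>8^k\<close> times that of \<open>\<epsilon>^k\<close>, and \<open>w10\<close> is
  \<open>\<surd>\<tau> / a\<close> times \<open>B\<^sub>0\<close>.
\<close>

lemma burgers_coefficients:
  assumes "a \<noteq> 0" "k \<ge> 1"
  shows "burgers_coeff a (\<lambda>i z. 8 ^ i * coefB 0 i z / a) k z = 0"
proof -
  obtain j where k: "k = Suc j" using assms(2) by (cases k) auto
  have d: "deriv (\<lambda>z. 8 ^ i * coefB 0 i z / a) = (\<lambda>z. 8 ^ i * coefB' 0 i z / a)" for i
    by (intro ext DERIV_imp_deriv DERIV_cdivide DERIV_cmult coefB_deriv)
  have d2: "deriv (\<lambda>z. 8 ^ k * coefB' 0 k z / a) z =
      8 ^ k * (2 * (\<Sum>i\<le>k. coefB 0 i z * coefB' 0 (k - i) z) - coefA' 1 k z) / a"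
    by (intro DERIV_imp_deriv DERIV_cdivide DERIV_cmult coefB_second_deriv)
  define S where "S = (\<Sum>i\<le>k. coefB 0 i z * coefB' 0 (k - i) z)"
  have sum: "(\<Sum>i\<le>k. 8 ^ i * coefB 0 i z / a * (8 ^ (k - i) * coefB' 0 (k - i) z / a)) = 8 ^ k / a\<^sup>2 * S"
    unfolding S_def sum_distrib_left
  proof (rule sum.cong)
    fix i assume "i \<in> {..k}"
    hence "(8::real) ^ k = 8 ^ i * 8 ^ (k - i)" by (simp flip: power_add)
    thus "8 ^ i * coefB 0 i z / a * (8 ^ (k - i) * coefB' 0 (k - i) z / a) = 8 ^ k / a\<^sup>2 * (coefB 0 i z * coefB' 0 (k - i) z)"
      by (simp add: power2_eq_square)
  qed simp
  have "burgers_coeff a (\<lambda>i z. 8 ^ i * coefB 0 i z / a) k z =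
    (1 / 2 - 2 * real j) * (8 ^ j * coefB 0 j z / a) + z / 2 * (8 ^ j * coefB' 0 j z / a)
     + a * (1 / 2 * (8 ^ k / a\<^sup>2 * S)) - 1 / 4 * (8 ^ k * (2 * S - coefA' 1 k z) / a)"
    unfolding burgers_coeff_def d d2 sum S_def[symmetric] using k by simp
  also have "\<dots> = 0"
    unfolding k coefA'_1 using assms(1) by (simp add: power2_eq_square field_simps)
  finally show ?thesis .
qed

text \<open>
  An algebra of functions that contains the coefficients and, by the Riccati equation, is closed under
  differentiation. Hence all of its members are smooth.
\<close>

inductive coef_algebra :: "(real \<Rightarrow> real) \<Rightarrow> bool" where
  const: "coef_algebra (\<lambda>z. c)"
| ident: "coef_algebra (\<lambda>z. z)"
| coef: "coef_algebra (coefB 0 k)"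
| add: "coef_algebra f \<Longrightarrow> coef_algebra g \<Longrightarrow> coef_algebra (\<lambda>z. f z + g z)"
| mult: "coef_algebra f \<Longrightarrow> coef_algebra g \<Longrightarrow> coef_algebra (\<lambda>z. f z * g z)"

lemma coef_algebra_cmult: "coef_algebra f \<Longrightarrow> coef_algebra (\<lambda>z. c * f z)"
  by (rule coef_algebra.mult[OF coef_algebra.const])

lemma coef_algebra_diff: "coef_algebra f \<Longrightarrow> coef_algebra g \<Longrightarrow> coef_algebra (\<lambda>z. f z - g z)"
  using coef_algebra.add[OF _ coef_algebra_cmult[of g "-1"], of f] by simp

lemma coef_algebra_sum: "(\<And>i. i \<in> I \<Longrightarrow> coef_algebra (f i)) \<Longrightarrow> coef_algebra (\<lambda>z. \<Sum>i\<in>I. f i z)"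
  by (induction I rule: infinite_finite_induct) (auto intro: coef_algebra.intros)

lemma coef_algebra_coefs: "coef_algebra (coefA n k) \<and> coef_algebra (coefB n k)"
proof (rule coef_induct[where P = "\<lambda>n k. coef_algebra"])
  fix n k :: nat
  assume *: "coef_algebra (coefA n k)" "coef_algebra (coefA (n - 1) k)" "coef_algebra (coefB n k)"
    "coef_algebra (coefA (n + 2) (Suc k))"
  have "coef_algebra (\<lambda>z. 1 / 4 * ((1 + 2 * real n) * coefA n k z + 2 * real n * coefA (n - 1) k z - z * coefB n k z) - coefA (n + 2) (Suc k) z)"
    by (intro coef_algebra_diff coef_algebra_cmult coef_algebra.add coef_algebra.mult[OF coef_algebra.ident] *)
  thus "coef_algebra (\<lambda>z. ((1 + 2 * real n) * coefA n k z + 2 * real n * coefA (n - 1) k z - z * coefB n k z) / 4 - coefA (n + 2) (Suc k) z)"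
    by simp
next
  fix n k :: nat
  assume *: "coef_algebra (coefB (n - 1) k)" "coef_algebra (coefA n k)"
  have "coef_algebra (\<lambda>z. 1 / 4 * (2 * real n * coefB (n - 1) k z - z * coefA n k z))"
    by (intro coef_algebra_diff coef_algebra_cmult coef_algebra.mult[OF coef_algebra.ident] *)
  thus "coef_algebra (\<lambda>z. (2 * real n * coefB (n - 1) k z - z * coefA n k z) / 4)" by simp
qed (rule coef_algebra.const coef_algebra.coef)+

lemma coef_algebra_has_deriv:
  "coef_algebra f \<Longrightarrow> \<exists>f'. coef_algebra f' \<and> (\<forall>z. (f has_real_derivative f' z) (at z))"
proof (induction rule: coef_algebra.induct)
  case (const c)
  show ?case by (intro exI[of _ "\<lambda>z. 0"]) (auto intro: coef_algebra.const)
next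
  case ident
  show ?case by (intro exI[of _ "\<lambda>z. 1"]) (auto intro: coef_algebra.const)
next
  case (coef k)
  have "coef_algebra (\<lambda>z. (\<Sum>i\<le>k. coefB 0 i z * coefB 0 (k - i) z) - (if k = 0 then 1 else 0) - coefA 1 k z)"
    by (intro coef_algebra_diff coef_algebra_sum coef_algebra.const coef_algebra.mult coef_algebra.coef)
       (use coef_algebra_coefs in blast)
  moreover have "(coefB 0 k has_real_derivative (\<Sum>i\<le>k. coefB 0 i z * coefB 0 (k - i) z) - (if k = 0 then 1 else 0) - coefA 1 k z) (at z)" for z
    using coefB_deriv[of 0 k z] unfolding riccati_coefficients .
  ultimately show ?case by blast
next
  case (add f g)
  then obtain f' g' where "coef_algebra f'" "coef_algebra g'" "\<And>z. (f has_real_derivative f' z) (at z)"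
    "\<And>z. (g has_real_derivative g' z) (at z)" by blast
  thus ?case by (intro exI[of _ "\<lambda>z. f' z + g' z"]) (auto intro: coef_algebra.add intro!: derivative_intros)
next
  case (mult f g)
  then obtain f' g' where *: "coef_algebra f'" "coef_algebra g'" "\<And>z. (f has_real_derivative f' z) (at z)"
    "\<And>z. (g has_real_derivative g' z) (at z)" by blast
  have "((\<lambda>z. f z * g z) has_real_derivative f' z * g z + g' z * f z) (at z)" for z
    by (rule DERIV_mult) (use * in auto)
  moreover have "coef_algebra (\<lambda>z. f' z * g z + g' z * f z)"
    using * mult.hyps by (intro coef_algebra.add coef_algebra.mult)
  ultimately show ?case by blast
qed

lemma coef_algebra_smooth:
  assumes "coef_algebra f"
  shows "smooth f"
proof -
  have step: "coef_algebra (deriv f)" if "coef_algebra f" for f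
  proof -
    from coef_algebra_has_deriv[OF that]
    obtain f' where f': "coef_algebra f'" "\<And>z. (f has_real_derivative f' z) (at z)" by blast
    hence "deriv f = f'" by (auto intro: DERIV_imp_deriv)
    thus ?thesis using f' by simp
  qed
  have "coef_algebra ((deriv ^^ n) f)" for n
    by (induction n) (use assms step in auto)
  thus ?thesis unfolding smooth_def real_differentiable_def using coef_algebra_has_deriv by blast
qed

definition poly_growth :: "nat \<Rightarrow> (real \<Rightarrow> real) \<Rightarrow> bool" where
  "poly_growth k f \<longleftrightarrow> (\<exists>M\<ge>0. \<forall>z. \<bar>f z\<bar> \<le> M * (1 + \<bar>z\<bar>) ^ k)"

lemma poly_growth_const: "poly_growth k (\<lambda>z. c)"
  unfolding poly_growth_def
  by (intro exI[of _ "\<bar>c\<bar>"]) (auto intro!: mult_le_cancel_left1[THEN iffD2] simp: one_le_power)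

lemma poly_growth_add: "poly_growth k f \<Longrightarrow> poly_growth k g \<Longrightarrow> poly_growth k (\<lambda>z. f z + g z)"
proof -
  assume "poly_growth k f" "poly_growth k g"
  then obtain M N where MN: "M \<ge> 0" "N \<ge> 0" "\<And>z. \<bar>f z\<bar> \<le> M * (1 + \<bar>z\<bar>) ^ k" "\<And>z. \<bar>g z\<bar> \<le> N * (1 + \<bar>z\<bar>) ^ k"
    unfolding poly_growth_def by blast
  have "\<bar>f z + g z\<bar> \<le> (M + N) * (1 + \<bar>z\<bar>) ^ k" for z
    using MN(3)[of z] MN(4)[of z] by (simp add: distrib_right)
  thus ?thesis unfolding poly_growth_def using MN by (intro exI[of _ "M + N"]) auto
qed

lemma poly_growth_mult: "poly_growth j f \<Longrightarrow> poly_growth k g \<Longrightarrow> poly_growth (j + k) (\<lambda>z. f z * g z)"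
proof -
  assume "poly_growth j f" "poly_growth k g"
  then obtain M N where MN: "M \<ge> 0" "N \<ge> 0" "\<And>z. \<bar>f z\<bar> \<le> M * (1 + \<bar>z\<bar>) ^ j" "\<And>z. \<bar>g z\<bar> \<le> N * (1 + \<bar>z\<bar>) ^ k"
    unfolding poly_growth_def by blast
  have "\<bar>f z * g z\<bar> \<le> (M * N) * (1 + \<bar>z\<bar>) ^ (j + k)" for z
  proof -
    have "\<bar>f z * g z\<bar> \<le> (M * (1 + \<bar>z\<bar>) ^ j) * (N * (1 + \<bar>z\<bar>) ^ k)"
      unfolding abs_mult using MN by (intro mult_mono) auto
    thus ?thesis by (simp add: power_add mult_ac)
  qed
  thus ?thesis unfolding poly_growth_def using MN by (intro exI[of _ "M * N"]) auto
qed

lemma poly_growth_mono: "poly_growth j f \<Longrightarrow> j \<le> k \<Longrightarrow> poly_growth k f"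
  using poly_growth_mult[OF poly_growth_const[of "k - j" 1], of j f] by simp

lemma poly_growth_cmult: "poly_growth k f \<Longrightarrow> poly_growth k (\<lambda>z. c * f z)"
  using poly_growth_mult[OF poly_growth_const[of 0 c], of k f] by simp

lemma poly_growth_diff: "poly_growth k f \<Longrightarrow> poly_growth k g \<Longrightarrow> poly_growth k (\<lambda>z. f z - g z)"
  using poly_growth_add[OF _ poly_growth_cmult[of k g "-1"], of f] by simp

lemma poly_growth_ident_mult: "poly_growth k f \<Longrightarrow> poly_growth (Suc k) (\<lambda>z. z * f z)"
proof -
  assume f: "poly_growth k f"
  have "poly_growth 1 (\<lambda>z. z)" unfolding poly_growth_def by (intro exI[of _ 1]) auto
  from poly_growth_mult[OF this f] show ?thesis by simp
qed

lemma poly_growth_sum: "(\<And>i. i \<in> I \<Longrightarrow> poly_growth k (f i)) \<Longrightarrow> poly_growth k (\<lambda>z. \<Sum>i\<in>I. f i z)"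
  by (induction I rule: infinite_finite_induct) (auto intro: poly_growth_const poly_growth_add)

text \<open>
  Each recurrence step raises the order by one and multiplies by at most one factor \<open>z\<close>.
  The equation for \<open>Q\<^sub>k\<close> preserves growth because the solution operator of
  \<open>Q' = - 2 tanh z Q + S\<close> is bounded, which is another instance of
  \<open>stable_linear_ode_bound\<close>.
\<close>

lemma poly_growth_coefs: "poly_growth k (coefA n k) \<and> poly_growth k (coefB n k)"
proof (rule coef_induct[where P = "\<lambda>n k. poly_growth k"])
  fix k
  assume A: "\<And>n::nat. poly_growth k (coefA n k)" and B: "\<And>(n::nat) j. j < k \<Longrightarrow> poly_growth j (coefB n j)"
  show "poly_growth k (coefB 0 k)"
  proof (cases "k = 0")
    case True
    have "\<bar>coefB 0 k z\<bar> \<le> 1 * (1 + \<bar>z\<bar>) ^ k" for z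
      using tanh_real_bounds[of z] by (simp add: True coefB_0_0 abs_le_iff)
    thus ?thesis unfolding poly_growth_def by (intro exI[of _ 1]) auto
  next
    case False
    define S where "S = (\<lambda>t. (\<Sum>i=1..<k. coefB 0 i t * coefB 0 (k - i) t) - coefA 1 k t)"
    have "poly_growth k S" unfolding S_def
    proof (intro poly_growth_diff poly_growth_sum A)
      fix i assume i: "i \<in> {1..<k}"
      hence "poly_growth (i + (k - i)) (\<lambda>t. coefB 0 i t * coefB 0 (k - i) t)"
        by (intro poly_growth_mult B) auto
      thus "poly_growth k (\<lambda>t. coefB 0 i t * coefB 0 (k - i) t)" using i by simp
    qed
    then obtain M where M: "M \<ge> 0" "\<And>z. \<bar>S z\<bar> \<le> M * (1 + \<bar>z\<bar>) ^ k" unfolding poly_growth_def by blast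
    have der: "(coefB 0 k has_real_derivative (- 2 * tanh t) * coefB 0 k t + S t) (at t)" for t
    proof -
      have "{..k} = insert 0 (insert k {1..<k})" using False by auto
      hence "coefB' 0 k t = (- 2 * tanh t) * coefB 0 k t + S t"
        unfolding riccati_coefficients S_def using False by (simp add: coefB_0_0)
      thus ?thesis using coefB_deriv[of 0 k t] by simp
    qed
    have "\<bar>coefB 0 k z\<bar> \<le> 4 * (M * (1 + \<bar>z\<bar>) ^ k)" for z
    proof (rule stable_linear_ode_bound[OF coefB_0_at_0 der])
      fix t :: real assume t: "\<bar>t\<bar> \<le> \<bar>z\<bar>"
      have "\<bar>S t\<bar> \<le> M * (1 + \<bar>t\<bar>) ^ k" by (rule M)
      also have "\<dots> \<le> M * (1 + \<bar>z\<bar>) ^ k" using M t by (intro mult_left_mono power_mono) auto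
      finally show "\<bar>S t\<bar> \<le> M * (1 + \<bar>z\<bar>) ^ k" .
      show "- 2 * tanh t \<le> 1 / 2 - tanh t" if "t \<ge> 0" using that by simp
      show "- (- 2 * tanh t) \<le> 1 / 2 + tanh t" if "t \<le> 0"
      proof -
        have "tanh t \<le> 0" using that by simp
        thus ?thesis by linarith
      qed
    qed
    thus ?thesis unfolding poly_growth_def using M by (intro exI[of _ "4 * M"]) (auto simp: mult.assoc)
  qed
next
  fix n k
  assume *: "poly_growth k (coefA n k)" "poly_growth k (coefA (n - 1) k)" "poly_growth k (coefB n k)" "poly_growth (Suc k) (coefA (n + 2) (Suc k))"
  have "poly_growth (Suc k) (\<lambda>z. 1 / 4 * ((1 + 2 * real n) * coefA n k z + 2 * real n * coefA (n - 1) k z - z * coefB n k z) - coefA (n + 2) (Suc k) z)"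
    by (intro poly_growth_diff poly_growth_cmult poly_growth_add poly_growth_ident_mult *(3,4) *(1,2)[THEN poly_growth_mono, OF le_SucI[OF order_refl]])
  thus "poly_growth (Suc k) (\<lambda>z. ((1 + 2 * real n) * coefA n k z + 2 * real n * coefA (n - 1) k z - z * coefB n k z) / 4 - coefA (n + 2) (Suc k) z)"
    by simp
next
  fix n k
  assume *: "poly_growth k (coefB (n - 1) k)" "poly_growth k (coefA n k)"
  have "poly_growth (Suc k) (\<lambda>z. 1 / 4 * (2 * real n * coefB (n - 1) k z - z * coefA n k z))"
    by (intro poly_growth_diff poly_growth_cmult poly_growth_ident_mult *(2) *(1)[THEN poly_growth_mono, OF le_SucI[OF order_refl]])
  thus "poly_growth (Suc k) (\<lambda>z. (2 * real n * coefB (n - 1) k z - z * coefA n k z) / 4)" by simp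
qed (auto intro: poly_growth_const)

lemma one_plus_power_le: "(1 + x) ^ k \<le> 2 ^ k * (1 + x ^ k)" if "x \<ge> 0" for x :: real
proof (cases "x \<le> 1")
  case True
  have "(1 + x) ^ k \<le> 2 ^ k * 1" using that True by (simp add: power_mono)
  also have "\<dots> \<le> 2 ^ k * (1 + x ^ k)" using that by (intro mult_left_mono) auto
  finally show ?thesis .
next
  case False
  have "(1 + x) ^ k \<le> (2 * x) ^ k" using that False by (intro power_mono) auto
  also have "\<dots> \<le> 2 ^ k * (1 + x ^ k)" unfolding power_mult_distrib by (intro mult_left_mono) auto
  finally show ?thesis .
qed

section \<open>Moments in rescaled coordinates\<close>

text \<open>
  With \<open>\<xi> = 2 z / \<surd>\<tau>\<close> the phase is
  \<open>T - z r - T x^2\<close>, where \<open>T = \<tau>^2/8\<close> and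
  \<open>x = r^2 - 1\<close> (\<open>phase_rescaled\<close>), so for large \<open>T\<close> the
  density concentrates where \<open>x\<close> is small. \<open>A\<^sub>n\<close> and
  \<open>B\<^sub>n\<close> are \<open>momA\<close> and \<open>momB\<close> below. The moments of
  \<open>r\<close> itself would not do: they are all of the same size.
\<close>

abbreviation rvar :: "real \<Rightarrow> real \<Rightarrow> real" where
  "rvar \<tau> s \<equiv> 2 * s / sqrt \<tau>"

abbreviation xvar :: "real \<Rightarrow> real \<Rightarrow> real" where
  "xvar \<tau> s \<equiv> 4 * s\<^sup>2 / \<tau> - 1"

abbreviation inner_avg :: "real \<Rightarrow> real \<Rightarrow> (real \<Rightarrow> real) \<Rightarrow> real" where
  "inner_avg z \<tau> \<equiv> avg (2 * z / sqrt \<tau>) \<tau>"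

definition momA :: "nat \<Rightarrow> real \<Rightarrow> real \<Rightarrow> real" where
  "momA n z \<tau> = inner_avg z \<tau> (\<lambda>s. xvar \<tau> s ^ n)"

definition momB :: "nat \<Rightarrow> real \<Rightarrow> real \<Rightarrow> real" where
  "momB n z \<tau> = inner_avg z \<tau> (\<lambda>s. rvar \<tau> s * xvar \<tau> s ^ n)"

definition eps :: "real \<Rightarrow> real" where "eps \<tau> = 8 / \<tau>\<^sup>2"

lemmas poly_intros = polynomial_function_intros real_polynomial_function_divide

lemma momA_0: "momA 0 z \<tau> = 1"
  by (simp add: momA_def avg_const)

lemma rescaled_square: "\<tau> > 0 \<Longrightarrow> (rvar \<tau> s)\<^sup>2 = 1 + xvar \<tau> s"
  by (simp add: power_divide power_mult_distrib)

lemma rescaled_deriv: "(rvar \<tau> has_real_derivative 2 / sqrt \<tau>) (at s)"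
  by (rule DERIV_cong[OF DERIV_cdivide[OF DERIV_cmult[OF DERIV_ident, of 2]]]) simp

lemma xvar_power_deriv:
  assumes "\<tau> > 0"
  shows "((\<lambda>s. xvar \<tau> s ^ n) has_real_derivative 2 / sqrt \<tau> * (2 * real n * (rvar \<tau> s * xvar \<tau> s ^ (n - 1)))) (at s)"
proof -
  define t where "t = sqrt \<tau>"
  have t: "t > 0" "\<tau> = t * t" using assms by (auto simp: t_def)
  have "(xvar \<tau> has_real_derivative 8 * s / \<tau>) (at s)"
    using assms by (auto intro!: derivative_eq_intros)
  also have "8 * s / \<tau> = 4 / sqrt \<tau> * rvar \<tau> s"
    unfolding t_def[symmetric] using t by (simp add: field_simps)
  finally show ?thesis by (rule DERIV_cong[OF DERIV_power]) simp
qed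

text \<open>
  The term \<open>z\<close> is the derivative of \<open>z r\<close> and
  \<open>4 r x / \<epsilon>\<close> that of \<open>T x^2\<close>; the latter has been isolated, so
  that the right-hand side is small.
\<close>

lemma inner_by_parts:
  assumes \<tau>: "\<tau> > 0" and p: "real_polynomial_function p" "real_polynomial_function p'"
    and der: "\<And>s. (p has_real_derivative 2 / sqrt \<tau> * p' s) (at s)"
  shows "inner_avg z \<tau> (\<lambda>s. p s * (rvar \<tau> s * xvar \<tau> s)) =
    eps \<tau> / 4 * (inner_avg z \<tau> p' - z * inner_avg z \<tau> p)"
proof -
  define \<xi> where "\<xi> = 2 * z / sqrt \<tau>"
  define t where "t = sqrt \<tau>"
  have t: "t > 0" "\<tau> = t * t" using \<tau> by (auto simp: t_def)
  have force: "8 * s ^ 3 - 2 * \<tau> * s + \<xi> = \<tau> * sqrt \<tau> * (rvar \<tau> s * xvar \<tau> s) + \<xi>" for s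
    unfolding t_def[symmetric] using t by (simp add: field_simps power2_eq_square power3_eq_cube)
  have "avg \<xi> \<tau> (\<lambda>s. 2 / sqrt \<tau> * p' s) = avg \<xi> \<tau> (\<lambda>s. p s * (8 * s ^ 3 - 2 * \<tau> * s + \<xi>))"
    by (rule avg_by_parts[OF p(1) _ der]) (intro poly_intros p)
  also have "(\<lambda>s. p s * (8 * s ^ 3 - 2 * \<tau> * s + \<xi>)) =
      (\<lambda>s. \<tau> * sqrt \<tau> * (p s * (rvar \<tau> s * xvar \<tau> s)) + \<xi> * p s)"
    unfolding force by (simp only: distrib_left mult_ac)
  also have "avg \<xi> \<tau> \<dots> = \<tau> * sqrt \<tau> * avg \<xi> \<tau> (\<lambda>s. p s * (rvar \<tau> s * xvar \<tau> s)) + \<xi> * avg \<xi> \<tau> p"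
    by (subst avg_add, (intro poly_intros p)+) (simp only: avg_cmult)
  finally have eq: "2 / sqrt \<tau> * avg \<xi> \<tau> p' = \<tau> * sqrt \<tau> * avg \<xi> \<tau> (\<lambda>s. p s * (rvar \<tau> s * xvar \<tau> s)) + \<xi> * avg \<xi> \<tau> p"
    by (simp only: avg_cmult)
  have "c = eps \<tau> / 4 * (b - z * d)" if "2 / sqrt \<tau> * b = \<tau> * sqrt \<tau> * c + \<xi> * d" for b c d
    using that t(1) unfolding \<xi>_def eps_def t_def[symmetric] t(2) by (simp add: field_simps power2_eq_square)
  from this[OF eq] show ?thesis unfolding \<xi>_def .
qed

lemma momB_recursion:
  assumes \<tau>: "\<tau> > 0"
  shows "momB (Suc n) z \<tau> = eps \<tau> / 4 * (2 * real n * momB (n - 1) z \<tau> - z * momA n z \<tau>)"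
proof -
  have "momB (Suc n) z \<tau> = inner_avg z \<tau> (\<lambda>s. xvar \<tau> s ^ n * (rvar \<tau> s * xvar \<tau> s))"
    unfolding momB_def by (simp only: power_Suc mult_ac)
  also have "\<dots> = eps \<tau> / 4 * (inner_avg z \<tau> (\<lambda>s. 2 * real n * (rvar \<tau> s * xvar \<tau> s ^ (n - 1)))
      - z * inner_avg z \<tau> (\<lambda>s. xvar \<tau> s ^ n))"
    by (rule inner_by_parts[OF \<tau> _ _ xvar_power_deriv[OF \<tau>]]) (intro poly_intros)+
  finally show ?thesis unfolding momA_def momB_def by (simp only: avg_cmult)
qed

text \<open>
  Integration by parts with \<open>r x^n\<close>, where \<open>r^2 = 1 + x\<close> turns everything
  into powers of \<open>x\<close>.
\<close>

lemma momA_recursion: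
  assumes \<tau>: "\<tau> > 0"
  shows "momA (Suc n) z \<tau> + momA (n + 2) z \<tau> =
     eps \<tau> / 4 * ((1 + 2 * real n) * momA n z \<tau> + 2 * real n * momA (n - 1) z \<tau> - z * momB n z \<tau>)"
    and "inner_avg z \<tau> (\<lambda>s. (rvar \<tau> s)\<^sup>2 * xvar \<tau> s ^ Suc n) = momA (Suc n) z \<tau> + momA (n + 2) z \<tau>"
proof -
  have r2: "rvar \<tau> s * rvar \<tau> s = 1 + xvar \<tau> s" for s
    using rescaled_square[OF \<tau>, of s] by (simp only: power2_eq_square)
  have "(1 + x) * x ^ Suc n = x ^ Suc n + x ^ (n + 2)" for x :: real by (simp add: distrib_right)
  hence "inner_avg z \<tau> (\<lambda>s. (rvar \<tau> s)\<^sup>2 * xvar \<tau> s ^ Suc n) = inner_avg z \<tau> (\<lambda>s. xvar \<tau> s ^ Suc n + xvar \<tau> s ^ (n + 2))"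
    by (simp only: rescaled_square[OF \<tau>])
  also have "\<dots> = momA (Suc n) z \<tau> + momA (n + 2) z \<tau>"
    unfolding momA_def by (rule avg_add; intro poly_intros)
  finally show sum: "inner_avg z \<tau> (\<lambda>s. (rvar \<tau> s)\<^sup>2 * xvar \<tau> s ^ Suc n) = momA (Suc n) z \<tau> + momA (n + 2) z \<tau>" .
  define p' where "p' = (\<lambda>s. (1 + 2 * real n) * xvar \<tau> s ^ n + 2 * real n * xvar \<tau> s ^ (n - 1))"
  have "inner_avg z \<tau> (\<lambda>s. (rvar \<tau> s)\<^sup>2 * xvar \<tau> s ^ Suc n) =
      inner_avg z \<tau> (\<lambda>s. (rvar \<tau> s * xvar \<tau> s ^ n) * (rvar \<tau> s * xvar \<tau> s))"
    by (simp only: power2_eq_square power_Suc mult_ac)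
  also have "\<dots> = eps \<tau> / 4 * (inner_avg z \<tau> p' - z * inner_avg z \<tau> (\<lambda>s. rvar \<tau> s * xvar \<tau> s ^ n))"
  proof (rule inner_by_parts[OF \<tau>])
    fix s
    have "real n * x ^ (n - 1) * (1 + x) = real n * x ^ (n - 1) + real n * x ^ n" for x :: real
      by (cases n) (auto simp: algebra_simps)
    hence eq0: "real n * xvar \<tau> s ^ (n - 1) * (rvar \<tau> s * rvar \<tau> s) = real n * xvar \<tau> s ^ (n - 1) + real n * xvar \<tau> s ^ n"
      by (simp only: r2)
    have g: "c * a + c * (2 * m * (r * b)) * r = c * (a + 2 * (m * b * (r * r)))"
      "a + 2 * (m * b + m * a) = (1 + 2 * m) * a + 2 * m * b" for a b c m r :: real by algebra+
    have eq: "2 / sqrt \<tau> * xvar \<tau> s ^ n + 2 / sqrt \<tau> * (2 * real n * (rvar \<tau> s * xvar \<tau> s ^ (n - 1))) * rvar \<tau> s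
        = 2 / sqrt \<tau> * p' s"
      unfolding p'_def g(1) eq0 g(2) ..
    show "((\<lambda>s. rvar \<tau> s * xvar \<tau> s ^ n) has_real_derivative 2 / sqrt \<tau> * p' s) (at s)"
      using DERIV_mult[OF rescaled_deriv[of \<tau> s] xvar_power_deriv[OF \<tau>, of n s]] unfolding eq .
  qed (unfold p'_def, (intro poly_intros)+)
  also have "inner_avg z \<tau> p' = (1 + 2 * real n) * momA n z \<tau> + 2 * real n * momA (n - 1) z \<tau>"
    unfolding p'_def momA_def by (subst avg_add, (intro poly_intros)+) (simp only: avg_cmult)
  finally show "momA (Suc n) z \<tau> + momA (n + 2) z \<tau> =
     eps \<tau> / 4 * ((1 + 2 * real n) * momA n z \<tau> + 2 * real n * momA (n - 1) z \<tau> - z * momB n z \<tau>)"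
    unfolding sum momB_def .
qed

lemma momB_0_riccati:
  assumes \<tau>: "\<tau> > 0"
  shows "((\<lambda>z. momB 0 z \<tau>) has_real_derivative (momB 0 z \<tau>)\<^sup>2 - 1 - momA 1 z \<tau>) (at z)"
proof -
  define r where "r = (\<lambda>s. 2 / sqrt \<tau> * s)"
  define \<xi> where "\<xi> = 2 * z / sqrt \<tau>"
  have rp: "real_polynomial_function r" unfolding r_def by (intro poly_intros)
  have "(\<lambda>s. rvar \<tau> s * xvar \<tau> s ^ 0) = r" unfolding r_def by auto
  hence momB: "momB 0 z \<tau> = inner_avg z \<tau> r" for z unfolding momB_def by simp
  have "((\<lambda>\<xi>. avg \<xi> \<tau> r) has_real_derivative avg \<xi> \<tau> (\<lambda>s. s) * avg \<xi> \<tau> r - avg \<xi> \<tau> (\<lambda>s. s * r s)) (at \<xi>)"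
    by (rule avg_has_derivative[OF rp])
  hence "((\<lambda>z. inner_avg z \<tau> r) has_real_derivative
     (avg \<xi> \<tau> (\<lambda>s. s) * avg \<xi> \<tau> r - avg \<xi> \<tau> (\<lambda>s. s * r s)) * (2 / sqrt \<tau>)) (at z)"
    unfolding \<xi>_def by (rule DERIV_chain2) (rule rescaled_deriv)
  also have "(avg \<xi> \<tau> (\<lambda>s. s) * avg \<xi> \<tau> r - avg \<xi> \<tau> (\<lambda>s. s * r s)) * (2 / sqrt \<tau>)
     = (2 / sqrt \<tau> * avg \<xi> \<tau> (\<lambda>s. s)) * avg \<xi> \<tau> r - 2 / sqrt \<tau> * avg \<xi> \<tau> (\<lambda>s. s * r s)" by (simp add: algebra_simps)
  also have "\<dots> = avg \<xi> \<tau> r * avg \<xi> \<tau> r - avg \<xi> \<tau> (\<lambda>s. r s * r s)"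
  proof -
    have "avg \<xi> \<tau> r = 2 / sqrt \<tau> * avg \<xi> \<tau> (\<lambda>s. s)" unfolding r_def by (rule avg_cmult)
    moreover have "(\<lambda>s. r s * r s) = (\<lambda>s. 2 / sqrt \<tau> * (s * r s))" by (simp add: r_def)
    ultimately show ?thesis by (simp only: avg_cmult)
  qed
  also have "(\<lambda>s. r s * r s) = (\<lambda>s. 1 + xvar \<tau> s ^ 1)"
    using rescaled_square[OF \<tau>] unfolding r_def by (auto simp: power2_eq_square)
  also have "avg \<xi> \<tau> \<dots> = 1 + momA 1 z \<tau>"
    unfolding momA_def \<xi>_def[symmetric] by (subst avg_add, (intro poly_intros)+) (simp add: avg_const)
  finally show ?thesis unfolding momB \<xi>_def by (simp add: power2_eq_square algebra_simps)
qed

lemma momB_0_at_0: "momB 0 0 \<tau> = 0"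
proof -
  have "weighted_integral 0 \<tau> (\<lambda>s. s) = (LINT s|lborel. s * exp (phase 0 \<tau> s))"
    by (simp add: weighted_integral_def)
  also have "\<dots> = \<bar>- 1\<bar> *\<^sub>R (LINT s|lborel. (0 + (- 1) * s) * exp (phase 0 \<tau> (0 + (- 1) * s)))"
    by (rule lborel_integral_real_affine) simp
  also have "\<dots> = - weighted_integral 0 \<tau> (\<lambda>s. s)"
    by (simp add: weighted_integral_def phase_def)
  finally have "avg 0 \<tau> (\<lambda>s. s) = 0" by (simp add: avg_def)
  hence "avg 0 \<tau> (\<lambda>s. 2 / sqrt \<tau> * s) = 0" by (simp only: avg_cmult)
  moreover have "(\<lambda>s. rvar \<tau> s * xvar \<tau> s ^ 0) = (\<lambda>s. 2 / sqrt \<tau> * s)" by auto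
  ultimately show ?thesis unfolding momB_def by simp
qed

text \<open>
  The derivative is minus the variance of \<open>r\<close>. Together with \<open>momB_0_at_0\<close>
  this fixes the sign of \<open>B\<^sub>0\<close>.
\<close>

lemma momB_0_decreasing:
  assumes \<tau>: "\<tau> > 0" and "z \<le> z'"
  shows "momB 0 z' \<tau> \<le> momB 0 z \<tau>"
proof (rule DERIV_nonpos_imp_nonincreasing[OF assms(2)])
  fix t
  define \<xi> where "\<xi> = 2 * t / sqrt \<tau>"
  define y where "y = momB 0 t \<tau>"
  have eq: "(rvar \<tau> s - y)\<^sup>2 = (1 + y\<^sup>2) + xvar \<tau> s ^ 1 - 2 * y * (rvar \<tau> s * xvar \<tau> s ^ 0)" for s
    using rescaled_square[OF \<tau>, of s] by (simp add: power2_diff)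
  have "0 \<le> avg \<xi> \<tau> (\<lambda>s. (rvar \<tau> s - y)\<^sup>2)"
    by (rule avg_nonneg) (intro poly_intros, simp)
  also have "\<dots> = (1 + y\<^sup>2) + momA 1 t \<tau> - 2 * y * momB 0 t \<tau>"
    unfolding eq momA_def momB_def \<xi>_def[symmetric]
    by (subst avg_diff, (intro poly_intros)+, subst avg_add, (intro poly_intros)+) (simp only: avg_const avg_cmult)
  finally have "y\<^sup>2 - 1 - momA 1 t \<tau> \<le> 0" unfolding y_def by (simp add: power2_eq_square)
  thus "\<exists>d. ((\<lambda>z. momB 0 z \<tau>) has_real_derivative d) (at t) \<and> d \<le> 0"
    using momB_0_riccati[OF \<tau>, of t] unfolding y_def by blast
qed

lemma phase_rescaled:
  assumes "\<tau> > 0"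
  shows "phase (2 * z / sqrt \<tau>) \<tau> s = \<tau>\<^sup>2 / 8 - z * (rvar \<tau> s) - \<tau>\<^sup>2 / 8 * (xvar \<tau> s)\<^sup>2"
  using assms unfolding phase_def by (simp add: field_simps power2_eq_square power4_eq_xxxx)

text \<open>
  Only the maximum favoured by the sign of \<open>z\<close> is used: on an interval of length
  \<open>1/\<surd>T\<close> in \<open>r\<close>, on its outer side,
  \<open>|x| \<le> 3/\<surd>T\<close>, so that \<open>T x^2 \<le> 9\<close>, and
  \<open>- z r \<ge> |z|\<close>.
\<close>

lemma Lam_lower_bound_rescaled:
  assumes \<tau>: "\<tau> > 0" and T: "T = \<tau>\<^sup>2 / 8" "T \<ge> 1"
  shows "Lam (2 * z / sqrt \<tau>) \<tau> \<ge> sqrt \<tau> / (2 * sqrt T) * exp (T + \<bar>z\<bar> - 9)"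
proof -
  define \<sigma> where "\<sigma> = (if z \<le> 0 then 1 else - 1 :: real)"
  have \<sigma>: "- z * \<sigma> = \<bar>z\<bar>" "\<sigma> * \<sigma> = 1" unfolding \<sigma>_def by auto
  have sT: "sqrt T \<ge> 1" using T by simp
  have lower: "phase (2 * z / sqrt \<tau>) \<tau> (\<sigma> * s) \<ge> T + \<bar>z\<bar> - 9"
    if s: "s \<in> {sqrt \<tau> / 2..sqrt \<tau> / 2 * (1 + 1 / sqrt T)}" for s
  proof -
    define r where "r = rvar \<tau> s"
    have r: "1 \<le> r" "r \<le> 1 + 1 / sqrt T" using s \<tau> unfolding r_def by (auto simp: field_simps)
    have r2: "r \<le> 2" using r(2) sT by (smt (verit) divide_le_eq_1)
    have x: "xvar \<tau> s = (r - 1) * (r + 1)"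
      using rescaled_square[OF \<tau>, of s] unfolding r_def[symmetric] by (simp add: power2_eq_square algebra_simps)
    have "(r - 1) * (r + 1) \<le> (1 / sqrt T) * 3" using r r2 sT by (intro mult_mono) auto
    moreover have "(r - 1) * (r + 1) \<ge> 0" using r by simp
    ultimately have "((r - 1) * (r + 1))\<^sup>2 \<le> (1 / sqrt T * 3)\<^sup>2" by (intro power_mono)
    also have "\<dots> = 9 / T" using T(2) by (simp add: power_mult_distrib power_divide)
    finally have "T * (xvar \<tau> s)\<^sup>2 \<le> T * (9 / T)" unfolding x using T(2) by (intro mult_left_mono) auto
    hence "T * (xvar \<tau> s)\<^sup>2 \<le> 9" using T(2) by simp
    moreover have "- z * (2 * (\<sigma> * s) / sqrt \<tau>) \<ge> \<bar>z\<bar>"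
    proof -
      have "- z * (2 * (\<sigma> * s) / sqrt \<tau>) = (- z * \<sigma>) * r" unfolding r_def by simp
      also have "\<dots> = \<bar>z\<bar> * r" by (simp only: \<sigma>)
      also have "\<dots> \<ge> \<bar>z\<bar> * 1" using r by (intro mult_left_mono) auto
      finally show ?thesis by simp
    qed
    moreover have "(\<sigma> * s)\<^sup>2 = s\<^sup>2" unfolding \<sigma>_def by auto
    ultimately show ?thesis unfolding phase_rescaled[OF \<tau>] T(1)[symmetric] by simp
  qed
  define L where "L = sqrt \<tau> / 2"
  define U where "U = sqrt \<tau> / 2 * (1 + 1 / sqrt T)"
  have UL: "U - L = sqrt \<tau> / (2 * sqrt T)" "U \<ge> L" using \<tau> sT unfolding U_def L_def by (auto simp: field_simps)
  show ?thesis
  proof (cases "z \<le> 0")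
    case True
    have "Lam (2 * z / sqrt \<tau>) \<tau> \<ge> (U - L) * exp (T + \<bar>z\<bar> - 9)"
      by (rule Lam_ge_on_interval) (use lower True UL in \<open>auto simp: \<sigma>_def U_def L_def\<close>)
    thus ?thesis using UL by simp
  next
    case False
    have "Lam (2 * z / sqrt \<tau>) \<tau> \<ge> (- L - (- U)) * exp (T + \<bar>z\<bar> - 9)"
    proof (rule Lam_ge_on_interval)
      fix s assume "s \<in> {- U..- L}"
      hence "- s \<in> {L..U}" by auto
      from lower[OF this[unfolded L_def U_def]] show "T + \<bar>z\<bar> - 9 \<le> phase (2 * z / sqrt \<tau>) \<tau> s" using False by (simp add: \<sigma>_def)
    qed (use UL in auto)
    thus ?thesis using UL by simp
  qed
qed

text \<open>
  Integration by parts controls \<open>r^2 x^(2m)\<close>, which degenerates at \<open>r = 0\<close>,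
  the local minimum of the weight. Where \<open>r^2 < 1/2\<close> one has
  \<open>x^2 \<ge> 1/4\<close> and \<open>|r| \<le> 1\<close>, so the mass of that region is
  exponentially small in \<open>T\<close> compared with \<open>Lam\<close>, for every \<open>z\<close>.
\<close>

lemma momA_even_le:
  assumes \<tau>: "\<tau> > 0" and T: "T = \<tau>\<^sup>2 / 8" "T \<ge> 1"
  shows "momA (2 * m) z \<tau> \<le> 2 * inner_avg z \<tau> (\<lambda>s. (rvar \<tau> s)\<^sup>2 * xvar \<tau> s ^ (2 * m))
     + 2 * sqrt T * exp (9 - T / 4)"
proof -
  define \<xi> where "\<xi> = 2 * z / sqrt \<tau>"
  define W where "W = (\<lambda>s. (rvar \<tau> s)\<^sup>2 * xvar \<tau> s ^ (2 * m))"
  define J where "J = {- sqrt \<tau> / 2..sqrt \<tau> / 2}"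
  define E where "E = exp (T + \<bar>z\<bar> - T / 4)"
  have W: "real_polynomial_function W" unfolding W_def by (intro poly_intros)
  have p: "real_polynomial_function (\<lambda>s::real. xvar \<tau> s ^ (2 * m))" by (intro poly_intros)
  have st: "sqrt \<tau> > 0" using \<tau> by simp
  have iW: "integrable lborel (\<lambda>s. 2 * (W s * exp (phase \<xi> \<tau> s)))" by (intro integrable_mult_right integrable_polynomial_weight W)
  have iJ: "integrable lborel (\<lambda>s. indicat_real J s * E)"
    using st by (intro integrable_mult_left integrable_real_indicator) (auto simp: J_def emeasure_lborel_Icc_eq)
  have "weighted_integral \<xi> \<tau> (\<lambda>s. xvar \<tau> s ^ (2 * m)) \<le>
     (LINT s|lborel. 2 * (W s * exp (phase \<xi> \<tau> s)) + indicator J s * E)"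
    unfolding weighted_integral_def
  proof (rule integral_mono[OF integrable_polynomial_weight[OF p] Bochner_Integration.integrable_add[OF iW iJ]])
    fix s :: real
    define r where "r = rvar \<tau> s"
    define x where "x = xvar \<tau> s"
    have r2: "r\<^sup>2 = 1 + x" using rescaled_square[OF \<tau>, of s] unfolding r_def x_def .
    have xm: "x ^ (2 * m) \<ge> 0" by simp
    show "xvar \<tau> s ^ (2 * m) * exp (phase \<xi> \<tau> s) \<le> 2 * (W s * exp (phase \<xi> \<tau> s)) + indicator J s * E"
    proof (cases "r\<^sup>2 \<ge> 1 / 2")
      case True
      have "x ^ (2 * m) * 1 \<le> x ^ (2 * m) * (2 * r\<^sup>2)" using True xm by (intro mult_left_mono) auto
      hence "x ^ (2 * m) * exp (phase \<xi> \<tau> s) \<le> (2 * W s) * exp (phase \<xi> \<tau> s)"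
        unfolding W_def r_def[symmetric] x_def[symmetric] by (intro mult_right_mono) (auto simp: mult_ac)
      moreover have "indicator J s * E \<ge> 0" by (simp add: E_def)
      ultimately show ?thesis unfolding x_def mult.assoc by linarith
    next
      case False
      have "r\<^sup>2 \<ge> 0" by simp
      hence x: "x \<le> - (1 / 2)" "x \<ge> - 1" using False r2 by linarith+
      have "x\<^sup>2 \<le> 1" using x by (intro abs_square_le_1[THEN iffD2]) auto
      hence x1: "x ^ (2 * m) \<le> 1" using power_le_one[of "x\<^sup>2" m] by (simp add: power_mult)
      have "(1 / 2)\<^sup>2 \<le> (- x)\<^sup>2" using x by (intro power_mono) auto
      hence x4: "x\<^sup>2 \<ge> 1 / 4" by (simp add: power_divide)
      have "\<bar>r\<bar> \<le> 1" using False by (intro abs_square_le_1[THEN iffD1]) auto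
      hence rz: "- z * r \<le> \<bar>z\<bar>" using mult_left_mono[of "\<bar>r\<bar>" 1 "\<bar>z\<bar>"] abs_ge_self[of "- z * r"] by (simp add: abs_mult)
      have "\<bar>r\<bar> * sqrt \<tau> \<le> 1 * sqrt \<tau>" using \<open>\<bar>r\<bar> \<le> 1\<close> st by (intro mult_right_mono) auto
      moreover have "\<bar>r\<bar> * sqrt \<tau> = 2 * \<bar>s\<bar>" using st unfolding r_def by (simp add: abs_mult)
      ultimately have sJ: "s \<in> J" unfolding J_def by auto
      have "phase \<xi> \<tau> s = T - z * r - T * x\<^sup>2" unfolding \<xi>_def phase_rescaled[OF \<tau>] T(1) r_def x_def ..
      also have "\<dots> \<le> T + \<bar>z\<bar> - T / 4"
      proof -
        have "T * (1 / 4) \<le> T * x\<^sup>2" using x4 T(2) by (intro mult_left_mono) auto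
        thus ?thesis using rz by simp
      qed
      finally have "exp (phase \<xi> \<tau> s) \<le> E" unfolding E_def by simp
      hence "x ^ (2 * m) * exp (phase \<xi> \<tau> s) \<le> 1 * E" using x1 xm by (intro mult_mono) auto
      moreover have "W s \<ge> 0" unfolding W_def by simp
      ultimately show ?thesis using sJ unfolding x_def by (simp add: add_increasing)
    qed
  qed
  also have "\<dots> = 2 * weighted_integral \<xi> \<tau> W + sqrt \<tau> * E"
    using iW iJ st by (subst Bochner_Integration.integral_add) (auto simp: weighted_integral_def J_def)
  finally have num: "weighted_integral \<xi> \<tau> (\<lambda>s. xvar \<tau> s ^ (2 * m)) \<le> 2 * weighted_integral \<xi> \<tau> W + sqrt \<tau> * E" .
  have L: "Lam \<xi> \<tau> \<ge> sqrt \<tau> / (2 * sqrt T) * exp (T + \<bar>z\<bar> - 9)" unfolding \<xi>_def by (rule Lam_lower_bound_rescaled[OF \<tau> T])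
  have "sqrt \<tau> * E \<le> 2 * sqrt T * exp (9 - T / 4) * Lam \<xi> \<tau>"
  proof -
    have "sqrt \<tau> * E = 2 * sqrt T * exp (9 - T / 4) * (sqrt \<tau> / (2 * sqrt T) * exp (T + \<bar>z\<bar> - 9))"
      using T(2) unfolding E_def by (simp add: flip: exp_add)
    also have "\<dots> \<le> 2 * sqrt T * exp (9 - T / 4) * Lam \<xi> \<tau>" using L T(2) by (intro mult_left_mono) auto
    finally show ?thesis .
  qed
  with num have "weighted_integral \<xi> \<tau> (\<lambda>s. xvar \<tau> s ^ (2 * m)) \<le> 2 * weighted_integral \<xi> \<tau> W + 2 * sqrt T * exp (9 - T / 4) * Lam \<xi> \<tau>"
    by linarith
  hence "weighted_integral \<xi> \<tau> (\<lambda>s. xvar \<tau> s ^ (2 * m)) / Lam \<xi> \<tau> \<le>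
     (2 * weighted_integral \<xi> \<tau> W + 2 * sqrt T * exp (9 - T / 4) * Lam \<xi> \<tau>) / Lam \<xi> \<tau>"
    using Lam_pos[of \<xi> \<tau>] by (intro divide_right_mono) auto
  thus ?thesis using Lam_pos[of \<xi> \<tau>] unfolding momA_def avg_def \<xi>_def[symmetric] W_def[symmetric]
    by (simp add: add_divide_distrib)
qed

section \<open>Size of the rescaled moments\<close>

text \<open>
  This is \<open>\<sigma>\<close>. The fluctuations of \<open>x\<close> are of size
  \<open>\<surd>\<epsilon>\<close> around a mean that the linear term of the phase displaces by about
  \<open>|z| \<epsilon>\<close>; for \<open>\<sigma> \<le> 1\<close> both have squares of order
  \<open>\<sigma>\<close> at most.
\<close>

definition spread :: "real \<times> real \<Rightarrow> real" where "spread p = (1 + \<bar>fst p\<bar>) * eps (snd p)"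

text \<open>
  The limit \<open>\<sigma> \<rightarrow> 0\<close> in the variables \<open>(z, \<tau>)\<close>. A
  basic neighbourhood contains with \<open>(z, \<tau>)\<close> all \<open>(t, \<tau>)\<close> with
  \<open>|t| \<le> |z|\<close>, which is what a differential equation in \<open>z\<close> with data at
  \<open>0\<close> requires.
\<close>

definition inner_filter :: "(real \<times> real) filter" where
  "inner_filter = inf (filtercomap spread (at_right 0)) (principal {p. snd p > 0})"

abbreviation (input) inner_O :: "nat \<Rightarrow> (real \<times> real \<Rightarrow> real) set" where
  "inner_O N \<equiv> O[inner_filter](\<lambda>p. spread p ^ N)"

lemma eps_pos: "\<tau> > 0 \<Longrightarrow> eps \<tau> > 0"
  by (simp add: eps_def)

lemma eps_le_spread: "snd p > 0 \<Longrightarrow> eps (snd p) \<le> spread p"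
  unfolding spread_def using eps_pos[of "snd p"] by (simp add: mult_le_cancel_right1)

lemma spread_pos: "snd p > 0 \<Longrightarrow> spread p > 0"
  using eps_le_spread eps_pos by (metis less_le_trans)

lemma eventually_inner_filter:
  "eventually P inner_filter \<longleftrightarrow> (\<exists>s0>0. \<forall>p. snd p > 0 \<longrightarrow> spread p < s0 \<longrightarrow> P p)"
proof -
  have "eventually P inner_filter \<longleftrightarrow> (\<exists>Q. eventually Q (at_right 0) \<and> (\<forall>p. Q (spread p) \<longrightarrow> snd p > 0 \<longrightarrow> P p))"
    unfolding inner_filter_def eventually_inf_principal eventually_filtercomap by simp
  also have "\<dots> \<longleftrightarrow> (\<exists>s0>0. \<forall>p. snd p > 0 \<longrightarrow> spread p < s0 \<longrightarrow> P p)" (is "?A \<longleftrightarrow> ?B")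
  proof
    assume ?A
    then obtain Q b where Q: "b > 0" "\<And>y. y > 0 \<Longrightarrow> y < b \<Longrightarrow> Q y" "\<forall>p. Q (spread p) \<longrightarrow> snd p > 0 \<longrightarrow> P p"
      unfolding eventually_at_right_field by blast
    thus ?B using spread_pos by blast
  next
    assume ?B
    then obtain s0 where s0: "s0 > 0" "\<forall>p. snd p > 0 \<longrightarrow> spread p < s0 \<longrightarrow> P p" by blast
    have "eventually (\<lambda>y. y < s0) (at_right 0)"
      unfolding eventually_at_right_field using s0(1) by auto
    thus ?A using s0(2) by (intro exI[of _ "\<lambda>y. y < s0"]) auto
  qed
  finally show ?thesis .
qed

lemma eventually_spread_less: "\<delta> > 0 \<Longrightarrow> \<forall>\<^sub>F p in inner_filter. snd p > 0 \<and> 0 < spread p \<and> spread p < \<delta>"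
  unfolding eventually_inner_filter using spread_pos by blast

lemma spread_power_bigo: "m \<le> n \<Longrightarrow> (\<lambda>p. spread p ^ n) \<in> inner_O m"
proof (rule bigoI[of _ 1])
  assume mn: "m \<le> n"
  show "\<forall>\<^sub>F p in inner_filter. norm (spread p ^ n) \<le> 1 * norm (spread p ^ m)"
    using eventually_spread_less[of 1, simplified]
    by eventually_elim (use mn in \<open>auto intro: power_decreasing\<close>)
qed

lemma eps_bigo: "(\<lambda>p. eps (snd p)) \<in> O[inner_filter](spread)"
proof (rule bigoI[of _ 1])
  show "\<forall>\<^sub>F p in inner_filter. norm (eps (snd p)) \<le> 1 * norm (spread p)"
    using eventually_spread_less[of 1, simplified]
    by eventually_elim (use eps_le_spread eps_pos in \<open>auto simp: abs_of_pos\<close>)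
qed

lemma eps_ident_bigo: "(\<lambda>p. eps (snd p) * fst p) \<in> O[inner_filter](spread)"
proof (rule bigoI[of _ 1])
  show "\<forall>\<^sub>F p in inner_filter. norm (eps (snd p) * fst p) \<le> 1 * norm (spread p)"
    using eventually_spread_less[of 1, simplified]
  proof eventually_elim
    case (elim p)
    thus ?case using eps_pos[of "snd p"] unfolding spread_def by (simp add: abs_mult abs_of_pos algebra_simps)
  qed
qed

lemma coef_term_bigo:
  assumes "poly_growth k f"
  shows "(\<lambda>p. eps (snd p) ^ k * f (fst p)) \<in> inner_O k"
proof -
  obtain M where M: "M \<ge> 0" "\<And>z. \<bar>f z\<bar> \<le> M * (1 + \<bar>z\<bar>) ^ k" using assms unfolding poly_growth_def by blast
  show ?thesis
  proof (rule bigoI[of _ M])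
    show "\<forall>\<^sub>F p in inner_filter. norm (eps (snd p) ^ k * f (fst p)) \<le> M * norm (spread p ^ k)"
      using eventually_spread_less[of 1, simplified]
    proof eventually_elim
      case (elim p)
      have "eps (snd p) ^ k * \<bar>f (fst p)\<bar> \<le> eps (snd p) ^ k * (M * (1 + \<bar>fst p\<bar>) ^ k)"
        using M(2) eps_pos[of "snd p"] elim by (intro mult_left_mono) auto
      also have "\<dots> = M * spread p ^ k" by (simp add: spread_def power_mult_distrib)
      finally show ?case using elim eps_pos[of "snd p"] by (simp add: abs_mult power_abs abs_of_pos)
    qed
  qed
qed

lemma filterlim_inner_T: "filterlim (\<lambda>p. (snd p)\<^sup>2 / 8) at_top inner_filter"
  unfolding filterlim_at_top_dense
proof
  fix Z :: real
  define Z' where "Z' = max Z 1"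
  have "\<forall>\<^sub>F p in inner_filter. snd p > 0 \<and> 0 < spread p \<and> spread p < 1 / Z'"
    by (rule eventually_spread_less) (simp add: Z'_def)
  thus "\<forall>\<^sub>F p in inner_filter. Z < (snd p)\<^sup>2 / 8"
  proof eventually_elim
    case (elim p)
    hence "eps (snd p) < 1 / Z'" using eps_le_spread[of p] by simp
    hence "Z' < (snd p)\<^sup>2 / 8" using elim unfolding eps_def by (simp add: Z'_def field_simps)
    thus ?case by (simp add: Z'_def)
  qed
qed

lemma momA_nonneg: "momA (2 * j) z \<tau> \<ge> 0"
  unfolding momA_def by (intro avg_nonneg poly_intros) simp

lemma power_double:
  fixes x :: real
  shows "x ^ (2 * j) = x ^ j * x ^ j" "x ^ (2 * j + 1) = x * (x ^ j * x ^ j)" "x ^ (2 * j + 2) = x * x * (x ^ j * x ^ j)"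
  by (simp_all add: mult_2 power_add)

lemma momA_odd_le: "momA (2 * j + 1) z \<tau> \<le> (momA (2 * j) z \<tau> + momA (2 * j + 2) z \<tau>) / 2"
proof -
  have "momA (2 * j + 1) z \<tau> \<le> inner_avg z \<tau> (\<lambda>s. 1 / 2 * (xvar \<tau> s ^ (2 * j) + xvar \<tau> s ^ (2 * j + 2)))"
    unfolding momA_def
  proof (rule avg_mono)
    fix s :: real
    define x where "x = xvar \<tau> s"
    have "0 \<le> (x ^ j - x ^ (j + 1))\<^sup>2" by simp
    also have "\<dots> = x ^ (2 * j) + x ^ (2 * j + 2) - 2 * x ^ (2 * j + 1)"
      unfolding power_double by (simp add: power2_eq_square algebra_simps)
    finally show "x ^ (2 * j + 1) \<le> 1 / 2 * (x ^ (2 * j) + x ^ (2 * j + 2))" by simp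
  qed (intro poly_intros)+
  also have "\<dots> = 1 / 2 * (momA (2 * j) z \<tau> + momA (2 * j + 2) z \<tau>)"
    unfolding avg_cmult momA_def by (subst avg_add, (intro poly_intros)+) simp
  finally show ?thesis by simp
qed

text \<open>
  Young's inequality \<open>- c r x^(2j+1) \<le> (r x^(j+1))^2 / 2 + (c x^j)^2 / 2\<close>.
\<close>

lemma momB_odd_le:
  "- c * momB (2 * j + 1) z \<tau> \<le>
     1 / 2 * inner_avg z \<tau> (\<lambda>s. (rvar \<tau> s)\<^sup>2 * xvar \<tau> s ^ (2 * j + 2)) + c\<^sup>2 / 2 * momA (2 * j) z \<tau>"
proof -
  have "inner_avg z \<tau> (\<lambda>s. - c * (rvar \<tau> s * xvar \<tau> s ^ (2 * j + 1))) \<le>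
     inner_avg z \<tau> (\<lambda>s. 1 / 2 * ((rvar \<tau> s)\<^sup>2 * xvar \<tau> s ^ (2 * j + 2))
       + c\<^sup>2 / 2 * xvar \<tau> s ^ (2 * j))"
  proof (rule avg_mono)
    fix s :: real
    define x where "x = xvar \<tau> s"
    define r where "r = rvar \<tau> s"
    have "0 \<le> (r * x ^ (j + 1) + c * x ^ j)\<^sup>2" by simp
    also have "\<dots> = r\<^sup>2 * x ^ (2 * j + 2) + c\<^sup>2 * x ^ (2 * j) + 2 * c * (r * x ^ (2 * j + 1))"
      unfolding power_double by (simp add: power2_eq_square algebra_simps)
    finally show "- c * (r * x ^ (2 * j + 1)) \<le> 1 / 2 * (r\<^sup>2 * x ^ (2 * j + 2)) + c\<^sup>2 / 2 * x ^ (2 * j)" by simp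
  qed (intro poly_intros)+
  also have "\<dots> = 1 / 2 * inner_avg z \<tau> (\<lambda>s. (rvar \<tau> s)\<^sup>2 * xvar \<tau> s ^ (2 * j + 2))
      + c\<^sup>2 / 2 * momA (2 * j) z \<tau>"
    unfolding momA_def by (subst avg_add, (intro poly_intros)+) (simp only: avg_cmult)
  finally show ?thesis unfolding momB_def by (simp only: avg_cmult)
qed

text \<open>
  Let \<open>X\<close>, \<open>Y\<close> and \<open>W\<close> be the means of \<open>x^(2j+2)\<close>,
  \<open>x^(2j)\<close> and \<open>r^2 x^(2j+2)\<close>. Integration by parts with
  \<open>r x^(2j+1)\<close> bounds \<open>W\<close> by \<open>\<epsilon>\<close> times
  \<open>X + Y\<close> and a term \<open>\<epsilon> z\<close> times the mean of
  \<open>r x^(2j+1)\<close>; half of \<open>W\<close> absorbs the latter at the price of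
  \<open>(\<epsilon> z)^2 Y \<le> \<sigma> Y\<close>. So \<open>W\<close> is of order
  \<open>\<sigma> (X + Y)\<close>, hence so is \<open>X\<close> by \<open>momA_even_le\<close>, and
  \<open>X\<close> can be absorbed for small \<open>\<sigma>\<close>.
\<close>

lemma momA_even_bigo: "(\<lambda>p. momA (2 * j) (fst p) (snd p)) \<in> inner_O j"
proof (induction j)
  case 0
  show ?case by (simp add: momA_0)
next
  case (Suc j)
  obtain C where C: "C > 0" "\<forall>\<^sub>F p in inner_filter. norm (momA (2 * j) (fst p) (snd p)) \<le> C * norm (spread p ^ j)"
    using Suc.IH by (elim landau_o.bigE)
  define n where "n = 2 * j + 1"
  have "\<forall>\<^sub>F T in at_top. 2 * sqrt T * exp (9 - T / 4) \<le> 1 / T ^ Suc j"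
  proof -
    have "((\<lambda>T. 2 * sqrt T * exp (9 - T / 4) * T powr (real j + 1)) \<longlongrightarrow> 0) at_top" by real_asymp
    hence "\<forall>\<^sub>F T in at_top. 2 * sqrt T * exp (9 - T / 4) * T powr (real j + 1) < 1" by (rule order_tendstoD) auto
    thus ?thesis using eventually_gt_at_top[of 0]
    proof eventually_elim
      case (elim T)
      have "T powr (real j + 1) = T ^ Suc j" using elim by (simp add: powr_add powr_realpow)
      thus ?case using elim by (simp add: pos_le_divide_eq)
    qed
  qed
  hence tail: "\<forall>\<^sub>F p in inner_filter. 2 * sqrt ((snd p)\<^sup>2 / 8) * exp (9 - (snd p)\<^sup>2 / 8 / 4) \<le> 1 / ((snd p)\<^sup>2 / 8) ^ Suc j"
    by (rule eventually_compose_filterlim[OF _ filterlim_inner_T])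
  have T1: "\<forall>\<^sub>F p in inner_filter. (snd p)\<^sup>2 / 8 \<ge> 1"
    by (rule eventually_compose_filterlim[OF eventually_ge_at_top filterlim_inner_T])
  \<comment> \<open>Large enough for \<open>W \<le> \<sigma> K/4 (X + Y)\<close>; then \<open>\<sigma> < 1/K\<close> permits the absorption of \<open>X\<close>.\<close>
  define K where "K = 8 * (real n + 1)"
  have K: "K \<ge> 8" unfolding K_def by simp
  hence K': "1 / K > 0" by simp
  have "\<forall>\<^sub>F p in inner_filter. norm (momA (2 * Suc j) (fst p) (snd p)) \<le> (K * C + 2) * norm (spread p ^ Suc j)"
    using C(2) tail T1 eventually_spread_less[of "1 / K", OF K']
  proof (eventually_elim)
    case (elim p)
    define s where "s = spread p"
    define z where "z = fst p"
    define \<tau> where "\<tau> = snd p"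
    define X where "X = momA (2 * Suc j) z \<tau>"
    define Y where "Y = momA (2 * j) z \<tau>"
    define W where "W = inner_avg z \<tau> (\<lambda>s. (rvar \<tau> s)\<^sup>2 * xvar \<tau> s ^ (2 * j + 2))"
    have s: "0 < s" "s < 1 / K" and \<tau>: "\<tau> > 0" using elim K by (auto simp: s_def \<tau>_def)
    have sK: "s * K \<le> 1" using s K by (simp add: field_simps)
    have s1: "s \<le> 1" using s K by (smt (verit) divide_le_eq_1)
    have e: "0 < eps \<tau>" "eps \<tau> \<le> s" using eps_pos[OF \<tau>] eps_le_spread[of p] \<tau> by (auto simp: s_def \<tau>_def)
    have XY: "X \<ge> 0" "Y \<ge> 0" unfolding X_def Y_def by (rule momA_nonneg)+
    have Y: "Y \<le> C * s ^ j" using elim(1) s unfolding Y_def z_def \<tau>_def s_def by simp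
    define c where "c = eps \<tau> / 4 * z"
    have c: "c\<^sup>2 \<le> s"
    proof -
      have "\<bar>c\<bar> \<le> s" using e \<tau> unfolding c_def s_def spread_def z_def[symmetric] \<tau>_def[symmetric]
        by (simp add: abs_mult algebra_simps)
      hence "c\<^sup>2 \<le> s\<^sup>2" by (metis abs_ge_zero power2_abs power_mono)
      also have "\<dots> \<le> s" using s s1 by (simp add: power2_eq_square mult_left_le)
      finally show ?thesis .
    qed
    have "W = eps \<tau> / 4 * ((1 + 2 * real n) * momA n z \<tau> + 2 * real n * momA (n - 1) z \<tau> - z * momB n z \<tau>)"
      using momA_recursion[OF \<tau>, where n = n and z = z] unfolding W_def n_def by simp
    also have "\<dots> = eps \<tau> / 4 * ((1 + 2 * real n) * momA n z \<tau> + 2 * real n * Y) + (- c * momB n z \<tau>)"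
      unfolding c_def Y_def n_def by (simp add: algebra_simps)
    also have "\<dots> \<le> s / 4 * ((1 + 2 * real n) * ((Y + X) / 2) + 2 * real n * Y) + (1 / 2 * W + s / 2 * Y)"
    proof (rule add_mono)
      have "momA n z \<tau> \<le> (Y + X) / 2" using momA_odd_le[of j z \<tau>] by (simp add: n_def X_def Y_def)
      hence "eps \<tau> / 4 * ((1 + 2 * real n) * momA n z \<tau> + 2 * real n * Y) \<le>
         eps \<tau> / 4 * ((1 + 2 * real n) * ((Y + X) / 2) + 2 * real n * Y)"
        using e by (intro mult_left_mono add_right_mono) auto
      also have "\<dots> \<le> s / 4 * ((1 + 2 * real n) * ((Y + X) / 2) + 2 * real n * Y)"
        using e XY by (intro mult_right_mono) auto
      finally show "eps \<tau> / 4 * ((1 + 2 * real n) * momA n z \<tau> + 2 * real n * Y) \<le>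
        s / 4 * ((1 + 2 * real n) * ((Y + X) / 2) + 2 * real n * Y)" .
      have "- c * momB n z \<tau> \<le> 1 / 2 * W + c\<^sup>2 / 2 * Y"
        using momB_odd_le[of c j z \<tau>] unfolding W_def Y_def n_def .
      also have "c\<^sup>2 / 2 * Y \<le> s / 2 * Y" using c XY by (intro mult_right_mono) auto
      finally show "- c * momB n z \<tau> \<le> 1 / 2 * W + s / 2 * Y" by simp
    qed
    finally have W': "W \<le> s / 4 * ((1 + 2 * real n) * ((Y + X) / 2) + 2 * real n * Y) + (1 / 2 * W + s / 2 * Y)" .
    have "W \<le> 2 * (a + b)" if "W \<le> a + (1 / 2 * W + b)" for a b using that by simp
    from this[OF W'] have "W \<le> 2 * (s / 4 * ((1 + 2 * real n) * ((Y + X) / 2) + 2 * real n * Y) + s / 2 * Y)" .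
    also have "\<dots> = s * ((1 + 2 * real n) / 4 * (Y + X) + (real n + 1) * Y)" by (simp add: field_simps)
    also have "\<dots> \<le> s * ((real n + 1) * (Y + X) + (real n + 1) * (Y + X))"
      using s XY by (intro mult_left_mono add_mono mult_right_mono mult_left_mono) auto
    also have "\<dots> = s * K / 4 * (Y + X)" unfolding K_def by (simp add: algebra_simps)
    finally have W: "W \<le> s * K / 4 * (Y + X)" .
    have "X \<le> 2 * W + 2 * sqrt (\<tau>\<^sup>2 / 8) * exp (9 - \<tau>\<^sup>2 / 8 / 4)"
      using momA_even_le[OF \<tau> refl, of "Suc j" z] elim(3) unfolding X_def W_def \<tau>_def by simp
    also have "2 * sqrt (\<tau>\<^sup>2 / 8) * exp (9 - \<tau>\<^sup>2 / 8 / 4) \<le> s ^ Suc j"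
    proof -
      have "2 * sqrt (\<tau>\<^sup>2 / 8) * exp (9 - \<tau>\<^sup>2 / 8 / 4) \<le> 1 / (\<tau>\<^sup>2 / 8) ^ Suc j" using elim(2) unfolding \<tau>_def .
      also have "\<dots> = eps \<tau> ^ Suc j" unfolding eps_def by (simp add: power_divide)
      also have "\<dots> \<le> s ^ Suc j" using e by (intro power_mono) auto
      finally show ?thesis .
    qed
    finally have "X \<le> s * K / 2 * Y + s * K / 2 * X + s ^ Suc j" using W by (simp add: algebra_simps)
    also have "s * K / 2 * X \<le> 1 / 2 * X" using sK XY by (intro mult_right_mono) auto
    finally have "X \<le> s * K * Y + 2 * s ^ Suc j" by simp
    also have "s * K * Y \<le> s * K * (C * s ^ j)" using Y s K by (intro mult_left_mono) auto
    finally have "X \<le> (K * C + 2) * s ^ Suc j" by (simp add: algebra_simps)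
    thus ?case using XY s unfolding X_def z_def \<tau>_def s_def by (simp add: abs_of_nonneg)
  qed
  thus ?case by (rule bigoI)
qed

lemma momA_bigo:
  assumes "n \<ge> 2 * N"
  shows "(\<lambda>p. momA n (fst p) (snd p)) \<in> inner_O N"
proof -
  have le: "\<bar>momA n z \<tau>\<bar> \<le> momA (2 * N) z \<tau> + momA (2 * n) z \<tau>" for z \<tau>
  proof -
    have "\<bar>momA n z \<tau>\<bar> \<le> inner_avg z \<tau> (\<lambda>s. xvar \<tau> s ^ (2 * N) + xvar \<tau> s ^ (2 * n))"
      unfolding momA_def
    proof (rule avg_abs_le)
      fix s :: real
      define x where "x = xvar \<tau> s"
      have ev: "x ^ (2 * k) = \<bar>x\<bar> ^ (2 * k)" for k by (simp add: power_mult)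
      show "\<bar>x ^ n\<bar> \<le> x ^ (2 * N) + x ^ (2 * n)"
      proof (cases "\<bar>x\<bar> \<le> 1")
        case True
        have "\<bar>x\<bar> ^ n \<le> \<bar>x\<bar> ^ (2 * N)" using True assms by (intro power_decreasing) auto
        thus ?thesis unfolding ev by (simp add: power_abs add_increasing2)
      next
        case False
        have "\<bar>x\<bar> ^ n \<le> \<bar>x\<bar> ^ (2 * n)" using False by (intro power_increasing) auto
        thus ?thesis unfolding ev by (simp add: power_abs add_increasing)
      qed
    qed (intro poly_intros)+
    also have "\<dots> = momA (2 * N) z \<tau> + momA (2 * n) z \<tau>" unfolding momA_def by (rule avg_add; intro poly_intros)
    finally show ?thesis .
  qed
  have "(\<lambda>p. momA n (fst p) (snd p)) \<in> O[inner_filter](\<lambda>p. momA (2 * N) (fst p) (snd p) + momA (2 * n) (fst p) (snd p))"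
    by (rule bigoI[of _ 1]) (use le in \<open>auto intro!: always_eventually order_trans[OF le]\<close>)
  also have "(\<lambda>p. momA (2 * N) (fst p) (snd p) + momA (2 * n) (fst p) (snd p)) \<in> inner_O N"
    by (rule sum_in_bigo(1)[OF momA_even_bigo landau_o.big_trans[OF momA_even_bigo spread_power_bigo]]) (use assms in auto)
  finally show ?thesis .
qed

lemma momB_0_bigo: "(\<lambda>p. momB 0 (fst p) (snd p)) \<in> O[inner_filter](\<lambda>p. 1)"
proof -
  have le: "\<bar>momB 0 z \<tau>\<bar> \<le> 2 + momA 1 z \<tau>" if \<tau>: "\<tau> > 0" for z \<tau>
  proof -
    have "\<bar>momB 0 z \<tau>\<bar> \<le> inner_avg z \<tau> (\<lambda>s. 2 + xvar \<tau> s ^ 1)"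
      unfolding momB_def
    proof (rule avg_abs_le)
      fix s :: real
      define r where "r = rvar \<tau> s"
      have "0 \<le> (\<bar>r\<bar> - 1)\<^sup>2" by simp
      also have "\<dots> = r\<^sup>2 + 1 - 2 * \<bar>r\<bar>" by (simp add: power2_diff)
      finally have "\<bar>r\<bar> \<le> r\<^sup>2 + 1" by (smt (verit) abs_ge_zero)
      thus "\<bar>rvar \<tau> s * xvar \<tau> s ^ 0\<bar> \<le> 2 + xvar \<tau> s ^ 1"
        using rescaled_square[OF \<tau>, of s] unfolding r_def by simp
    qed (intro poly_intros)+
    also have "\<dots> = 2 + momA 1 z \<tau>" unfolding momA_def by (subst avg_add, (intro poly_intros)+) (simp only: avg_const)
    finally show ?thesis .
  qed
  have "\<forall>\<^sub>F p in inner_filter. norm (momB 0 (fst p) (snd p)) \<le> 1 * norm (2 + momA 1 (fst p) (snd p))"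
    using eventually_spread_less[of 1, simplified]
  proof eventually_elim
    case (elim p)
    hence "\<bar>momB 0 (fst p) (snd p)\<bar> \<le> 2 + momA 1 (fst p) (snd p)" by (intro le) simp
    also have "\<dots> \<le> \<bar>2 + momA 1 (fst p) (snd p)\<bar>" by (rule abs_ge_self)
    finally show ?case by simp
  qed
  hence "(\<lambda>p. momB 0 (fst p) (snd p)) \<in> O[inner_filter](\<lambda>p. 2 + momA 1 (fst p) (snd p))" by (rule bigoI)
  also have "(\<lambda>p. 2 + momA 1 (fst p) (snd p)) \<in> O[inner_filter](\<lambda>p. 1)"
    by (rule sum_in_bigo(1)) (use momA_bigo[of 0 1] in auto)
  finally show ?thesis .
qed

section \<open>Expansion across the shock\<close>

definition errA :: "nat \<Rightarrow> nat \<Rightarrow> real \<times> real \<Rightarrow> real" where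
  "errA N n p = momA n (fst p) (snd p) - (\<Sum>k<N. eps (snd p) ^ k * coefA n k (fst p))"

definition errB :: "nat \<Rightarrow> nat \<Rightarrow> real \<times> real \<Rightarrow> real" where
  "errB N n p = momB n (fst p) (snd p) - (\<Sum>k<N. eps (snd p) ^ k * coefB n k (fst p))"

lemma errA_recursion:
  assumes "snd p > 0"
  shows "errA (Suc N) (Suc n) p = eps (snd p) / 4 * ((1 + 2 * real n) * errA N n p
     + 2 * real n * errA N (n - 1) p - fst p * errB N n p) - errA (Suc N) (n + 2) p"
proof -
  define e where "e = eps (snd p)"
  define z where "z = fst p"
  have "(\<Sum>k<Suc N. e ^ k * coefA (Suc n) k z) + (\<Sum>k<Suc N. e ^ k * coefA (n + 2) k z)
    = (\<Sum>k<N. e ^ Suc k * (coefA (Suc n) (Suc k) z + coefA (n + 2) (Suc k) z))"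
    unfolding sum.lessThan_Suc_shift by (simp add: coefA_vanish sum.distrib[symmetric] ring_distribs)
  also have "\<dots> = e / 4 * ((1 + 2 * real n) * (\<Sum>k<N. e ^ k * coefA n k z)
     + 2 * real n * (\<Sum>k<N. e ^ k * coefA (n - 1) k z) - z * (\<Sum>k<N. e ^ k * coefB n k z))"
    unfolding coefA_recursion sum_distrib_left sum.distrib[symmetric] sum_subtractf[symmetric]
    by (intro sum.cong) (auto simp: algebra_simps add_divide_distrib diff_divide_distrib)
  finally have "(\<Sum>k<Suc N. e ^ k * coefA (Suc n) k z) = e / 4 * ((1 + 2 * real n) * (\<Sum>k<N. e ^ k * coefA n k z)
     + 2 * real n * (\<Sum>k<N. e ^ k * coefA (n - 1) k z) - z * (\<Sum>k<N. e ^ k * coefB n k z)) - (\<Sum>k<Suc N. e ^ k * coefA (n + 2) k z)"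
    by linarith
  moreover have "momA (Suc n) z (snd p) = e / 4 * ((1 + 2 * real n) * momA n z (snd p) + 2 * real n * momA (n - 1) z (snd p) - z * momB n z (snd p)) - momA (n + 2) z (snd p)"
    using momA_recursion(1)[OF assms, of n z] unfolding e_def by linarith
  ultimately show ?thesis unfolding errA_def errB_def e_def[symmetric] z_def[symmetric]
    by (simp only:) (simp only: algebra_simps)
qed

lemma errB_recursion:
  assumes "snd p > 0"
  shows "errB (Suc N) (Suc n) p = eps (snd p) / 4 * (2 * real n * errB N (n - 1) p - fst p * errA N n p)"
proof -
  define e where "e = eps (snd p)"
  define z where "z = fst p"
  have "(\<Sum>k<Suc N. e ^ k * coefB (Suc n) k z) = (\<Sum>k<N. e ^ Suc k * coefB (Suc n) (Suc k) z)"
    unfolding sum.lessThan_Suc_shift by (simp add: coefB_Suc_0)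
  also have "\<dots> = e / 4 * (2 * real n * (\<Sum>k<N. e ^ k * coefB (n - 1) k z) - z * (\<Sum>k<N. e ^ k * coefA n k z))"
    unfolding coefB_Suc_Suc sum_distrib_left sum.distrib[symmetric] sum_subtractf[symmetric]
    by (intro sum.cong) (auto simp: algebra_simps add_divide_distrib diff_divide_distrib)
  finally have "(\<Sum>k<Suc N. e ^ k * coefB (Suc n) k z) = e / 4 * (2 * real n * (\<Sum>k<N. e ^ k * coefB (n - 1) k z) - z * (\<Sum>k<N. e ^ k * coefA n k z))" .
  moreover have "momB (Suc n) z (snd p) = e / 4 * (2 * real n * momB (n - 1) z (snd p) - z * momA n z (snd p))"
    using momB_recursion[OF assms, of n z] unfolding e_def .
  ultimately show ?thesis unfolding errA_def errB_def e_def[symmetric] z_def[symmetric]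
    by (simp only:) (simp only: algebra_simps)
qed

lemma eps_mult_bigo:
  assumes "f \<in> inner_O N"
  shows "(\<lambda>p. eps (snd p) * f p) \<in> inner_O (Suc N)"
    and "(\<lambda>p. eps (snd p) * fst p * f p) \<in> inner_O (Suc N)"
  using landau_o.big.mult[OF eps_bigo assms] landau_o.big.mult[OF eps_ident_bigo assms] by simp_all

lemma errB_Suc_bigo:
  assumes "\<And>n. errA N n \<in> inner_O N" "\<And>n. errB N n \<in> inner_O N"
  shows "errB (Suc N) (Suc n) \<in> inner_O (Suc N)"
proof -
  have 1: "(\<lambda>p. real n / 2 * (eps (snd p) * errB N (n - 1) p)) \<in> inner_O (Suc N)"
    by (rule cmult_in_bigo_iff[THEN iffD2, OF disjI2, OF eps_mult_bigo(1)[OF assms(2)]])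
  have 2: "(\<lambda>p. 1 / 4 * (eps (snd p) * fst p * errA N n p)) \<in> inner_O (Suc N)"
    by (rule cmult_in_bigo_iff[THEN iffD2, OF disjI2, OF eps_mult_bigo(2)[OF assms(1)]])
  have "\<forall>\<^sub>F p in inner_filter. errB (Suc N) (Suc n) p =
     real n / 2 * (eps (snd p) * errB N (n - 1) p) - 1 / 4 * (eps (snd p) * fst p * errA N n p)"
    using eventually_spread_less[of 1, OF zero_less_one]
    by eventually_elim (simp add: errB_recursion algebra_simps)
  from landau_o.big.in_cong[OF this] sum_in_bigo(2)[OF 1 2] show ?thesis by simp
qed

text \<open>
  Downward induction on \<open>n\<close>: for \<open>n \<ge> 2 (N + 1)\<close> the moment itself is
  small enough and its coefficients up to order \<open>N\<close> vanish.
\<close>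

lemma errA_Suc_bigo:
  assumes "\<And>n. errA N n \<in> inner_O N" "\<And>n. errB N n \<in> inner_O N"
  shows "errA (Suc N) n \<in> inner_O (Suc N)"
proof (induction "2 * Suc N - n" arbitrary: n rule: less_induct)
  case less
  consider "n = 0" | "n \<ge> 2 * Suc N" | m where "n = Suc m" "n < 2 * Suc N"
    by (cases n) (simp, use not_less in blast)
  thus ?case
  proof cases
    case 1
    have "errA (Suc N) n = (\<lambda>p. 0)"
      unfolding 1 errA_def[abs_def] by (simp add: momA_0 coefA_0 sum.delta if_distrib cong: if_cong)
    thus ?thesis by simp
  next
    case 2
    have "(\<Sum>k<Suc N. eps (snd p) ^ k * coefA n k (fst p)) = 0" for p
      using 2 by (intro sum.neutral) (auto simp: coefA_vanish)
    hence "errA (Suc N) n = (\<lambda>p. momA n (fst p) (snd p))" unfolding errA_def[abs_def] by simp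
    thus ?thesis using momA_bigo[OF 2] by simp
  next
    case 3
    have a: "(\<lambda>p. (1 + 2 * real m) / 4 * (eps (snd p) * errA N m p)) \<in> inner_O (Suc N)"
      by (rule cmult_in_bigo_iff[THEN iffD2, OF disjI2, OF eps_mult_bigo(1)[OF assms(1)]])
    have b: "(\<lambda>p. real m / 2 * (eps (snd p) * errA N (m - 1) p)) \<in> inner_O (Suc N)"
      by (rule cmult_in_bigo_iff[THEN iffD2, OF disjI2, OF eps_mult_bigo(1)[OF assms(1)]])
    have c: "(\<lambda>p. 1 / 4 * (eps (snd p) * fst p * errB N m p)) \<in> inner_O (Suc N)"
      by (rule cmult_in_bigo_iff[THEN iffD2, OF disjI2, OF eps_mult_bigo(2)[OF assms(2)]])
    have d: "errA (Suc N) (m + 2) \<in> inner_O (Suc N)"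
      by (rule less) (use 3 in auto)
    have "\<forall>\<^sub>F p in inner_filter. errA (Suc N) n p =
       (1 + 2 * real m) / 4 * (eps (snd p) * errA N m p) + real m / 2 * (eps (snd p) * errA N (m - 1) p)
       - 1 / 4 * (eps (snd p) * fst p * errB N m p) - errA (Suc N) (m + 2) p"
      using eventually_spread_less[of 1, OF zero_less_one]
    proof eventually_elim
      case (elim p)
      have "errA (Suc N) n p = eps (snd p) / 4 * ((1 + 2 * real m) * errA N m p
        + 2 * real m * errA N (m - 1) p - fst p * errB N m p) - errA (Suc N) (m + 2) p"
        unfolding 3(1) by (rule errA_recursion) (use elim in simp)
      thus ?case by (simp add: algebra_simps add_divide_distrib diff_divide_distrib)
    qed
    from landau_o.big.in_cong[OF this] sum_in_bigo(2)[OF sum_in_bigo(2)[OF sum_in_bigo(1)[OF a b] c] d]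
    show ?thesis by simp
  qed
qed

lemma coef_sum_bigo:
  assumes "\<And>k. k \<in> I \<Longrightarrow> poly_growth (m k) (f k) \<and> N \<le> m k"
  shows "(\<lambda>p. \<Sum>k\<in>I. eps (snd p) ^ m k * f k (fst p)) \<in> inner_O N"
  using assms
  by (intro big_sum_in_bigo landau_o.big_trans[OF coef_term_bigo spread_power_bigo]) auto

text \<open>
  In the terms that are left over the two indices add up to more than \<open>N\<close>, which makes the
  discrepancy between the square of a partial sum and the truncated Cauchy product a term of the next
  order.
\<close>

lemma square_truncation:
  fixes a :: "nat \<Rightarrow> real"
  shows "(\<Sum>k\<le>N. a k)\<^sup>2 - (\<Sum>k\<le>N. \<Sum>i\<le>k. a i * a (k - i)) = (\<Sum>(i, j)\<in>{..N} \<times> {..N} - {(i, j). i + j \<le> N}. a i * a j)"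
proof -
  have "(\<Sum>k\<le>N. \<Sum>i\<le>k. a i * a (k - i)) = (\<Sum>(i, j)\<in>{(i, j). i + j \<le> N}. a i * a j)"
    by (rule sum.triangle_reindex_eq[symmetric])
  moreover have "(\<Sum>k\<le>N. a k)\<^sup>2 = (\<Sum>(i, j)\<in>{..N} \<times> {..N}. a i * a j)"
    by (simp add: power2_eq_square sum_product sum.cartesian_product)
  moreover have "(\<Sum>(i, j)\<in>{..N} \<times> {..N} - {(i, j). i + j \<le> N}. a i * a j) =
     (\<Sum>(i, j)\<in>{..N} \<times> {..N}. a i * a j) - (\<Sum>(i, j)\<in>{(i, j). i + j \<le> N}. a i * a j)"
    by (rule sum_diff) auto
  ultimately show ?thesis by simp
qed

text \<open>
  With \<open>Y\<close> the partial sum for \<open>B\<^sub>0\<close>, the error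
  \<open>e = B\<^sub>0 - Y\<close> satisfies \<open>e' = (B\<^sub>0 + Y) e + R\<close>, where
  \<open>R\<close> collects the error of \<open>A\<^sub>1\<close> and the tail of \<open>Y^2\<close>.
  For \<open>z \<ge> 0\<close> the sign of \<open>B\<^sub>0\<close> and
  \<open>Y = - tanh z + O(\<sigma>)\<close> bound the coefficient \<open>B\<^sub>0 + Y\<close>
  from above by \<open>1/2 - tanh z\<close>, so nothing about the size of \<open>e\<close> has to be
  known beforehand.
\<close>

lemma errB_0_Suc_bigo:
  assumes A: "errA (Suc N) 1 \<in> inner_O (Suc N)"
  shows "errB (Suc N) 0 \<in> inner_O (Suc N)"
proof -
  define Y where "Y = (\<lambda>p. \<Sum>k\<le>N. eps (snd p) ^ k * coefB 0 k (fst p))"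
  define S where "S = (\<lambda>p. \<Sum>k\<le>N. eps (snd p) ^ k * (\<Sum>i\<le>k. coefB 0 i (fst p) * coefB 0 (k - i) (fst p)))"
  define R where "R = (\<lambda>p. (Y p)\<^sup>2 - S p - errA (Suc N) 1 p)"
  have "(\<lambda>p. (Y p)\<^sup>2 - S p) \<in> inner_O (Suc N)"
  proof -
    have "(Y p)\<^sup>2 - S p = (\<Sum>ij\<in>{..N} \<times> {..N} - {(i, j). i + j \<le> N}.
        eps (snd p) ^ (fst ij + snd ij) * (coefB 0 (fst ij) (fst p) * coefB 0 (snd ij) (fst p)))" for p
    proof -
      have S: "S p = (\<Sum>k\<le>N. \<Sum>i\<le>k. (eps (snd p) ^ i * coefB 0 i (fst p)) * (eps (snd p) ^ (k - i) * coefB 0 (k - i) (fst p)))"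
        unfolding S_def sum_distrib_left
      proof (intro sum.cong refl)
        fix k i :: nat assume "i \<in> {..k}"
        hence "eps (snd p) ^ k = eps (snd p) ^ i * eps (snd p) ^ (k - i)" by (simp flip: power_add)
        thus "eps (snd p) ^ k * (coefB 0 i (fst p) * coefB 0 (k - i) (fst p)) =
          (eps (snd p) ^ i * coefB 0 i (fst p)) * (eps (snd p) ^ (k - i) * coefB 0 (k - i) (fst p))" by simp
      qed
      have "(Y p)\<^sup>2 - S p = (\<Sum>(i, j)\<in>{..N} \<times> {..N} - {(i, j). i + j \<le> N}.
          (eps (snd p) ^ i * coefB 0 i (fst p)) * (eps (snd p) ^ j * coefB 0 j (fst p)))"
        unfolding Y_def S by (rule square_truncation)
      thus ?thesis by (simp only: case_prod_unfold power_add mult_ac)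
    qed
    moreover have "(\<lambda>p. \<Sum>ij\<in>{..N} \<times> {..N} - {(i, j). i + j \<le> N}.
        eps (snd p) ^ (fst ij + snd ij) * (\<lambda>z. coefB 0 (fst ij) z * coefB 0 (snd ij) z) (fst p)) \<in> inner_O (Suc N)"
      by (rule coef_sum_bigo) (use poly_growth_coefs in \<open>auto intro!: poly_growth_mult\<close>)
    ultimately show ?thesis by simp
  qed
  from sum_in_bigo(2)[OF this A] have R: "R \<in> inner_O (Suc N)" unfolding R_def .
  obtain C where C: "C > 0" "\<forall>\<^sub>F p in inner_filter. norm (R p) \<le> C * norm (spread p ^ Suc N)"
    using R by (elim landau_o.bigE)
  have "(\<lambda>p. \<Sum>k\<in>{1..N}. eps (snd p) ^ k * coefB 0 k (fst p)) \<in> inner_O 1"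
    by (rule coef_sum_bigo) (use poly_growth_coefs in auto)
  then obtain C' where C': "C' > 0" "\<forall>\<^sub>F p in inner_filter. norm (\<Sum>k\<in>{1..N}. eps (snd p) ^ k * coefB 0 k (fst p)) \<le> C' * norm (spread p ^ 1)"
    by (elim landau_o.bigE)
  have tanh: "Y p + tanh (fst p) = (\<Sum>k\<in>{1..N}. eps (snd p) ^ k * coefB 0 k (fst p))" for p
  proof -
    have "{..N} = insert 0 {1..N}" by auto
    thus ?thesis unfolding Y_def by (simp add: coefB_0_0)
  qed
  have "\<forall>\<^sub>F p in inner_filter. \<bar>Y p + tanh (fst p)\<bar> \<le> 1 / 2"
  proof -
    have "1 / (2 * C') > 0" using C'(1) by simp
    from C'(2) eventually_spread_less[OF this] show ?thesis
    proof eventually_elim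
      case (elim p)
      hence "C' * spread p \<le> C' * (1 / (2 * C'))" using C'(1) by (intro mult_left_mono) auto
      hence "C' * spread p \<le> 1 / 2" using C'(1) by simp
      thus ?case using elim unfolding tanh by simp
    qed
  qed
  with C(2) have "\<forall>\<^sub>F p in inner_filter. norm (R p) \<le> C * norm (spread p ^ Suc N) \<and> \<bar>Y p + tanh (fst p)\<bar> \<le> 1 / 2"
    by eventually_elim auto
  then obtain s0 where s0: "s0 > 0" "\<And>p. snd p > 0 \<Longrightarrow> spread p < s0 \<Longrightarrow>
     norm (R p) \<le> C * norm (spread p ^ Suc N) \<and> \<bar>Y p + tanh (fst p)\<bar> \<le> 1 / 2"
    unfolding eventually_inner_filter by blast
  \<comment> \<open>\<open>spread\<close> increases with \<open>|z|\<close>, so its value at the endpoint serves on the whole interval.\<close>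
  have "norm (errB (Suc N) 0 p) \<le> 4 * C * norm (spread p ^ Suc N)" if p: "snd p > 0" "spread p < s0" for p
  proof -
    define \<tau> where "\<tau> = snd p"
    define z where "z = fst p"
    have pz: "p = (z, \<tau>)" and \<tau>: "\<tau> > 0" using p by (auto simp: z_def \<tau>_def)
    have mono: "spread (t, \<tau>) \<le> spread p" if "\<bar>t\<bar> \<le> \<bar>z\<bar>" for t
      unfolding spread_def pz fst_conv snd_conv using that eps_pos[OF \<tau>] by (intro mult_right_mono) auto
    have small: "\<bar>R (t, \<tau>)\<bar> \<le> C * spread p ^ Suc N" "\<bar>Y (t, \<tau>) + tanh t\<bar> \<le> 1 / 2" if t: "\<bar>t\<bar> \<le> \<bar>z\<bar>" for t
    proof -
      have pos: "spread (t, \<tau>) > 0" using spread_pos[of "(t, \<tau>)"] \<tau> by simp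
      have *: "norm (R (t, \<tau>)) \<le> C * norm (spread (t, \<tau>) ^ Suc N)" "\<bar>Y (t, \<tau>) + tanh t\<bar> \<le> 1 / 2"
        using s0(2)[of "(t, \<tau>)"] mono[OF t] p \<tau> by auto
      have "spread (t, \<tau>) ^ Suc N \<le> spread p ^ Suc N" using mono[OF t] pos by (intro power_mono) auto
      hence "C * spread (t, \<tau>) ^ Suc N \<le> C * spread p ^ Suc N" using C(1) by (intro mult_left_mono) auto
      thus "\<bar>R (t, \<tau>)\<bar> \<le> C * spread p ^ Suc N" using *(1) pos by simp
      show "\<bar>Y (t, \<tau>) + tanh t\<bar> \<le> 1 / 2" by (rule *)
    qed
    have sumN: "{..<Suc N} = {..N}" by auto
    have eB: "errB (Suc N) 0 (t, \<tau>) = momB 0 t \<tau> - Y (t, \<tau>)" for t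
      unfolding errB_def Y_def sumN by simp
    have "\<bar>(\<lambda>t. errB (Suc N) 0 (t, \<tau>)) z\<bar> \<le> 4 * (C * spread p ^ Suc N)"
    proof (rule stable_linear_ode_bound[where e = "\<lambda>t. errB (Suc N) 0 (t, \<tau>)"
          and p = "\<lambda>t. momB 0 t \<tau> + Y (t, \<tau>)" and r = "\<lambda>t. R (t, \<tau>)"])
      show "errB (Suc N) 0 (0, \<tau>) = 0" by (simp add: errB_def momB_0_at_0 coefB_0_at_0)
    next
      fix t assume t: "\<bar>t\<bar> \<le> \<bar>z\<bar>"
      have "((\<lambda>t. momB 0 t \<tau> - (\<Sum>k\<le>N. eps \<tau> ^ k * coefB 0 k t)) has_real_derivative
        ((momB 0 t \<tau>)\<^sup>2 - 1 - momA 1 t \<tau>) - (\<Sum>k\<le>N. eps \<tau> ^ k * coefB' 0 k t)) (at t)"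
        by (intro DERIV_diff momB_0_riccati[OF \<tau>] DERIV_sum DERIV_cmult coefB_deriv)
      moreover have "(\<Sum>k\<le>N. eps \<tau> ^ k * coefB' 0 k t) = S (t, \<tau>) - 1 - (\<Sum>k\<le>N. eps \<tau> ^ k * coefA 1 k t)"
      proof -
        have "(\<Sum>k\<le>N. eps \<tau> ^ k * coefB' 0 k t) = S (t, \<tau>) - (\<Sum>k\<le>N. eps \<tau> ^ k * (if k = 0 then 1 else 0)) - (\<Sum>k\<le>N. eps \<tau> ^ k * coefA 1 k t)"
          unfolding riccati_coefficients S_def by (simp add: right_diff_distrib sum_subtractf)
        also have "(\<Sum>k\<le>N. eps \<tau> ^ k * (if k = 0 then 1 else 0)) = 1"
          by (simp add: if_distrib sum.delta cong: if_cong)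
        finally show ?thesis .
      qed
      moreover have "R (t, \<tau>) = (Y (t, \<tau>))\<^sup>2 - S (t, \<tau>) - (momA 1 t \<tau> - (\<Sum>k\<le>N. eps \<tau> ^ k * coefA 1 k t))"
        unfolding R_def errA_def sumN by simp
      ultimately have "((\<lambda>t. momB 0 t \<tau> - (\<Sum>k\<le>N. eps \<tau> ^ k * coefB 0 k t)) has_real_derivative
         (momB 0 t \<tau> + Y (t, \<tau>)) * (momB 0 t \<tau> - Y (t, \<tau>)) + R (t, \<tau>)) (at t)"
        by (elim DERIV_cong) (simp add: algebra_simps power2_eq_square)
      thus "((\<lambda>t. errB (Suc N) 0 (t, \<tau>)) has_real_derivative
         (momB 0 t \<tau> + Y (t, \<tau>)) * errB (Suc N) 0 (t, \<tau>) + R (t, \<tau>)) (at t)"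
        unfolding eB by (simp add: Y_def)
      show "\<bar>R (t, \<tau>)\<bar> \<le> C * spread p ^ Suc N" by (rule small[OF t])
      show "momB 0 t \<tau> + Y (t, \<tau>) \<le> 1 / 2 - tanh t" if "t \<ge> 0"
      proof -
        have "momB 0 t \<tau> \<le> 0" using momB_0_decreasing[OF \<tau> that] by (simp add: momB_0_at_0)
        thus ?thesis using small(2)[OF t] unfolding abs_le_iff by linarith
      qed
      show "- (momB 0 t \<tau> + Y (t, \<tau>)) \<le> 1 / 2 + tanh t" if "t \<le> 0"
      proof -
        have "momB 0 t \<tau> \<ge> 0" using momB_0_decreasing[OF \<tau> that] by (simp add: momB_0_at_0)
        thus ?thesis using small(2)[OF t] unfolding abs_le_iff by linarith
      qed
    qed
    thus ?thesis using spread_pos[of p] p by (simp add: pz)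
  qed
  hence "\<forall>\<^sub>F p in inner_filter. norm (errB (Suc N) 0 p) \<le> 4 * C * norm (spread p ^ Suc N)"
    unfolding eventually_inner_filter using s0(1) by blast
  thus ?thesis by (rule bigoI)
qed

text \<open>
  Order \<open>0\<close> is boundedness. Order \<open>N + 1\<close> follows from order
  \<open>N\<close> by the recurrences for all moments except \<open>B\<^sub>0\<close>, and then for
  \<open>B\<^sub>0\<close> by the Riccati equation, which involves \<open>A\<^sub>1\<close> at the new
  order.
\<close>

lemma inner_expansion:
  "errA N n \<in> inner_O N \<and> errB N n \<in> inner_O N"
proof (induction N arbitrary: n)
  case 0
  have A: "errA 0 n = (\<lambda>p. momA n (fst p) (snd p))" and B: "errB 0 n = (\<lambda>p. momB n (fst p) (snd p))" for n
    by (auto simp: errA_def errB_def)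
  have a: "errA 0 n \<in> inner_O 0" for n
    unfolding A using momA_bigo[of 0 n] by simp
  have "errB 0 n \<in> inner_O 0"
  proof (induction n rule: less_induct)
    case (less n)
    show ?case
    proof (cases n)
      case 0
      thus ?thesis unfolding B using momB_0_bigo by simp
    next
      case (Suc m)
      have "(\<lambda>p. real m / 2 * (eps (snd p) * errB 0 (m - 1) p)) \<in> inner_O (Suc 0)"
      proof (cases "m = 0")
        case False
        show ?thesis
          by (rule cmult_in_bigo_iff[THEN iffD2, OF disjI2, OF eps_mult_bigo(1)[OF less]]) (use Suc False in auto)
      qed simp
      moreover have "(\<lambda>p. 1 / 4 * (eps (snd p) * fst p * errA 0 m p)) \<in> inner_O (Suc 0)"
        by (rule cmult_in_bigo_iff[THEN iffD2, OF disjI2, OF eps_mult_bigo(2)[OF a]])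
      ultimately have "(\<lambda>p. real m / 2 * (eps (snd p) * errB 0 (m - 1) p) - 1 / 4 * (eps (snd p) * fst p * errA 0 m p))
         \<in> inner_O (Suc 0)" by (rule sum_in_bigo(2))
      from landau_o.big_trans[OF this spread_power_bigo[of 0 "Suc 0"]]
      have bound: "(\<lambda>p. real m / 2 * (eps (snd p) * errB 0 (m - 1) p) - 1 / 4 * (eps (snd p) * fst p * errA 0 m p))
         \<in> inner_O 0" by simp
      have "\<forall>\<^sub>F p in inner_filter. errB 0 n p =
          real m / 2 * (eps (snd p) * errB 0 (m - 1) p) - 1 / 4 * (eps (snd p) * fst p * errA 0 m p)"
        using eventually_spread_less[of 1, OF zero_less_one]
      proof eventually_elim
        case (elim p)
        hence "momB (Suc m) (fst p) (snd p) = eps (snd p) / 4 * (2 * real m * momB (m - 1) (fst p) (snd p) - fst p * momA m (fst p) (snd p))"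
          by (intro momB_recursion) simp
        thus ?case unfolding Suc A B by (simp add: algebra_simps)
      qed
      from landau_o.big.in_cong[OF this] bound show ?thesis by simp
    qed
  qed
  with a show ?case by blast
next
  case (Suc N)
  note IH = Suc
  have A: "errA (Suc N) n \<in> inner_O (Suc N)" for n
    by (rule errA_Suc_bigo) (use Suc in auto)
  have "errB (Suc N) n \<in> inner_O (Suc N)"
  proof (cases n)
    case 0
    show ?thesis unfolding 0 by (rule errB_0_Suc_bigo[OF A])
  next
    case (Suc m)
    show ?thesis unfolding Suc by (rule errB_Suc_bigo) (use IH in auto)
  qed
  with A show ?case by blast
qed

section \<open>The two expansions of the solution\<close>

definition burgers_filter :: "real \<Rightarrow> (real \<times> real) filter" where
  "burgers_filter \<gamma> = inf (filtercomap snd at_top) (principal (Omega2 \<gamma>))"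

definition inner_coords :: "real \<times> real \<Rightarrow> real \<times> real" where
  "inner_coords p = (fst p * sqrt (snd p) / 2, snd p)"

lemma filterlim_snd_burgers: "filterlim snd at_top (burgers_filter \<gamma>)"
  unfolding burgers_filter_def
  by (rule filterlim_mono[OF filterlim_filtercomap order.refl inf_le1])

lemma eventually_Omega2: "\<forall>\<^sub>F p in burgers_filter \<gamma>. p \<in> Omega2 \<gamma>"
  unfolding burgers_filter_def eventually_inf_principal by simp

text \<open>
  In \<open>\<Omega>\<^sub>2\<close> one has \<open>|z| < \<tau> powr \<gamma>\<close>, so
  \<open>\<sigma>\<close> is at most of the order of \<open>\<tau> powr (\<gamma> - 2)\<close>. This
  is where \<open>\<gamma> < 2\<close> enters.
\<close>

lemma spread_inner_coords_tendsto:
  assumes \<gamma>: "\<gamma> < 2"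
  shows "((\<lambda>p. spread (inner_coords p)) \<longlongrightarrow> 0) (burgers_filter \<gamma>)"
proof (rule tendsto_sandwich[where f = "\<lambda>_. 0" and h = "\<lambda>p. (1 + snd p powr \<gamma>) * (8 / (snd p)\<^sup>2)"])
  have "((\<lambda>\<tau>::real. (1 + \<tau> powr \<gamma>) * (8 / \<tau>\<^sup>2)) \<longlongrightarrow> 0) at_top"
  proof -
    have "((\<lambda>\<tau>::real. 8 * \<tau> powr - 2 + 8 * \<tau> powr (\<gamma> - 2)) \<longlongrightarrow> 8 * 0 + 8 * 0) at_top"
      by (intro tendsto_intros tendsto_neg_powr filterlim_ident) (use \<gamma> in auto)
    moreover have "\<forall>\<^sub>F \<tau>::real in at_top. 8 * \<tau> powr - 2 + 8 * \<tau> powr (\<gamma> - 2) = (1 + \<tau> powr \<gamma>) * (8 / \<tau>\<^sup>2)"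
      using eventually_gt_at_top[of 0]
    proof eventually_elim
      case (elim \<tau>)
      have "\<tau> powr - 2 = 1 / \<tau>\<^sup>2" "\<tau> powr (\<gamma> - 2) = \<tau> powr \<gamma> / \<tau>\<^sup>2"
        using elim by (simp_all add: powr_minus_divide powr_diff)
      thus ?case by (simp add: algebra_simps add_divide_distrib)
    qed
    ultimately show ?thesis by (simp add: filterlim_cong)
  qed
  from filterlim_compose[OF this filterlim_snd_burgers]
  show "((\<lambda>p. (1 + snd p powr \<gamma>) * (8 / (snd p)\<^sup>2)) \<longlongrightarrow> 0) (burgers_filter \<gamma>)" .
  show "\<forall>\<^sub>F p in burgers_filter \<gamma>. 0 \<le> spread (inner_coords p)"
    by (rule always_eventually) (simp add: spread_def inner_coords_def eps_def)
  show "\<forall>\<^sub>F p in burgers_filter \<gamma>. spread (inner_coords p) \<le> (1 + snd p powr \<gamma>) * (8 / (snd p)\<^sup>2)"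
    using eventually_Omega2
  proof eventually_elim
    case (elim p)
    hence \<tau>: "snd p > 0" and "\<bar>fst p\<bar> * snd p powr (1 / 2) < snd p powr \<gamma>"
      by (auto simp: Omega2_def case_prod_unfold)
    hence "\<bar>fst p\<bar> * sqrt (snd p) < snd p powr \<gamma>" by (simp add: powr_half_sqrt)
    moreover have "\<bar>fst p\<bar> * sqrt (snd p) / 2 \<le> \<bar>fst p\<bar> * sqrt (snd p)" using \<tau> by simp
    ultimately have "\<bar>fst p\<bar> * sqrt (snd p) / 2 \<le> snd p powr \<gamma>" by linarith
    thus ?case using \<tau> unfolding spread_def inner_coords_def eps_def fst_conv snd_conv
      by (intro mult_right_mono) (auto simp: abs_mult)
  qed
qed auto

lemma eventually_burgers_pos: "\<forall>\<^sub>F p in burgers_filter \<gamma>. snd p > 0"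
  using eventually_Omega2 by eventually_elim (auto simp: Omega2_def)

lemma filterlim_inner_coords:
  assumes "\<gamma> < 2"
  shows "filterlim inner_coords inner_filter (burgers_filter \<gamma>)"
  unfolding inner_filter_def
proof (rule filterlim_inf[THEN iffD2], intro conjI)
  have "\<forall>\<^sub>F p in burgers_filter \<gamma>. spread (inner_coords p) > 0"
    using eventually_burgers_pos by eventually_elim (simp add: spread_pos inner_coords_def)
  thus "filterlim inner_coords (filtercomap spread (at_right 0)) (burgers_filter \<gamma>)"
    unfolding filterlim_filtercomap_iff comp_def using spread_inner_coords_tendsto[OF assms]
    by (intro tendsto_imp_filterlim_at_right)
  show "filterlim inner_coords (principal {p. snd p > 0}) (burgers_filter \<gamma>)"
    unfolding filterlim_principal using eventually_burgers_pos
    by eventually_elim (simp add: inner_coords_def)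
qed

lemma w10_eq_momB:
  assumes "\<tau> > 0"
  shows "w10 \<phi> \<xi> \<tau> = sqrt \<tau> / deriv (deriv \<phi>) 0 * momB 0 (\<xi> * sqrt \<tau> / 2) \<tau>"
proof -
  have \<xi>: "2 * (\<xi> * sqrt \<tau> / 2) / sqrt \<tau> = \<xi>" using assms by simp
  have "(\<lambda>s. rvar \<tau> s * xvar \<tau> s ^ 0) = (\<lambda>s. 2 / sqrt \<tau> * s)" by auto
  hence "momB 0 (\<xi> * sqrt \<tau> / 2) \<tau> = 2 / sqrt \<tau> * avg \<xi> \<tau> (\<lambda>s. s)"
    unfolding momB_def \<xi> by (simp only: avg_cmult)
  thus ?thesis unfolding w10_eq_avg using assms by simp
qed

lemma gauge_le:
  assumes "\<tau> > 0"
  shows "spread (z, \<tau>) ^ n \<le> 16 ^ n * ((1 + \<bar>z\<bar> ^ n) / \<tau> ^ (2 * n))"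
proof -
  have "spread (z, \<tau>) ^ n = (1 + \<bar>z\<bar>) ^ n * (8 ^ n / \<tau> ^ (2 * n))"
    by (simp only: spread_def eps_def fst_conv snd_conv power_mult_distrib power_divide power_mult)
  also have "\<dots> \<le> (2 ^ n * (1 + \<bar>z\<bar> ^ n)) * (8 ^ n / \<tau> ^ (2 * n))"
    using assms by (intro mult_right_mono one_plus_power_le) auto
  also have "\<dots> = 16 ^ n * ((1 + \<bar>z\<bar> ^ n) / \<tau> ^ (2 * n))"
  proof -
    have "(16::real) ^ n = 2 ^ n * 8 ^ n" by (simp flip: power_mult_distrib)
    thus ?thesis by simp
  qed
  finally show ?thesis .
qed

lemma gauge_Suc_le:
  assumes "\<tau> > 0"
  shows "(1 + \<bar>z\<bar> ^ Suc n) / \<tau> ^ (2 * Suc n) \<le> spread (z, \<tau>) * ((1 + \<bar>z\<bar> ^ n) / \<tau> ^ (2 * n))"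
proof -
  have "1 + \<bar>z\<bar> ^ Suc n \<le> (1 + \<bar>z\<bar>) * (1 + \<bar>z\<bar> ^ n)" by (simp add: algebra_simps)
  hence "(1 + \<bar>z\<bar> ^ Suc n) / \<tau> ^ (2 * Suc n) \<le> ((1 + \<bar>z\<bar>) * (1 + \<bar>z\<bar> ^ n)) / \<tau> ^ (2 * Suc n)"
    using assms by (intro divide_right_mono) auto
  also have "\<dots> = ((1 + \<bar>z\<bar>) * (1 / \<tau>\<^sup>2)) * ((1 + \<bar>z\<bar> ^ n) / \<tau> ^ (2 * n))"
    by (simp add: power_add power2_eq_square)
  also have "\<dots> \<le> spread (z, \<tau>) * ((1 + \<bar>z\<bar> ^ n) / \<tau> ^ (2 * n))"
    unfolding spread_def eps_def using assms by (intro mult_right_mono mult_left_mono) (auto intro!: divide_right_mono)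
  finally show ?thesis .
qed

lemma w10_burgers_expansion:
  assumes \<gamma>: "\<gamma> < 2" and a: "deriv (deriv \<phi>) 0 \<noteq> 0"
  shows "\<exists>(q :: nat \<Rightarrow> real \<Rightarrow> real) (M :: nat \<Rightarrow> real).
        (\<forall>z. q 0 z = - tanh z / deriv (deriv \<phi>) 0) \<and>
        (\<forall>k\<ge>1. smooth (q k)) \<and>
        (\<forall>k\<ge>1. \<forall>z. burgers_coeff (deriv (deriv \<phi>) 0) q k z = 0) \<and>
        (\<forall>k\<ge>1. \<forall>z. \<bar>q k z\<bar> \<le> M k * (1 + \<bar>z\<bar> ^ k)) \<and>
        asymptotic_series (burgers_filter \<gamma>)
          (\<lambda>(\<xi>, \<tau>). w10 \<phi> \<xi> \<tau>)
          (\<lambda>k (\<xi>, \<tau>). sqrt \<tau> * (q k (\<xi> * sqrt \<tau> / 2) / \<tau> ^ (2 * k)))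
          (\<lambda>k (\<xi>, \<tau>). sqrt \<tau> * ((1 + \<bar>\<xi> * sqrt \<tau> / 2\<bar> ^ k) / \<tau> ^ (2 * k)))"
proof -
  define a where "a = deriv (deriv \<phi>) 0"
  have a0: "a \<noteq> 0" using a by (simp add: a_def)
  define q where "q = (\<lambda>k z. 8 ^ k * coefB 0 k z / a)"
  define gauge where "gauge = (\<lambda>k (\<xi>, \<tau>). sqrt \<tau> * ((1 + \<bar>\<xi> * sqrt \<tau> / 2\<bar> ^ k) / \<tau> ^ (2 * k)))"
  have gauge: "gauge k p = sqrt (snd p) * ((1 + \<bar>fst (inner_coords p)\<bar> ^ k) / snd p ^ (2 * k))" for k p
    by (simp add: gauge_def case_prod_unfold inner_coords_def)
  have "\<exists>M. \<forall>z. \<bar>q k z\<bar> \<le> M * (1 + \<bar>z\<bar> ^ k)" for k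
  proof -
    obtain M where M: "M \<ge> 0" "\<And>z. \<bar>coefB 0 k z\<bar> \<le> M * (1 + \<bar>z\<bar>) ^ k"
      using poly_growth_coefs[of k 0] unfolding poly_growth_def by blast
    have "\<bar>q k z\<bar> \<le> (8 ^ k / \<bar>a\<bar> * M * 2 ^ k) * (1 + \<bar>z\<bar> ^ k)" for z
    proof -
      have "\<bar>q k z\<bar> = 8 ^ k / \<bar>a\<bar> * \<bar>coefB 0 k z\<bar>" by (simp add: q_def abs_mult)
      also have "\<dots> \<le> 8 ^ k / \<bar>a\<bar> * (M * (2 ^ k * (1 + \<bar>z\<bar> ^ k)))"
        using M one_plus_power_le[of "\<bar>z\<bar>" k]
        by (intro mult_left_mono order_trans[OF M(2)]) auto
      finally show ?thesis by (simp add: mult_ac)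
    qed
    thus ?thesis by blast
  qed
  hence "\<exists>M. \<forall>k z. \<bar>q k z\<bar> \<le> M k * (1 + \<bar>z\<bar> ^ k)" by (intro choice allI)
  then obtain M where M: "\<And>k z. \<bar>q k z\<bar> \<le> M k * (1 + \<bar>z\<bar> ^ k)" by blast
  have smooth: "smooth (q k)" for k
  proof -
    have "coef_algebra (\<lambda>z. (8 ^ k / a) * coefB 0 k z)" by (intro coef_algebra_cmult coef_algebra.coef)
    hence "coef_algebra (q k)" by (simp add: q_def)
    thus ?thesis by (rule coef_algebra_smooth)
  qed
  have "asymptotic_series (burgers_filter \<gamma>) (\<lambda>(\<xi>, \<tau>). w10 \<phi> \<xi> \<tau>)
          (\<lambda>k (\<xi>, \<tau>). sqrt \<tau> * (q k (\<xi> * sqrt \<tau> / 2) / \<tau> ^ (2 * k))) gauge"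
    unfolding asymptotic_series_def
  proof (intro conjI allI)
    fix n
    show "gauge (Suc n) \<in> o[burgers_filter \<gamma>](gauge n)"
    proof (rule landau_o.smallI)
      fix c :: real assume "c > 0"
      hence "\<forall>\<^sub>F p in burgers_filter \<gamma>. spread (inner_coords p) < c"
        by (intro order_tendstoD(2)[OF spread_inner_coords_tendsto[OF \<gamma>]])
      thus "\<forall>\<^sub>F p in burgers_filter \<gamma>. norm (gauge (Suc n) p) \<le> c * norm (gauge n p)"
        using eventually_burgers_pos
      proof eventually_elim
        case (elim p)
        define z where "z = fst (inner_coords p)"
        have ic: "inner_coords p = (z, snd p)" by (simp add: z_def inner_coords_def)
        have "(1 + \<bar>z\<bar> ^ Suc n) / snd p ^ (2 * Suc n) \<le> spread (z, snd p) * ((1 + \<bar>z\<bar> ^ n) / snd p ^ (2 * n))"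
          by (rule gauge_Suc_le) (use elim in simp)
        also have "\<dots> \<le> c * ((1 + \<bar>z\<bar> ^ n) / snd p ^ (2 * n))"
          using elim unfolding ic by (intro mult_right_mono) auto
        finally have "sqrt (snd p) * ((1 + \<bar>z\<bar> ^ Suc n) / snd p ^ (2 * Suc n)) \<le> sqrt (snd p) * (c * ((1 + \<bar>z\<bar> ^ n) / snd p ^ (2 * n)))"
          using elim by (intro mult_left_mono) auto
        moreover have "sqrt (snd p) * ((1 + \<bar>z\<bar> ^ k) / snd p ^ (2 * k)) \<ge> 0" for k using elim by simp
        ultimately show ?case unfolding gauge z_def[symmetric] real_norm_def
          by (simp only: abs_of_nonneg mult.left_commute)
      qed
    qed
  next
    fix n
    have "errB n 0 \<in> inner_O n" using inner_expansion by blast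
    from landau_o.big.compose[OF this filterlim_inner_coords[OF \<gamma>]]
    have "(\<lambda>p. errB n 0 (inner_coords p)) \<in> O[burgers_filter \<gamma>](\<lambda>p. spread (inner_coords p) ^ n)" .
    then obtain C where C: "C > 0" "\<forall>\<^sub>F p in burgers_filter \<gamma>. norm (errB n 0 (inner_coords p)) \<le> C * norm (spread (inner_coords p) ^ n)"
      by (elim landau_o.bigE)
    have "\<forall>\<^sub>F p in burgers_filter \<gamma>. norm ((case p of (\<xi>, \<tau>) \<Rightarrow> w10 \<phi> \<xi> \<tau>) -
         (\<Sum>k<n. case p of (\<xi>, \<tau>) \<Rightarrow> sqrt \<tau> * (q k (\<xi> * sqrt \<tau> / 2) / \<tau> ^ (2 * k)))) \<le> (C * 16 ^ n / \<bar>a\<bar>) * norm (gauge n p)"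
      using C(2) eventually_burgers_pos
    proof eventually_elim
      case (elim p)
      define z where "z = fst (inner_coords p)"
      define \<tau> where "\<tau> = snd p"
      have ic: "inner_coords p = (z, \<tau>)" by (simp add: z_def \<tau>_def inner_coords_def)
      have zz: "fst p * sqrt \<tau> / 2 = z" by (simp add: z_def \<tau>_def inner_coords_def)
      have p: "p = (fst p, \<tau>)" by (simp add: \<tau>_def)
      have \<tau>: "\<tau> > 0" using elim by (simp add: \<tau>_def)
      have coef: "sqrt \<tau> * (q k z / \<tau> ^ (2 * k)) = sqrt \<tau> / a * (eps \<tau> ^ k * coefB 0 k z)" for k
        by (simp add: q_def eps_def power_divide power_mult)
      have "(case p of (\<xi>, \<tau>) \<Rightarrow> w10 \<phi> \<xi> \<tau>) - (\<Sum>k<n. case p of (\<xi>, \<tau>) \<Rightarrow> sqrt \<tau> * (q k (\<xi> * sqrt \<tau> / 2) / \<tau> ^ (2 * k)))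
         = sqrt \<tau> / a * errB n 0 (z, \<tau>)"
        by (subst p, subst (2) p)
           (simp only: split zz coef w10_eq_momB[OF \<tau>] a_def[symmetric] errB_def fst_conv snd_conv sum_distrib_left right_diff_distrib)
      also have "norm \<dots> = sqrt \<tau> / \<bar>a\<bar> * \<bar>errB n 0 (z, \<tau>)\<bar>" using \<tau> by (simp add: abs_mult)
      also have "\<dots> \<le> sqrt \<tau> / \<bar>a\<bar> * (C * (16 ^ n * ((1 + \<bar>z\<bar> ^ n) / \<tau> ^ (2 * n))))"
      proof (intro mult_left_mono)
        have "spread (z, \<tau>) > 0" using spread_pos[of "(z, \<tau>)"] \<tau> by simp
        hence "\<bar>errB n 0 (z, \<tau>)\<bar> \<le> C * spread (z, \<tau>) ^ n" using elim(1) unfolding ic by simp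
        also have "\<dots> \<le> C * (16 ^ n * ((1 + \<bar>z\<bar> ^ n) / \<tau> ^ (2 * n)))"
          using gauge_le[OF \<tau>] C(1) by (intro mult_left_mono) auto
        finally show "\<bar>errB n 0 (z, \<tau>)\<bar> \<le> C * (16 ^ n * ((1 + \<bar>z\<bar> ^ n) / \<tau> ^ (2 * n)))" .
      qed (use \<tau> in auto)
      also have "\<dots> = (C * 16 ^ n / \<bar>a\<bar>) * norm (gauge n p)"
        using \<tau> unfolding gauge z_def[symmetric] \<tau>_def[symmetric] by simp
      finally show ?case .
    qed
    thus "(\<lambda>p. (case p of (\<xi>, \<tau>) \<Rightarrow> w10 \<phi> \<xi> \<tau>) -
         (\<Sum>k<n. case p of (\<xi>, \<tau>) \<Rightarrow> sqrt \<tau> * (q k (\<xi> * sqrt \<tau> / 2) / \<tau> ^ (2 * k)))) \<in> O[burgers_filter \<gamma>](gauge n)"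
      by (rule bigoI)
  qed
  moreover have "\<forall>z. q 0 z = - tanh z / a" by (simp add: q_def coefB_0_0)
  moreover have "\<forall>k\<ge>1. \<forall>z. burgers_coeff a q k z = 0" unfolding q_def using burgers_coefficients[OF a0] by blast
  ultimately show ?thesis using smooth M unfolding a_def gauge_def
    by (intro exI[of _ q] exI[of _ M]) blast
qed

theorem theorem1:
  fixes \<phi> :: "real \<Rightarrow> real" and \<gamma>\<^sub>1 \<gamma>\<^sub>2 :: real
  assumes "smooth \<phi>" and "\<And>x. deriv (deriv \<phi>) x > 0"
    and "0 < \<gamma>\<^sub>1" and "\<gamma>\<^sub>1 < \<gamma>\<^sub>2" and "\<gamma>\<^sub>2 < 2"
  shows
    "(\<exists>P :: nat \<Rightarrow> ((nat \<times> nat \<times> nat) \<Rightarrow>\<^sub>0 real).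
        (\<forall>l\<ge>1. homogeneous_of_power (P l) (1 - 4 * int l)) \<and>
        asymptotic_series
          (inf (filtercomap (\<lambda>(\<xi>, \<tau>). 3 * (H \<xi> \<tau>)\<^sup>2 - \<tau>) at_top) (principal (Omega1 \<gamma>\<^sub>1)))
          (\<lambda>(\<xi>, \<tau>). w10 \<phi> \<xi> \<tau>)
          (\<lambda>l (\<xi>, \<tau>). if l = 0 then inverse (deriv (deriv \<phi>) 0) * H \<xi> \<tau> else eval_poly3 (P l) \<xi> \<tau>)
          (\<lambda>l (\<xi>, \<tau>). (3 * (H \<xi> \<tau>)\<^sup>2 - \<tau>) powr ((1 - 4 * real l) / 2))) \<and>
     (\<exists>(q :: nat \<Rightarrow> real \<Rightarrow> real) (M :: nat \<Rightarrow> real).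
        (\<forall>z. q 0 z = - tanh z / deriv (deriv \<phi>) 0) \<and>
        (\<forall>k\<ge>1. smooth (q k)) \<and>
        (\<forall>k\<ge>1. \<forall>z. burgers_coeff (deriv (deriv \<phi>) 0) q k z = 0) \<and>
        (\<forall>k\<ge>1. \<forall>z. \<bar>q k z\<bar> \<le> M k * (1 + \<bar>z\<bar> ^ k)) \<and>
        asymptotic_series
          (inf (filtercomap snd at_top) (principal (Omega2 \<gamma>\<^sub>2)))
          (\<lambda>(\<xi>, \<tau>). w10 \<phi> \<xi> \<tau>)
          (\<lambda>k (\<xi>, \<tau>). sqrt \<tau> * (q k (\<xi> * sqrt \<tau> / 2) / \<tau> ^ (2 * k)))
          (\<lambda>k (\<xi>, \<tau>). sqrt \<tau> * ((1 + \<bar>\<xi> * sqrt \<tau> / 2\<bar> ^ k) / \<tau> ^ (2 * k))))"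
proof -
  have "deriv (deriv \<phi>) 0 \<noteq> 0" using assms(2)[of 0] by simp
  from w10_laplace_expansion[OF assms(3), of \<phi>] w10_burgers_expansion[OF assms(5) this]
  show ?thesis unfolding laplace_filter_def burgers_filter_def by (rule conjI)
qed

end
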